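(* Consider, for functions $f(t,x)$, $M(t,x)$ on $[0,1]^2$, the differential equation $$\frac{\partial}{\partial t} f(t,x)=\frac{M(t,x)f(t,x)-M(t,0)f(t,0)}{x},\qquad t\in[0,1],\ x\in(0,1]. \tag{$*$}$$ (I) There exist $M,f\in C^\infty([0,1]^2)$ satisfying $( * )$, with $M(t,x)>0$ for all $(t,x)\in[0,1]^2$, such that $t\mapsto f(t,0)$ is not identically zero on $[0,1]$, and $f(0,x)=0=f(1,x)$ for all $x\in[0,1]$. (II) Fix $\epsilon>0$. Suppose that for $t\in[0,1]$, $x\in(0,1]$, $$M(t,x)=\frac{1}{x}\int_0^\epsilon e^{-w/x}\,b(t,w)\,dw+e^{-\epsilon/x}G(t,x),$$ with $M$ extended continuously to $x=0$ (so that $M(t,0)=b(t,0)$), where $b\in C^3([0,1]\times[0,\epsilon])$, $b(t,0)>0$ for all $t\in[0,1]$, and $G\in C([0,1]^2)$. Suppose $f\in C([0,1]^2)$ satisfies $( * )$, that $f(0,x)=0$ for all $x\in[0,1]$, and that the function $t\mapsto f(t,0)$ belongs to $C^2([0,1])$. Then $f(t,x)=0$ for all $(t,x)\in[0,1]^2$.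
   Context: Functions are real-valued. A function satisfies the differential equation $( * )$ if the derivative $\partial f/\partial t$ exists in the classical sense (one-sided at $t=0$ and $t=1$) and the equation holds at every indicated point. $C^k$ and $C^\infty$ on a closed rectangle mean that the derivatives of the relevant orders exist and are continuous up to the boundary. In part (II), $M(t,0)=b(t,0)$ is positive, and therefore $M(t,x)$ is positive for $x$ small, but positivity of $M$ away from $x=0$ is not assumed. *)

theory Defs
  imports "HOL-Analysis.Analysis"
begin

text \<open>
  The spaces $C^k$ on a closed interval and on a closed rectangle. Derivatives are taken within the
  domain, so they are one-sided at the boundary, and each derivative is required to be
  continuous on the whole closed domain. Values outside the domain play no role.
\<close>

primrec Ck_interval :: "nat \<Rightarrow> real set \<Rightarrow> (real \<Rightarrow> real) \<Rightarrow> bool" where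
  "Ck_interval 0 A g \<longleftrightarrow> continuous_on A g"
| "Ck_interval (Suc k) A g \<longleftrightarrow>
     continuous_on A g \<and>
     (\<exists>g'. (\<forall>t\<in>A. (g has_real_derivative g' t) (at t within A)) \<and> Ck_interval k A g')"

primrec Ck_rect :: "nat \<Rightarrow> real set \<Rightarrow> real set \<Rightarrow> (real \<Rightarrow> real \<Rightarrow> real) \<Rightarrow> bool" where
  "Ck_rect 0 A B h \<longleftrightarrow> continuous_on (A \<times> B) (\<lambda>(t, x). h t x)"
| "Ck_rect (Suc k) A B h \<longleftrightarrow>
     continuous_on (A \<times> B) (\<lambda>(t, x). h t x) \<and>
     (\<exists>ht hx.
        (\<forall>t\<in>A. \<forall>x\<in>B. ((\<lambda>s. h s x) has_real_derivative ht t x) (at t within A)) \<and>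
        (\<forall>t\<in>A. \<forall>x\<in>B. ((\<lambda>y. h t y) has_real_derivative hx t x) (at x within B)) \<and>
        Ck_rect k A B ht \<and> Ck_rect k A B hx)"

definition Cinf_rect :: "real set \<Rightarrow> real set \<Rightarrow> (real \<Rightarrow> real \<Rightarrow> real) \<Rightarrow> bool" where
  "Cinf_rect A B h \<longleftrightarrow> (\<forall>k. Ck_rect k A B h)"

definition satisfies_eq :: "(real \<Rightarrow> real \<Rightarrow> real) \<Rightarrow> (real \<Rightarrow> real \<Rightarrow> real) \<Rightarrow> bool" where
  "satisfies_eq M f \<longleftrightarrow>
     (\<forall>t\<in>{0..1}. \<forall>x\<in>{0<..1}.
        ((\<lambda>s. f s x) has_real_derivative (M t x * f t x - M t 0 * f t 0) / x) (at t within {0..1}))"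

end

theory Submission
  imports Defs "HOL-Complex_Analysis.Complex_Analysis" "HOL-Probability.Probability"
    "HOL-Real_Asymp.Real_Asymp"
begin

text \<open>
  The equation is ill-posed: for fixed \<open>x\<close> it says that \<open>f\<close> solves the linear ordinary differential
  equation \<open>x f\<^sub>t = M f - h\<close> with \<open>h t = M t 0 * f t 0\<close>, whose solution with \<open>f 0 x = 0\<close> grows like
  \<open>exp (t / x)\<close>. All the information about uniqueness therefore sits in how small a Laplace
  transform \<open>p \<mapsto> \<integral> exp (- p s) h(s) ds\<close>, with \<open>p = 1 / x\<close>, can be.

  Existence. Let \<open>m\<close> be a positive function with \<open>m s 0 = 1\<close> and put \<open>M = 1 - x m\<^sub>t / m\<close>. Then the
  equation for \<open>f\<close> becomes \<open>x (m f)\<^sub>t = m f - m h\<close> with \<open>h = f(\<cdot>, 0)\<close>, and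
  \<open>m f (t, x) = \<integral>\<^sub>0\<^sup>\<infinity> exp (- w) (m h) (t + x w, x) dw\<close> is a solution that is smooth up to \<open>x = 0\<close>.
  If \<open>h\<close> lives on \<open>[0, 1]\<close> it vanishes at \<open>t = 1\<close>, and it vanishes at \<open>t = 0\<close> exactly when
  \<open>\<integral> exp (- s / x) m(s, x) h(s) ds = 0\<close> for all \<open>x\<close>. This condition is linear in \<open>m\<close>, and
  \<open>m(s, x) = 1 - R(x) h(s)\<close> satisfies it for
  \<open>R(x) = \<integral> exp (- s / x) h(s) ds / \<integral> exp (- s / x) h(s)\<^sup>2 ds\<close>. What remains is that \<open>R\<close> be smooth at
  \<open>x = 0\<close>, where both integrals are exponentially small. For the real bump
  \<open>h(s) = exp (- 1 / s - 1 / (1 - s)) sin (31 / s)\<close> the numerator is an oscillating integral; moving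
  the contour into the complex plane bounds it and all its derivatives in \<open>p\<close> by \<open>2 exp (- 8 / sqrt x)\<close>
  for small \<open>x\<close> (\<open>contour_bound\<close>), whereas the denominator has a positive integrand and is at least
  \<open>exp (- 5 / sqrt x)\<close> for small \<open>x\<close> (\<open>energy_eventually\<close>). So \<open>R\<close> is flat at \<open>0\<close>, and shrinking the \<open>x\<close>-axis makes it as
  small as positivity of \<open>m\<close> and \<open>M\<close> requires.

  Uniqueness. A change of time turns \<open>b(t, 0)\<close> into \<open>1\<close>, and an exponential factor removes the next
  term of the expansion of \<open>M\<close>; the equation becomes \<open>f\<^sub>t = p (f - a) + N f\<close>, where \<open>a = f(\<cdot>, 0)\<close> and
  where \<open>N\<close> is a Laplace transform over \<open>[0, \<epsilon>]\<close> up to an error of size \<open>p exp (- p \<epsilon>)\<close>. Because \<open>f\<close>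
  stays bounded, the variation of constants formula gives, for every \<open>E \<le> \<epsilon>\<close>,
  \<open>\<integral>\<^sub>0\<^sup>E exp (- p s) exp (- \<integral>\<^sub>0\<^sup>s N) a(s) ds = O(exp (- p E))\<close>. The factor \<open>exp (- \<integral> N)\<close> is one plus a
  Laplace transform of a continuous kernel \<open>k\<close> (\<open>laplace_exp_kernel\<close>), so the left-hand side is the Laplace
  transform over \<open>[0, E]\<close> of \<open>g(\<sigma>) = a(\<sigma>) + \<integral>\<^sub>0\<^sup>\<sigma> a(s) k(s, \<sigma> - s) ds\<close>, up to an admissible error. A continuous
  function on \<open>[0, E]\<close> whose transform is \<open>O(p exp (- p E))\<close> is zero (\<open>finite_laplace_unique\<close>), and \<open>g = 0\<close> is a
  Volterra equation with the only solution \<open>a = 0\<close>. Then \<open>f\<close> solves a homogeneous equation and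
  vanishes up to time \<open>E\<close>; steps of length \<open>\<epsilon>\<close> cover the whole time interval.
\<close>

section \<open>Spaces of differentiable functions and flat extensions\<close>

text \<open>
  Successive derivatives that all stay in a class \<open>S\<close>. One recursion serves for continuity,
  for support in \<open>[0, 1]\<close> and for decay at infinity, so that closure under sums and products
  is proved once.
\<close>
primrec derivs_in :: "nat \<Rightarrow> real set \<Rightarrow> (real \<Rightarrow> real) set \<Rightarrow> (real \<Rightarrow> real) \<Rightarrow> bool" where
  "derivs_in 0 A S g \<longleftrightarrow> g \<in> S"
| "derivs_in (Suc k) A S g \<longleftrightarrow>
     g \<in> S \<and> (\<exists>g'. (\<forall>t\<in>A. (g has_real_derivative g' t) (at t within A)) \<and> derivs_in k A S g')"

lemma derivs_in_SucI:
  assumes "g \<in> S" "\<And>t. t \<in> A \<Longrightarrow> (g has_real_derivative g' t) (at t within A)" "derivs_in k A S g'"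
  shows "derivs_in (Suc k) A S g"
  using assms by auto

lemma derivs_in_SucE:
  assumes "derivs_in (Suc k) A S g"
  obtains g' where "g \<in> S" "\<And>t. t \<in> A \<Longrightarrow> (g has_real_derivative g' t) (at t within A)" "derivs_in k A S g'"
  using assms unfolding derivs_in.simps by blast

lemma Ck_interval_eq: "Ck_interval k A g \<longleftrightarrow> derivs_in k A {g. continuous_on A g} g"
  by (induction k arbitrary: g) auto

lemma derivs_in_Suc: "derivs_in (Suc k) A S g \<Longrightarrow> derivs_in k A S g"
proof (induction k arbitrary: g)
  case (Suc k)
  from Suc.prems obtain g' where g': "g \<in> S"
    "\<And>t. t \<in> A \<Longrightarrow> (g has_real_derivative g' t) (at t within A)" "derivs_in (Suc k) A S g'"
    by (rule derivs_in_SucE) blast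
  show ?case by (rule derivs_in_SucI[OF g'(1,2) Suc.IH[OF g'(3)]])
qed simp

lemma derivs_in_member: "derivs_in k A S g \<Longrightarrow> g \<in> S"
  by (cases k) auto

lemma derivs_in_add:
  assumes S: "\<And>f g. f \<in> S \<Longrightarrow> g \<in> S \<Longrightarrow> (\<lambda>x. f x + g x) \<in> S"
  shows "derivs_in k A S f \<Longrightarrow> derivs_in k A S g \<Longrightarrow> derivs_in k A S (\<lambda>x. f x + g x)"
proof (induction k arbitrary: f g)
  case (Suc k)
  from Suc.prems(1) obtain f' where f': "f \<in> S"
    "\<And>t. t \<in> A \<Longrightarrow> (f has_real_derivative f' t) (at t within A)" "derivs_in k A S f'"
    by (rule derivs_in_SucE) blast
  from Suc.prems(2) obtain g' where g': "g \<in> S"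
    "\<And>t. t \<in> A \<Longrightarrow> (g has_real_derivative g' t) (at t within A)" "derivs_in k A S g'"
    by (rule derivs_in_SucE) blast
  show ?case
    by (rule derivs_in_SucI[OF S[OF f'(1) g'(1)] DERIV_add[OF f'(2) g'(2)] Suc.IH[OF f'(3) g'(3)]])
qed (simp add: S)

text \<open>
  Three classes are needed because the rapidly decaying functions form an ideal in the bounded ones.
\<close>
lemma derivs_in_mult:
  assumes mult: "\<And>f g. f \<in> S \<Longrightarrow> g \<in> S' \<Longrightarrow> (\<lambda>x. f x * g x) \<in> S''"
    and add: "\<And>f g. f \<in> S'' \<Longrightarrow> g \<in> S'' \<Longrightarrow> (\<lambda>x. f x + g x) \<in> S''"
  shows "derivs_in k A S f \<Longrightarrow> derivs_in k A S' g \<Longrightarrow> derivs_in k A S'' (\<lambda>x. f x * g x)"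
proof (induction k arbitrary: f g)
  case (Suc k)
  from Suc.prems(1) obtain f' where f': "f \<in> S"
    "\<And>t. t \<in> A \<Longrightarrow> (f has_real_derivative f' t) (at t within A)" "derivs_in k A S f'"
    by (rule derivs_in_SucE) blast
  from Suc.prems(2) obtain g' where g': "g \<in> S'"
    "\<And>t. t \<in> A \<Longrightarrow> (g has_real_derivative g' t) (at t within A)" "derivs_in k A S' g'"
    by (rule derivs_in_SucE) blast
  show ?case
  proof (rule derivs_in_SucI[OF mult[OF f'(1) g'(1)] DERIV_mult[OF f'(2) g'(2)]])
    have "derivs_in k A S'' (\<lambda>x. f' x * g x + f x * g' x)"
      by (rule derivs_in_add[OF add Suc.IH[OF f'(3) derivs_in_Suc[OF Suc.prems(2)]]
            Suc.IH[OF derivs_in_Suc[OF Suc.prems(1)] g'(3)]])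
    then show "derivs_in k A S'' (\<lambda>x. f' x * g x + g' x * f x)" by (simp only: mult.commute)
  qed
qed (simp add: mult)

lemma Ck_interval_add:
  "Ck_interval k A f \<Longrightarrow> Ck_interval k A g \<Longrightarrow> Ck_interval k A (\<lambda>x. f x + g x)"
  unfolding Ck_interval_eq by (rule derivs_in_add) (auto intro: continuous_intros)

lemma Ck_interval_mult:
  "Ck_interval k A f \<Longrightarrow> Ck_interval k A g \<Longrightarrow> Ck_interval k A (\<lambda>x. f x * g x)"
  unfolding Ck_interval_eq
  by (rule derivs_in_mult[where S="{g. continuous_on A g}" and S'="{g. continuous_on A g}"]) (auto intro: continuous_intros)

lemma Ck_interval_const: "Ck_interval k A (\<lambda>_. c)"
proof (induction k arbitrary: c)
  case (Suc k)
  show ?case using Suc[of 0] by (auto intro!: exI[of _ "\<lambda>_. 0"])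
qed simp

lemma Ck_interval_UNIV_SucI:
  assumes "\<And>t. (g has_real_derivative g' t) (at t)" "Ck_interval k UNIV g'"
  shows "Ck_interval (Suc k) UNIV g"
  using assms by (auto intro!: exI[of _ g'] DERIV_continuous_on)

lemma Ck_interval_affine:
  "Ck_interval k UNIV g \<Longrightarrow> Ck_interval k UNIV (\<lambda>x. g (a + b * x))"
proof (induction k arbitrary: g)
  case 0
  then show ?case by (auto intro!: continuous_on_compose2[of UNIV g] continuous_intros)
next
  case (Suc k)
  then obtain g' where g': "\<And>t. (g has_real_derivative g' t) (at t)" "Ck_interval k UNIV g'" by auto
  have "((\<lambda>x. g (a + b * x)) has_real_derivative b * g' (a + b * t)) (at t)" for t
    by (rule DERIV_cong[OF DERIV_chain2[OF g'(1)], of _ b]) (auto intro!: derivative_eq_intros)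
  moreover have "Ck_interval k UNIV (\<lambda>x. b * g' (a + b * x))"
    by (intro Ck_interval_mult Ck_interval_const Suc.IH g')
  ultimately show ?case by (rule Ck_interval_UNIV_SucI)
qed

lemma Ck_rect_continuous: "Ck_rect k A B h \<Longrightarrow> continuous_on (A \<times> B) (\<lambda>(t, x). h t x)"
  by (cases k) auto

lemma Ck_rect_SucI:
  assumes "continuous_on (A \<times> B) (\<lambda>(t, x). h t x)"
    "\<And>t x. t \<in> A \<Longrightarrow> x \<in> B \<Longrightarrow> ((\<lambda>s. h s x) has_real_derivative ht t x) (at t within A)"
    "\<And>t x. t \<in> A \<Longrightarrow> x \<in> B \<Longrightarrow> ((\<lambda>y. h t y) has_real_derivative hx t x) (at x within B)"
    "Ck_rect k A B ht" "Ck_rect k A B hx"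
  shows "Ck_rect (Suc k) A B h"
  using assms unfolding Ck_rect.simps by blast

lemma Ck_rect_SucE:
  assumes "Ck_rect (Suc k) A B h"
  obtains ht hx where
    "\<And>t x. t \<in> A \<Longrightarrow> x \<in> B \<Longrightarrow> ((\<lambda>s. h s x) has_real_derivative ht t x) (at t within A)"
    "\<And>t x. t \<in> A \<Longrightarrow> x \<in> B \<Longrightarrow> ((\<lambda>y. h t y) has_real_derivative hx t x) (at x within B)"
    "Ck_rect k A B ht" "Ck_rect k A B hx"
  using assms unfolding Ck_rect.simps by blast

lemma Ck_rect_mono: "Ck_rect (Suc k) A B h \<Longrightarrow> Ck_rect k A B h"
proof (induction k arbitrary: h)
  case (Suc k)
  from Suc.prems obtain ht hx where h:
    "\<And>t x. t \<in> A \<Longrightarrow> x \<in> B \<Longrightarrow> ((\<lambda>s. h s x) has_real_derivative ht t x) (at t within A)"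
    "\<And>t x. t \<in> A \<Longrightarrow> x \<in> B \<Longrightarrow> ((\<lambda>y. h t y) has_real_derivative hx t x) (at x within B)"
    "Ck_rect (Suc k) A B ht" "Ck_rect (Suc k) A B hx" by (rule Ck_rect_SucE) blast
  show ?case
    by (rule Ck_rect_SucI[OF Ck_rect_continuous[OF Suc.prems] h(1,2) Suc.IH[OF h(3)] Suc.IH[OF h(4)]])
qed simp

lemma Ck_rect_add:
  "Ck_rect k A B f \<Longrightarrow> Ck_rect k A B g \<Longrightarrow> Ck_rect k A B (\<lambda>t x. f t x + g t x)"
proof (induction k arbitrary: f g)
  case 0
  then show ?case by (auto simp: split_beta intro!: continuous_intros)
next
  case (Suc k)
  from Suc.prems(1) obtain ft fx where f:
    "\<And>t x. t \<in> A \<Longrightarrow> x \<in> B \<Longrightarrow> ((\<lambda>s. f s x) has_real_derivative ft t x) (at t within A)"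
    "\<And>t x. t \<in> A \<Longrightarrow> x \<in> B \<Longrightarrow> ((\<lambda>y. f t y) has_real_derivative fx t x) (at x within B)"
    "Ck_rect k A B ft" "Ck_rect k A B fx" by (rule Ck_rect_SucE) blast
  from Suc.prems(2) obtain gt gx where g:
    "\<And>t x. t \<in> A \<Longrightarrow> x \<in> B \<Longrightarrow> ((\<lambda>s. g s x) has_real_derivative gt t x) (at t within A)"
    "\<And>t x. t \<in> A \<Longrightarrow> x \<in> B \<Longrightarrow> ((\<lambda>y. g t y) has_real_derivative gx t x) (at x within B)"
    "Ck_rect k A B gt" "Ck_rect k A B gx" by (rule Ck_rect_SucE) blast
  show ?case
  proof (rule Ck_rect_SucI[OF _ DERIV_add[OF f(1) g(1)] DERIV_add[OF f(2) g(2)] Suc.IH[OF f(3) g(3)] Suc.IH[OF f(4) g(4)]])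
    show "continuous_on (A \<times> B) (\<lambda>(t, x). f t x + g t x)"
      using Suc.prems[THEN Ck_rect_continuous] by (auto simp: split_beta intro!: continuous_intros)
  qed
qed

lemma Ck_rect_mult:
  "Ck_rect k A B f \<Longrightarrow> Ck_rect k A B g \<Longrightarrow> Ck_rect k A B (\<lambda>t x. f t x * g t x)"
proof (induction k arbitrary: f g)
  case 0
  then show ?case by (auto simp: split_beta intro!: continuous_intros)
next
  case (Suc k)
  from Suc.prems(1) obtain ft fx where f:
    "\<And>t x. t \<in> A \<Longrightarrow> x \<in> B \<Longrightarrow> ((\<lambda>s. f s x) has_real_derivative ft t x) (at t within A)"
    "\<And>t x. t \<in> A \<Longrightarrow> x \<in> B \<Longrightarrow> ((\<lambda>y. f t y) has_real_derivative fx t x) (at x within B)"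
    "Ck_rect k A B ft" "Ck_rect k A B fx" by (rule Ck_rect_SucE) blast
  from Suc.prems(2) obtain gt gx where g:
    "\<And>t x. t \<in> A \<Longrightarrow> x \<in> B \<Longrightarrow> ((\<lambda>s. g s x) has_real_derivative gt t x) (at t within A)"
    "\<And>t x. t \<in> A \<Longrightarrow> x \<in> B \<Longrightarrow> ((\<lambda>y. g t y) has_real_derivative gx t x) (at x within B)"
    "Ck_rect k A B gt" "Ck_rect k A B gx" by (rule Ck_rect_SucE) blast
  note lower = Suc.prems[THEN Ck_rect_mono]
  show ?case
  proof (rule Ck_rect_SucI[OF _ DERIV_mult[OF f(1) g(1)] DERIV_mult[OF f(2) g(2)]])
    show "continuous_on (A \<times> B) (\<lambda>(t, x). f t x * g t x)"
      using Suc.prems[THEN Ck_rect_continuous] by (auto simp: split_beta intro!: continuous_intros)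
    show "Ck_rect k A B (\<lambda>t x. ft t x * g t x + gt t x * f t x)"
      "Ck_rect k A B (\<lambda>t x. fx t x * g t x + gx t x * f t x)"
      by (intro Ck_rect_add Suc.IH f g lower)+
  qed
qed

lemma Ck_rect_const: "Ck_rect k A B (\<lambda>t x. c)"
proof (induction k arbitrary: c)
  case (Suc k)
  show ?case
    by (rule Ck_rect_SucI[where ht="\<lambda>_ _. 0" and hx="\<lambda>_ _. 0"]) (auto intro: Suc)
qed (simp add: split_beta)

lemma Ck_rect_inverse:
  assumes "\<And>t x. t \<in> A \<Longrightarrow> x \<in> B \<Longrightarrow> f t x \<noteq> 0"
  shows "Ck_rect k A B f \<Longrightarrow> Ck_rect k A B (\<lambda>t x. inverse (f t x))"
  using assms
proof (induction k arbitrary: f)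
  case 0
  then show ?case by (auto simp: split_beta intro!: continuous_intros)
next
  case (Suc k)
  from Suc.prems(1) obtain ft fx where f:
    "\<And>t x. t \<in> A \<Longrightarrow> x \<in> B \<Longrightarrow> ((\<lambda>s. f s x) has_real_derivative ft t x) (at t within A)"
    "\<And>t x. t \<in> A \<Longrightarrow> x \<in> B \<Longrightarrow> ((\<lambda>y. f t y) has_real_derivative fx t x) (at x within B)"
    "Ck_rect k A B ft" "Ck_rect k A B fx" by (rule Ck_rect_SucE) blast
  note inv = Suc.IH[OF Ck_rect_mono[OF Suc.prems(1)] Suc.prems(2)]
  show ?case
  proof (rule Ck_rect_SucI[where ht="\<lambda>t x. -1 * (inverse (f t x) * ft t x * inverse (f t x))"
        and hx="\<lambda>t x. -1 * (inverse (f t x) * fx t x * inverse (f t x))"])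
    show "continuous_on (A \<times> B) (\<lambda>(t, x). inverse (f t x))"
      using Suc.prems(1)[THEN Ck_rect_continuous] Suc.prems(2) by (auto simp: split_beta intro!: continuous_intros)
    show "Ck_rect k A B (\<lambda>t x. -1 * (inverse (f t x) * ft t x * inverse (f t x)))"
      by (intro Ck_rect_mult Ck_rect_const inv f(3))
    show "Ck_rect k A B (\<lambda>t x. -1 * (inverse (f t x) * fx t x * inverse (f t x)))"
      by (intro Ck_rect_mult Ck_rect_const inv f(4))
    fix t x assume tx: "t \<in> A" "x \<in> B"
    show "((\<lambda>s. inverse (f s x)) has_real_derivative -1 * (inverse (f t x) * ft t x * inverse (f t x))) (at t within A)"
      using DERIV_inverse'[OF f(1)[OF tx] Suc.prems(2)[OF tx]] by simp
    show "((\<lambda>y. inverse (f t y)) has_real_derivative -1 * (inverse (f t x) * fx t x * inverse (f t x))) (at x within B)"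
      using DERIV_inverse'[OF f(2)[OF tx] Suc.prems(2)[OF tx]] by simp
  qed
qed

lemma Ck_rect_of_t:
  "Ck_interval k UNIV g \<Longrightarrow> Ck_rect k A B (\<lambda>t x. g t)"
proof (induction k arbitrary: g)
  case 0
  then show ?case by (auto simp: split_beta intro!: continuous_on_compose2[of UNIV g] continuous_intros)
next
  case (Suc k)
  then obtain g' where g': "\<And>t. (g has_real_derivative g' t) (at t)" "Ck_interval k UNIV g'" by auto
  show ?case
    by (rule Ck_rect_SucI[where ht="\<lambda>t x. g' t" and hx="\<lambda>_ _. 0"])
       (use Suc.prems in \<open>auto simp: split_beta intro!: continuous_on_compose2[of UNIV g] continuous_intros
          Suc.IH g' Ck_rect_const has_field_derivative_at_within\<close>)
qed

lemma Ck_rect_of_x: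
  "Ck_interval k UNIV g \<Longrightarrow> Ck_rect k A B (\<lambda>t x. g x)"
proof (induction k arbitrary: g)
  case 0
  then show ?case by (auto simp: split_beta intro!: continuous_on_compose2[of UNIV g] continuous_intros)
next
  case (Suc k)
  then obtain g' where g': "\<And>t. (g has_real_derivative g' t) (at t)" "Ck_interval k UNIV g'" by auto
  show ?case
    by (rule Ck_rect_SucI[where hx="\<lambda>t x. g' x" and ht="\<lambda>_ _. 0"])
       (use Suc.prems in \<open>auto simp: split_beta intro!: continuous_on_compose2[of UNIV g] continuous_intros
          Suc.IH g' Ck_rect_const has_field_derivative_at_within\<close>)
qed

text \<open>
  Faster than every power at \<open>+\<infinity>\<close>: the class for which the substitution \<open>p = 1 / x\<close> produces
  functions that are flat at \<open>x = 0\<close>.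
\<close>
definition rapid :: "(real \<Rightarrow> real) set" where
  "rapid = {\<psi>. continuous_on {0<..} \<psi> \<and> (\<forall>N. ((\<lambda>p. p ^ N * \<psi> p) \<longlongrightarrow> 0) at_top)}"

text \<open>
  The power of \<open>x\<close> makes the family stable under differentiation.
\<close>
definition flat_ext :: "nat \<Rightarrow> (real \<Rightarrow> real) \<Rightarrow> real \<Rightarrow> real" where
  "flat_ext n \<psi> x = (if 0 < x then \<psi> (1 / x) / x ^ n else 0)"

lemma flat_ext_tendsto_0:
  assumes "\<psi> \<in> rapid"
  shows "(flat_ext n \<psi> \<longlongrightarrow> 0) (at 0)"
proof (rule filterlim_split_at)
  have "((\<lambda>x. inverse x ^ n * \<psi> (inverse x)) \<longlongrightarrow> 0) (at_right 0)"
    using assms filterlim_compose[OF _ filterlim_inverse_at_top_right, of "\<lambda>p. p ^ n * \<psi> p"]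
    by (simp add: rapid_def)
  then show "(flat_ext n \<psi> \<longlongrightarrow> 0) (at_right 0)"
    by (rule Lim_transform_eventually)
       (rule eventually_mono[OF eventually_at_right_less],
        simp add: flat_ext_def power_inverse divide_inverse mult.commute)
  show "(flat_ext n \<psi> \<longlongrightarrow> 0) (at_left 0)"
    by (rule Lim_transform_eventually[OF tendsto_const])
       (rule eventually_at_leftI[of "-1"], auto simp: flat_ext_def)
qed

lemma flat_ext_continuous:
  assumes "\<psi> \<in> rapid"
  shows "continuous_on UNIV (flat_ext n \<psi>)"
proof -
  have "isCont (flat_ext n \<psi>) x" for x
  proof -
    consider "0 < x" | "x = 0" | "x < 0" by linarith
    then show ?thesis
    proof cases
      case 1
      have "continuous_on {0<..} (\<lambda>x. \<psi> (1 / x) / x ^ n)"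
      proof -
        have "continuous_on {0<..} \<psi>" using assms by (simp add: rapid_def)
        then have "continuous_on {0<..} (\<lambda>x. \<psi> (1 / x))"
          by (rule continuous_on_compose2[where f="\<lambda>x. 1 / x"]) (auto intro!: continuous_intros)
        then show ?thesis by (intro continuous_on_divide continuous_intros) auto
      qed
      then have "continuous_on {0<..} (flat_ext n \<psi>)"
        by (rule continuous_on_eq) (simp add: flat_ext_def)
      with 1 show ?thesis by (simp add: continuous_on_eq_continuous_at)
    next
      case 2
      with flat_ext_tendsto_0[OF assms, of n] show ?thesis by (simp add: isCont_def flat_ext_def)
    next
      case 3
      have "continuous_on {..<0} (flat_ext n \<psi>)"
        by (rule continuous_on_eq[of _ "\<lambda>_. 0"]) (auto simp: flat_ext_def)
      with 3 show ?thesis by (simp add: continuous_on_eq_continuous_at)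
    qed
  qed
  then show ?thesis by (simp add: continuous_at_imp_continuous_on)
qed

text \<open>
  At \<open>x = 0\<close> the difference quotient of \<open>flat_ext n \<psi>\<close> is \<open>flat_ext (Suc n) \<psi>\<close>, which tends to \<open>0\<close>;
  elsewhere this is the chain rule.
\<close>
lemma flat_ext_deriv:
  assumes \<psi>: "\<psi> \<in> rapid" and \<psi>': "\<And>p. 0 < p \<Longrightarrow> (\<psi> has_real_derivative \<psi>' p) (at p)"
  shows "(flat_ext n \<psi> has_real_derivative - real n * flat_ext (Suc n) \<psi> x + -1 * flat_ext (Suc (Suc n)) \<psi>' x) (at x)"
proof -
  consider "0 < x" | "x = 0" | "x < 0" by linarith
  then show ?thesis
  proof cases
    case 1
    have d: "((\<lambda>x. \<psi> (1 / x)) has_real_derivative \<psi>' (1 / x) * (- 1 / x\<^sup>2)) (at x)"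
      by (rule DERIV_chain2[OF \<psi>']) (use 1 in \<open>auto intro!: derivative_eq_intros simp: power2_eq_square\<close>)
    have "((\<lambda>x. \<psi> (1 / x) / x ^ n) has_real_derivative
        - real n * (\<psi> (1 / x) / x ^ Suc n) + -1 * (\<psi>' (1 / x) / x ^ Suc (Suc n))) (at x)"
      using 1 by (auto intro!: derivative_eq_intros d)
         (cases n; simp add: field_simps power2_eq_square)
    then have "(flat_ext n \<psi> has_real_derivative
        - real n * (\<psi> (1 / x) / x ^ Suc n) + -1 * (\<psi>' (1 / x) / x ^ Suc (Suc n))) (at x)"
      by (rule has_field_derivative_transform_within_open[of _ _ _ "{0<..}"]) (use 1 in \<open>auto simp: flat_ext_def\<close>)
    with 1 show ?thesis by (simp add: flat_ext_def)
  next
    case 2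
    have "(flat_ext n \<psi> has_real_derivative 0) (at 0)"
      unfolding has_field_derivative_iff
    proof (rule Lim_transform_eventually[OF flat_ext_tendsto_0[OF \<psi>, of "Suc n"]])
      show "\<forall>\<^sub>F y in at 0. flat_ext (Suc n) \<psi> y = (flat_ext n \<psi> y - flat_ext n \<psi> 0) / (y - 0)"
        by (auto simp: eventually_at_filter flat_ext_def)
    qed
    with 2 show ?thesis by (simp add: flat_ext_def)
  next
    case 3
    have "(flat_ext n \<psi> has_real_derivative 0) (at x)"
      by (rule has_field_derivative_transform_within_open[of "\<lambda>_. 0" _ _ "{..<0}"])
         (use 3 in \<open>auto simp: flat_ext_def\<close>)
    with 3 show ?thesis by (simp add: flat_ext_def)
  qed
qed

lemma flat_ext_Ck: "derivs_in k {0<..} rapid \<psi> \<Longrightarrow> Ck_interval k UNIV (flat_ext n \<psi>)"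
proof (induction k arbitrary: \<psi> n)
  case 0
  then show ?case by (simp add: flat_ext_continuous)
next
  case (Suc k)
  then obtain \<psi>' where \<psi>': "\<forall>p\<in>{0<..}. (\<psi> has_real_derivative \<psi>' p) (at p within {0<..})" "derivs_in k {0<..} rapid \<psi>'"
    by auto
  have ck: "Ck_interval k UNIV (\<lambda>x. - real n * flat_ext (Suc n) \<psi> x + -1 * flat_ext (Suc (Suc n)) \<psi>' x)"
    by (intro Ck_interval_add Ck_interval_mult Ck_interval_const Suc.IH derivs_in_Suc[OF Suc.prems] \<psi>')
  have d: "(\<psi> has_real_derivative \<psi>' p) (at p)" if "0 < p" for p
    using bspec[OF \<psi>'(1), of p] at_within_open[of p "{0<..}"] that by simp
  show ?case
    by (rule Ck_interval_UNIV_SucI[OF flat_ext_deriv[OF derivs_in_member[OF Suc.prems] d] ck])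
qed

section \<open>A scaled Laplace transform that is smooth up to zero scale\<close>

definition unit_supported :: "(real \<Rightarrow> real) set" where
  "unit_supported = {g. continuous_on UNIV g \<and> (\<forall>x. x \<notin> {0..1} \<longrightarrow> g x = 0)}"

text \<open>
  The density of the Gamma distribution without its normalisation; its moments are factorials.
\<close>
definition gamma_weight :: "nat \<Rightarrow> real \<Rightarrow> real" where
  "gamma_weight n w = w ^ n * exp (- w) * indicator {0..} w"

lemma gamma_weight_nonneg: "0 \<le> gamma_weight n w"
  by (auto simp: gamma_weight_def indicator_def)

lemma gamma_weight_integral: "integrable lborel (gamma_weight n)" "(LINT w|lborel. gamma_weight n w) = fact n"
proof -
  have "has_bochner_integral lborel (gamma_weight n) (fact n)"
    unfolding gamma_weight_def
    using nn_intergal_power_times_exp_Ici[of n]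
    by (intro has_bochner_integral_nn_integral)
       (auto simp: nn_integral_set_ennreal split: split_indicator)
  then show "integrable lborel (gamma_weight n)" "(LINT w|lborel. gamma_weight n w) = fact n"
    by (auto simp: has_bochner_integral_iff)
qed

text \<open>
  Writing the backward solution \<open>(1 / x) \<integral>\<^sub>t exp (- (s - t) / x) g(s) ds\<close> of \<open>x u\<^sub>t = u - g\<close> in the variable
  \<open>w = (s - t) / x\<close> removes the singularity at \<open>x = 0\<close>. The powers of \<open>w\<close> arise from
  derivatives in \<open>x\<close>; the constant \<open>c\<close> rescales the \<open>x\<close>-axis.
\<close>
definition scaled_laplace :: "real \<Rightarrow> nat \<Rightarrow> (real \<Rightarrow> real) \<Rightarrow> real \<Rightarrow> real \<Rightarrow> real" where
  "scaled_laplace c n g t x = (LINT w|lborel. gamma_weight n w * g (t + c * x * w))"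

lemma unit_supported_bounded:
  assumes "g \<in> unit_supported"
  obtains B where "0 \<le> B" "\<And>x. \<bar>g x\<bar> \<le> B"
proof -
  have "continuous_on {0..1} g" using assms by (auto simp: unit_supported_def intro: continuous_on_subset)
  then have "bounded (g ` {0..1})" by (intro compact_imp_bounded compact_continuous_image) auto
  then obtain B where B: "\<forall>y\<in>g ` {0..1}. norm y \<le> B" "0 < B" unfolding bounded_pos by blast
  have "\<bar>g x\<bar> \<le> B" for x
    using B assms by (cases "x \<in> {0..1}") (auto simp: unit_supported_def)
  with B(2) that[of B] show ?thesis by auto
qed

lemma scaled_laplace_integrable:
  assumes "g \<in> unit_supported"
  shows "integrable lborel (\<lambda>w. gamma_weight n w * g (a + b * w))"
proof -
  obtain B where B: "0 \<le> B" "\<And>x. \<bar>g x\<bar> \<le> B" using unit_supported_bounded[OF assms] by blast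
  have [measurable]: "g \<in> borel_measurable borel"
    using assms by (auto simp: unit_supported_def intro: borel_measurable_continuous_onI)
  have [measurable]: "gamma_weight n \<in> borel_measurable borel"
    using borel_measurable_integrable[OF gamma_weight_integral(1)[of n]] by simp
  show ?thesis
  proof (rule Bochner_Integration.integrable_bound[OF integrable_mult_right[OF gamma_weight_integral(1), of B n]])
    show "AE w in lborel. norm (gamma_weight n w * g (a + b * w)) \<le> norm (B * gamma_weight n w)"
    proof (rule AE_I2)
      fix w
      have "gamma_weight n w * \<bar>g (a + b * w)\<bar> \<le> gamma_weight n w * B"
        using B(2) gamma_weight_nonneg by (intro mult_left_mono)
      then show "norm (gamma_weight n w * g (a + b * w)) \<le> norm (B * gamma_weight n w)"
        using B(1) gamma_weight_nonneg[of n w] by (simp add: abs_mult mult.commute)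
    qed
  qed measurable
qed

lemma scaled_laplace_bound:
  assumes "integrable lborel (\<lambda>w. gamma_weight n w * k w)" "\<And>w. 0 \<le> w \<Longrightarrow> \<bar>k w\<bar> \<le> B * w ^ m"
  shows "\<bar>LINT w|lborel. gamma_weight n w * k w\<bar> \<le> B * fact (n + m)"
proof -
  have "\<bar>LINT w|lborel. gamma_weight n w * k w\<bar> \<le> (LINT w|lborel. B * gamma_weight (n + m) w)"
  proof (rule order_trans[OF integral_abs_bound], rule integral_mono)
    show "integrable lborel (\<lambda>w. \<bar>gamma_weight n w * k w\<bar>)" using assms(1) by (rule integrable_abs)
    show "integrable lborel (\<lambda>w. B * gamma_weight (n + m) w)" by (intro integrable_mult_right gamma_weight_integral)
    fix w :: real
    show "\<bar>gamma_weight n w * k w\<bar> \<le> B * gamma_weight (n + m) w"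
    proof (cases "0 \<le> w")
      case True
      have "gamma_weight n w * \<bar>k w\<bar> \<le> gamma_weight n w * (B * w ^ m)"
        using assms(2)[OF True] gamma_weight_nonneg by (intro mult_left_mono) auto
      then show ?thesis using True by (simp add: abs_mult gamma_weight_nonneg) (simp add: gamma_weight_def power_add mult_ac)
    qed (simp add: gamma_weight_def)
  qed
  then show ?thesis by (simp add: gamma_weight_integral)
qed

text \<open>
  The remainder is uniform in \<open>u\<close>, so it can be integrated over the half-line against
  \<open>gamma_weight\<close>; this replaces a theorem on differentiation under improper integrals.
\<close>
lemma unit_supported_taylor:
  assumes "derivs_in (Suc (Suc 0)) UNIV unit_supported g" "\<And>x. (g has_real_derivative g' x) (at x)"
  obtains B where "0 \<le> B" "\<And>u d. \<bar>g (u + d) - g u - d * g' u\<bar> \<le> B * d\<^sup>2"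
proof -
  from assms(1) obtain h where h: "\<And>x. (g has_real_derivative h x) (at x)" "derivs_in (Suc 0) UNIV unit_supported h"
    by (rule derivs_in_SucE) auto
  have "h = g'" using DERIV_unique[OF h(1) assms(2)] by (rule ext)
  from h(2) obtain g'' where g'': "\<And>x. (h has_real_derivative g'' x) (at x)" "g'' \<in> unit_supported"
    by (rule derivs_in_SucE) auto
  obtain B where B: "0 \<le> B" "\<And>x. \<bar>g'' x\<bar> \<le> B" using unit_supported_bounded[OF g''(2)] by blast
  have lip: "\<bar>g' v - g' u\<bar> \<le> B * \<bar>v - u\<bar>" for u v
    using field_differentiable_bound[of UNIV g' g'' B v u] g''(1) B(2) \<open>h = g'\<close> by simp
  have "\<bar>g (u + d) - g u - d * g' u\<bar> \<le> B * d\<^sup>2" for u d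
  proof -
    have "\<exists>\<xi>. g (u + d) - g u = d * g' \<xi> \<and> \<bar>\<xi> - u\<bar> \<le> \<bar>d\<bar>"
    proof (cases d "0::real" rule: linorder_cases)
      case less
      then obtain z where "u + d < z" "z < u" "g u - g (u + d) = (u - (u + d)) * g' z"
        using MVT2[of "u + d" u g g'] assms(2) by auto
      then show ?thesis by (intro exI[of _ z]) auto
    next
      case greater
      then obtain z where "u < z" "z < u + d" "g (u + d) - g u = ((u + d) - u) * g' z"
        using MVT2[of u "u + d" g g'] assms(2) by auto
      then show ?thesis by (intro exI[of _ z]) auto
    qed auto
    then obtain \<xi> where \<xi>: "g (u + d) - g u = d * g' \<xi>" "\<bar>\<xi> - u\<bar> \<le> \<bar>d\<bar>" by blast
    have "\<bar>g (u + d) - g u - d * g' u\<bar> = \<bar>d\<bar> * \<bar>g' \<xi> - g' u\<bar>"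
      using \<xi>(1) by (simp add: abs_mult[symmetric] right_diff_distrib)
    also have "\<dots> \<le> \<bar>d\<bar> * (B * \<bar>d\<bar>)"
      using \<xi>(2) B(1) by (intro mult_left_mono order_trans[OF lip] mult_left_mono) auto
    finally show ?thesis by (simp add: power2_eq_square mult_ac)
  qed
  with B(1) that show ?thesis by blast
qed

lemma DERIV_quadratic:
  fixes F :: "real \<Rightarrow> real"
  assumes "\<And>d. \<bar>F (x + d) - F x - d * D\<bar> \<le> K * d\<^sup>2"
  shows "(F has_real_derivative D) (at x)"
  unfolding DERIV_def
proof -
  have "((\<lambda>h. (F (x + h) - F x) / h - D) \<longlongrightarrow> 0) (at 0)"
  proof (rule Lim_null_comparison)
    show "\<forall>\<^sub>F h in at 0. norm ((F (x + h) - F x) / h - D) \<le> K * \<bar>h\<bar>"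
    proof (rule eventually_mono[OF eventually_at_filter[THEN iffD2, OF always_eventually]])
      show "\<forall>h::real. h \<noteq> 0 \<longrightarrow> h \<in> UNIV \<longrightarrow> h \<noteq> 0" by simp
      fix h :: real assume h: "h \<noteq> 0"
      have "\<bar>h\<bar> * \<bar>(F (x + h) - F x) / h - D\<bar> = \<bar>F (x + h) - F x - h * D\<bar>"
        using h by (simp add: abs_mult[symmetric] field_simps)
      also have "\<dots> \<le> \<bar>h\<bar> * (K * \<bar>h\<bar>)" using assms[of h] by (simp add: power2_eq_square mult_ac)
      finally show "norm ((F (x + h) - F x) / h - D) \<le> K * \<bar>h\<bar>" using h by simp
    qed
    show "((\<lambda>h. K * \<bar>h\<bar>) \<longlongrightarrow> 0) (at 0)" by (auto intro!: tendsto_eq_intros)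
  qed
  then show "((\<lambda>h. (F (x + h) - F x) / h) \<longlongrightarrow> D) (at 0)" by (simp add: LIM_zero_iff)
qed

text \<open>
  Both derivatives lead back to the same family, with \<open>g\<close> replaced by its derivative.
\<close>
lemma scaled_laplace_derivs:
  assumes g: "derivs_in (Suc (Suc 0)) UNIV unit_supported g" and g': "\<And>x. (g has_real_derivative g' x) (at x)"
    and g'_supp: "g' \<in> unit_supported"
  shows "((\<lambda>s. scaled_laplace c n g s x) has_real_derivative scaled_laplace c n g' t x) (at t)"
    and "((\<lambda>y. scaled_laplace c n g t y) has_real_derivative c * scaled_laplace c (Suc n) g' t x) (at x)"
proof -
  obtain B where B: "0 \<le> B" "\<And>u d. \<bar>g (u + d) - g u - d * g' u\<bar> \<le> B * d\<^sup>2"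
    using unit_supported_taylor[OF g g'] by blast
  have g_supp: "g \<in> unit_supported" by (rule derivs_in_member[OF g])
  note int = scaled_laplace_integrable[OF g_supp] scaled_laplace_integrable[OF g'_supp]
  show "((\<lambda>s. scaled_laplace c n g s x) has_real_derivative scaled_laplace c n g' t x) (at t)"
  proof (rule DERIV_quadratic)
    fix d :: real
    have "scaled_laplace c n g (t + d) x - scaled_laplace c n g t x - d * scaled_laplace c n g' t x
        = (LINT w|lborel. gamma_weight n w * (g (t + d + c * x * w) - g (t + c * x * w) - d * g' (t + c * x * w)))"
      unfolding scaled_laplace_def using int
      by (simp add: right_diff_distrib mult.left_commute[of _ d])
    also have "\<bar>\<dots>\<bar> \<le> B * d\<^sup>2 * fact (n + 0)"
    proof (rule scaled_laplace_bound)
      show "integrable lborel (\<lambda>w. gamma_weight n w * (g (t + d + c * x * w) - g (t + c * x * w) - d * g' (t + c * x * w)))"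
        using int by (simp add: right_diff_distrib mult.left_commute[of _ d])
      show "\<bar>g (t + d + c * x * w) - g (t + c * x * w) - d * g' (t + c * x * w)\<bar> \<le> B * d\<^sup>2 * w ^ 0" for w
        using B(2)[of "t + c * x * w" d] by (simp add: algebra_simps)
    qed
    finally show "\<bar>scaled_laplace c n g (t + d) x - scaled_laplace c n g t x - d * scaled_laplace c n g' t x\<bar> \<le> (B * fact n) * d\<^sup>2"
      by (simp add: mult_ac)
  qed
  have gamma_weight_Suc: "gamma_weight (Suc n) w = w * gamma_weight n w" for w by (simp add: gamma_weight_def)
  show "((\<lambda>y. scaled_laplace c n g t y) has_real_derivative c * scaled_laplace c (Suc n) g' t x) (at x)"
  proof (rule DERIV_quadratic)
    fix d :: real
    have "scaled_laplace c n g t (x + d) - scaled_laplace c n g t x - d * (c * scaled_laplace c (Suc n) g' t x)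
        = (LINT w|lborel. gamma_weight n w * g (t + c * (x + d) * w)) - (LINT w|lborel. gamma_weight n w * g (t + c * x * w))
          - (LINT w|lborel. d * c * (gamma_weight (Suc n) w * g' (t + c * x * w)))"
      unfolding scaled_laplace_def by simp
    also have "\<dots> = (LINT w|lborel. gamma_weight n w * g (t + c * (x + d) * w) - gamma_weight n w * g (t + c * x * w)
          - d * c * (gamma_weight (Suc n) w * g' (t + c * x * w)))"
      using int[of n t "c * (x + d)"] int[of n t "c * x"] int(2)[of "Suc n" t "c * x"] by simp
    also have "\<dots> = (LINT w|lborel. gamma_weight n w * (g (t + c * (x + d) * w) - g (t + c * x * w) - (d * c * w) * g' (t + c * x * w)))"
      by (intro Bochner_Integration.integral_cong refl) (simp add: gamma_weight_Suc algebra_simps)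
    also have "\<bar>\<dots>\<bar> \<le> B * (d * c)\<^sup>2 * fact (n + 2)"
    proof (rule scaled_laplace_bound)
      have "integrable lborel (\<lambda>w. gamma_weight n w * g (t + c * (x + d) * w) - gamma_weight n w * g (t + c * x * w)
          - d * c * (gamma_weight (Suc n) w * g' (t + c * x * w)))"
        using int[of n t "c * (x + d)"] int[of n t "c * x"] int(2)[of "Suc n" t "c * x"] by simp
      then show "integrable lborel (\<lambda>w. gamma_weight n w * (g (t + c * (x + d) * w) - g (t + c * x * w) - (d * c * w) * g' (t + c * x * w)))"
        by (rule Bochner_Integration.integrable_cong[THEN iffD1, rotated -1]) (auto simp: gamma_weight_Suc algebra_simps)
      show "\<bar>g (t + c * (x + d) * w) - g (t + c * x * w) - (d * c * w) * g' (t + c * x * w)\<bar> \<le> B * (d * c)\<^sup>2 * w ^ 2" for w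
        using B(2)[of "t + c * x * w" "d * c * w"] by (simp add: algebra_simps power_mult_distrib)
    qed
    finally show "\<bar>scaled_laplace c n g t (x + d) - scaled_laplace c n g t x - d * (c * scaled_laplace c (Suc n) g' t x)\<bar> \<le> (B * c\<^sup>2 * fact (n + 2)) * d\<^sup>2"
      by (simp add: mult_ac power_mult_distrib)
  qed
qed

lemma scaled_laplace_continuous:
  assumes g: "derivs_in (Suc (Suc 0)) UNIV unit_supported g"
  shows "continuous_on (A \<times> B) (\<lambda>(t, x). scaled_laplace c n g t x)"
proof -
  from g obtain g' where g': "\<And>x. (g has_real_derivative g' x) (at x)" "derivs_in (Suc 0) UNIV unit_supported g'"
    by (rule derivs_in_SucE) auto
  obtain L where L: "0 \<le> L" "\<And>x. \<bar>g' x\<bar> \<le> L" using unit_supported_bounded derivs_in_member[OF g'(2)] by blast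
  have lip: "\<bar>g u - g v\<bar> \<le> L * \<bar>u - v\<bar>" for u v
    using field_differentiable_bound[of UNIV g g' L u v] g'(1) L(2) by simp
  have "isCont (\<lambda>z. scaled_laplace c n g (fst z) (snd z)) z" for z
  proof -
    define K where "K = L * fact n + L * \<bar>c\<bar> * fact (n + 1)"
    note int = scaled_laplace_integrable[OF derivs_in_member[OF g]]
    have "\<bar>scaled_laplace c n g s y - scaled_laplace c n g t x\<bar> \<le> L * \<bar>s - t\<bar> * fact n + L * (\<bar>c\<bar> * \<bar>y - x\<bar>) * fact (n + 1)" for s y t x
    proof -
      have "scaled_laplace c n g s y - scaled_laplace c n g t y = (LINT w|lborel. gamma_weight n w * (g (s + c * y * w) - g (t + c * y * w)))"
        unfolding scaled_laplace_def using int by (simp add: right_diff_distrib)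
      also have "\<bar>\<dots>\<bar> \<le> L * \<bar>s - t\<bar> * fact (n + 0)"
      proof (rule scaled_laplace_bound)
        show "integrable lborel (\<lambda>w. gamma_weight n w * (g (s + c * y * w) - g (t + c * y * w)))"
          using int by (simp add: right_diff_distrib)
        show "\<bar>g (s + c * y * w) - g (t + c * y * w)\<bar> \<le> L * \<bar>s - t\<bar> * w ^ 0" for w
          using lip[of "s + c * y * w" "t + c * y * w"] by simp
      qed
      finally have 1: "\<bar>scaled_laplace c n g s y - scaled_laplace c n g t y\<bar> \<le> L * \<bar>s - t\<bar> * fact n" by simp
      have "scaled_laplace c n g t y - scaled_laplace c n g t x = (LINT w|lborel. gamma_weight n w * (g (t + c * y * w) - g (t + c * x * w)))"
        unfolding scaled_laplace_def using int by (simp add: right_diff_distrib)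
      also have "\<bar>\<dots>\<bar> \<le> L * (\<bar>c\<bar> * \<bar>y - x\<bar>) * fact (n + 1)"
      proof (rule scaled_laplace_bound)
        show "integrable lborel (\<lambda>w. gamma_weight n w * (g (t + c * y * w) - g (t + c * x * w)))"
          using int by (simp add: right_diff_distrib)
        fix w :: real assume w: "0 \<le> w"
        have "\<bar>(t + c * y * w) - (t + c * x * w)\<bar> = \<bar>c\<bar> * \<bar>y - x\<bar> * w"
        proof -
          have "(t + c * y * w) - (t + c * x * w) = c * (y - x) * w" by (simp add: algebra_simps)
          then show ?thesis using w by (simp add: abs_mult)
        qed
        with lip[of "t + c * y * w" "t + c * x * w"]
        show "\<bar>g (t + c * y * w) - g (t + c * x * w)\<bar> \<le> L * (\<bar>c\<bar> * \<bar>y - x\<bar>) * w ^ 1" by (simp add: mult_ac)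
      qed
      finally show ?thesis using 1 by linarith
    qed
    then have "\<forall>\<^sub>F z' in at z. norm (scaled_laplace c n g (fst z') (snd z') - scaled_laplace c n g (fst z) (snd z))
        \<le> L * \<bar>fst z' - fst z\<bar> * fact n + L * (\<bar>c\<bar> * \<bar>snd z' - snd z\<bar>) * fact (n + 1)"
      by (intro always_eventually allI) simp
    then have "((\<lambda>z'. scaled_laplace c n g (fst z') (snd z') - scaled_laplace c n g (fst z) (snd z)) \<longlongrightarrow> 0) (at z)"
      by (rule Lim_null_comparison) (auto intro!: tendsto_eq_intros)
    then show ?thesis by (simp add: isCont_def LIM_zero_iff)
  qed
  then show ?thesis unfolding split_beta by (intro continuous_at_imp_continuous_on ballI)
qed

lemma scaled_laplace_Ck: "derivs_in (k + 2) UNIV unit_supported g \<Longrightarrow> Ck_rect k A B (scaled_laplace c n g)"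
proof (induction k arbitrary: g n)
  case 0
  then show ?case using scaled_laplace_continuous[of g A B c n] by (simp del: derivs_in.simps add: numeral_2_eq_2)
next
  case (Suc k)
  have g: "derivs_in (Suc (k + 2)) UNIV unit_supported g" using Suc.prems by simp
  then obtain g' where g': "\<And>x. (g has_real_derivative g' x) (at x)" "derivs_in (k + 2) UNIV unit_supported g'"
    by (rule derivs_in_SucE) auto
  have "derivs_in (j + 2) UNIV unit_supported g \<Longrightarrow> derivs_in (Suc (Suc 0)) UNIV unit_supported g" for j
  proof (induction j)
    case (Suc j)
    then show ?case using derivs_in_Suc[of "j + 2" UNIV unit_supported g] by (simp del: derivs_in.simps)
  qed (simp del: derivs_in.simps add: numeral_2_eq_2)
  then have g2: "derivs_in (Suc (Suc 0)) UNIV unit_supported g" using Suc.prems by blast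
  note d = scaled_laplace_derivs[OF g2 g'(1) derivs_in_member[OF g'(2)]]
  show ?case
  proof (rule Ck_rect_SucI[OF scaled_laplace_continuous[OF g2]])
    show "Ck_rect k A B (scaled_laplace c n g')" by (rule Suc.IH[OF g'(2)])
    show "Ck_rect k A B (\<lambda>t x. c * scaled_laplace c (Suc n) g' t x)"
      by (intro Ck_rect_mult Ck_rect_const Suc.IH[OF g'(2)])
  qed (auto intro: has_field_derivative_at_within d)
qed

lemma scaled_laplace_0: "scaled_laplace c 0 g t 0 = g t"
  using gamma_weight_integral[of 0] by (simp add: scaled_laplace_def)

text \<open>
  For \<open>x > 0\<close> undo the substitution; \<open>g\<close> vanishes beyond \<open>1\<close>.
\<close>
lemma scaled_laplace_eq:
  assumes g: "g \<in> unit_supported" and c: "0 < c" "0 < x" and t: "0 \<le> t"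
  defines "p \<equiv> 1 / (c * x)"
  shows "scaled_laplace c 0 g t x = p * exp (p * t) * integral {t..1} (\<lambda>s. exp (- p * s) * g s)"
proof -
  define F where "F s = indicator {t..1} s * (exp (- p * (s - t)) * g s)" for s
  have cx: "0 < c * x" using c by simp
  have "gamma_weight 0 w * g (t + c * x * w) = F (t + c * x * w)" for w
  proof -
    have "p * (c * x * w) = w" using c by (simp add: p_def)
    moreover have "g (t + c * x * w) = 0" if "1 < t + c * x * w" using g that by (auto simp: unit_supported_def)
    moreover have "0 \<le> c * x * w \<longleftrightarrow> 0 \<le> w"
      using cx zero_le_mult_iff[of "c * x" w] by linarith
    ultimately show ?thesis
      by (auto simp: F_def gamma_weight_def indicator_def)
  qed
  then have "scaled_laplace c 0 g t x = (LINT w|lborel. F (t + c * x * w))" by (simp add: scaled_laplace_def)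
  also have "\<dots> = p * (LINT s|lborel. F s)"
    using lborel_integral_real_affine[of "c * x" F t] c by (simp add: p_def)
  also have "(LINT s|lborel. F s) = integral {t..1} (\<lambda>s. exp (- p * (s - t)) * g s)"
  proof -
    have "set_integrable lborel {t..1} (\<lambda>s. exp (- p * (s - t)) * g s)"
      using g by (intro borel_integrable_atLeastAtMost' continuous_intros)
        (auto simp: unit_supported_def intro: continuous_on_subset)
    from set_borel_integral_eq_integral(2)[OF this] show ?thesis
      by (simp add: F_def set_lebesgue_integral_def)
  qed
  also have "\<dots> = integral {t..1} (\<lambda>s. exp (p * t) * (exp (- p * s) * g s))"
  proof -
    have "exp (- p * (s - t)) = exp (p * t) * exp (- p * s)" for s
      using exp_add[of "p * t" "- p * s"] by (simp add: algebra_simps)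
    then show ?thesis by (simp only: mult.assoc)
  qed
  finally show ?thesis by simp
qed

text \<open>
  The equation \<open>x u\<^sub>t = u - g\<close> that the transform was made for, on the scale \<open>c x\<close>.
\<close>
lemma scaled_laplace_ode:
  assumes g: "g \<in> unit_supported" and c: "0 < c" "0 < x" and t: "t \<in> {0..1}"
  shows "((\<lambda>s. scaled_laplace c 0 g s x) has_real_derivative (scaled_laplace c 0 g t x - g t) / (c * x)) (at t within {0..1})"
proof -
  define p where "p = 1 / (c * x)"
  define k where "k s = exp (- p * s) * g s" for s
  have kc: "continuous_on A k" for A
    using g unfolding k_def unit_supported_def by (auto intro!: continuous_intros intro: continuous_on_subset)
  have k_split: "integral {s..1} k = integral {0..1} k - integral {0..s} k" if "s \<in> {0..1}" for s
    using Henstock_Kurzweil_Integration.integral_combine[of 0 s 1 k] that integrable_continuous_interval[OF kc] by simp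
  have "((\<lambda>s. p * exp (p * s) * (integral {0..1} k - integral {0..s} k)) has_real_derivative
      p * (p * exp (p * t) * integral {t..1} k) - p * exp (p * t) * k t) (at t within {0..1})"
    unfolding k_split[OF t]
    by (rule derivative_eq_intros integral_has_real_derivative kc t refl | simp)+
  also have "p * (p * exp (p * t) * integral {t..1} k) - p * exp (p * t) * k t = (scaled_laplace c 0 g t x - g t) / (c * x)"
  proof -
    have "exp (p * t) * k t = g t" unfolding k_def by (simp add: mult_exp_exp mult.assoc[symmetric])
    moreover have "p * exp (p * t) * integral {t..1} k = scaled_laplace c 0 g t x"
      using scaled_laplace_eq[OF g c, of t] t by (simp add: p_def k_def[abs_def])
    ultimately have "p * (p * exp (p * t) * integral {t..1} k) - p * exp (p * t) * k t = p * scaled_laplace c 0 g t x - p * g t"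
      by (simp only: mult.assoc)
    then show ?thesis by (simp add: p_def diff_divide_distrib)
  qed
  finally show ?thesis
  proof (rule has_field_derivative_transform_within[OF _ zero_less_one t])
    fix s :: real assume s: "s \<in> {0..1}"
    have "scaled_laplace c 0 g s x = p * exp (p * s) * integral {s..1} k"
      using scaled_laplace_eq[OF g c, of s] s by (simp add: p_def k_def[abs_def])
    then show "p * exp (p * s) * (integral {0..1} k - integral {0..s} k) = scaled_laplace c 0 g s x"
      by (simp only: k_split[OF s])
  qed
qed

section \<open>A contour estimate for an oscillating integrand\<close>

text \<open>
  The analytic function behind the oscillating bump: on \<open>(0, 1)\<close> its phase is \<open>- 31 \<kappa> / s\<close> and its modulus is
  flat at both ends. The values at \<open>0\<close> and \<open>1\<close> are the limits from within the triangle below.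
  The exponent \<open>\<kappa> = 2\<close> gives the square of the function for \<open>\<kappa> = 1\<close>.
\<close>
definition wave :: "real \<Rightarrow> complex \<Rightarrow> complex" where
  "wave \<kappa> s = (if s = 0 \<or> s = 1 then 0
     else exp (- (of_real \<kappa> * ((1 + 31 * \<i>) / s)) - of_real \<kappa> / (1 - s)))"

text \<open>
  The two other sides of the triangle over \<open>[0, 1]\<close> are the path to which the integral is moved.
  Along the ray from \<open>0\<close> through \<open>corner\<close> the real part of \<open>(1 + 31 \<i>) / s\<close> is much larger than on the
  real axis, since \<open>1 + 31 \<i>\<close> is close to the imaginary axis.
\<close>
definition corner :: complex where "corner = (1 + \<i>) / 2"

abbreviation triangle :: "complex set" where "triangle \<equiv> convex hull {0, corner, 1}"

lemma triangle_bounds: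
  assumes "s \<in> triangle"
  shows "0 \<le> Im s" "Im s \<le> Re s" "Im s \<le> 1 - Re s"
proof -
  obtain u v w where "0 \<le> u" "0 \<le> v" "0 \<le> w" "u + v + w = 1" "s = u *\<^sub>R 0 + v *\<^sub>R corner + w *\<^sub>R 1"
    using assms unfolding convex_hull_3 by blast
  then show "0 \<le> Im s" "Im s \<le> Re s" "Im s \<le> 1 - Re s"
    by (auto simp: corner_def)
qed

lemma Re_phase: "Re ((1 + 31 * \<i>) / s) = (Re s + 31 * Im s) / (cmod s)\<^sup>2"
  by (simp add: Re_divide cmod_power2)

lemma cmod_square_le: "\<bar>Im s\<bar> \<le> Re s \<Longrightarrow> (cmod s)\<^sup>2 \<le> 2 * (Re s)\<^sup>2"
  using power_mono[of "\<bar>Im s\<bar>" "Re s" 2] by (simp add: cmod_power2)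

lemma inverse_double_le:
  fixes r X :: real
  assumes "0 < r" "r \<le> 2 * X"
  shows "1 / (2 * r) \<le> X / r\<^sup>2"
proof -
  have "1 / (2 * r) = (r / 2) / r\<^sup>2" using assms by (simp add: power2_eq_square)
  also have "\<dots> \<le> X / r\<^sup>2" using assms by (intro divide_right_mono) auto
  finally show ?thesis .
qed

text \<open>
  Both exponents have a real part that blows up at the vertex in question because the triangle
  lies in the upper half-plane and inside the sectors of half-opening \<open>\<pi> / 4\<close> around the real axis
  at \<open>0\<close> and at \<open>1\<close>.
\<close>
lemma triangle_phases:
  assumes s: "s \<in> triangle" "s \<noteq> 0" "s \<noteq> 1"
  shows "1 / (2 * cmod s) \<le> Re ((1 + 31 * \<i>) / s)" "1 / (2 * cmod (1 - s)) \<le> Re (1 / (1 - s))"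
proof -
  note b = triangle_bounds[OF s(1)]
  have r: "0 < cmod s" "0 < cmod (1 - s)" using s by auto
  have double: "2 * x\<^sup>2 \<le> (2 * x)\<^sup>2" for x :: real by (simp add: power_mult_distrib)
  have "(cmod s)\<^sup>2 \<le> 2 * (Re s)\<^sup>2" using b by (intro cmod_square_le) auto
  also note double
  finally have "cmod s \<le> 2 * Re s" by (rule power2_le_imp_le) (use b in auto)
  then have "cmod s \<le> 2 * (Re s + 31 * Im s)" using b by auto
  then show "1 / (2 * cmod s) \<le> Re ((1 + 31 * \<i>) / s)"
    unfolding Re_phase by (rule inverse_double_le[OF r(1)])
  have "(cmod (1 - s))\<^sup>2 \<le> 2 * (Re (1 - s))\<^sup>2" using b by (intro cmod_square_le) auto
  also note double
  finally have "cmod (1 - s) \<le> 2 * Re (1 - s)" by (rule power2_le_imp_le) (use b in auto)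
  then have "1 / (2 * cmod (1 - s)) \<le> Re (1 - s) / (cmod (1 - s))\<^sup>2"
    by (rule inverse_double_le[OF r(2)])
  also have "\<dots> = Re (1 / (1 - s))"
    by (simp add: Re_divide cmod_power2)
  finally show "1 / (2 * cmod (1 - s)) \<le> Re (1 / (1 - s))" .
qed

lemma wave_norm:
  assumes "s \<noteq> 0" "s \<noteq> 1"
  shows "cmod (wave \<kappa> s) = exp (- (\<kappa> * Re ((1 + 31 * \<i>) / s)) - \<kappa> * Re (1 / (1 - s)))"
proof -
  have real_mult: "Re (of_real \<kappa> * z) = \<kappa> * Re z" for z by simp
  moreover have "Re (of_real \<kappa> / (1 - s)) = \<kappa> * Re (1 / (1 - s))"
    using real_mult[of "1 / (1 - s)"] by simp
  ultimately show ?thesis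
    unfolding wave_def using assms by (simp only: norm_exp_eq_Re if_False minus_complex.simps uminus_complex.simps simp_thms)
qed

lemma wave_bound_ends:
  assumes s: "s \<in> triangle" and \<kappa>: "0 < \<kappa>"
  shows "cmod (wave \<kappa> s) \<le> exp (- (\<kappa> / (2 * cmod s)))" "cmod (wave \<kappa> s) \<le> exp (- (\<kappa> / (2 * cmod (1 - s))))"
    "cmod (wave \<kappa> s) \<le> 1"
proof -
  have *: "cmod (wave \<kappa> s) \<le> exp (- (\<kappa> / (2 * cmod s)) - (\<kappa> / (2 * cmod (1 - s))))"
  proof (cases "s = 0 \<or> s = 1")
    case True
    then show ?thesis by (auto simp: wave_def)
  next
    case False
    have "\<kappa> * (1 / (2 * cmod s)) \<le> \<kappa> * Re ((1 + 31 * \<i>) / s)" "\<kappa> * (1 / (2 * cmod (1 - s))) \<le> \<kappa> * Re (1 / (1 - s))"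
      using False \<kappa> by (intro mult_left_mono triangle_phases[OF s]; simp)+
    then show ?thesis
      using False by (subst wave_norm) auto
  qed
  have "0 \<le> \<kappa> / (2 * cmod s)" "0 \<le> \<kappa> / (2 * cmod (1 - s))" using \<kappa> by auto
  then show "cmod (wave \<kappa> s) \<le> exp (- (\<kappa> / (2 * cmod s)))" "cmod (wave \<kappa> s) \<le> exp (- (\<kappa> / (2 * cmod (1 - s))))"
    "cmod (wave \<kappa> s) \<le> 1"
    by (auto intro!: order_trans[OF *])
qed

lemma flat_norm_tendsto:
  assumes "0 < \<kappa>"
  shows "((\<lambda>s. exp (- (\<kappa> / (2 * cmod (s - z))))) \<longlongrightarrow> 0) (at z)"
proof -
  have "filterlim (\<lambda>s. cmod (s - z)) (at_right 0) (at z)"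
    unfolding filterlim_at
    by (auto intro!: tendsto_eq_intros simp: eventually_at_filter)
  moreover have "((\<lambda>r. exp (- (\<kappa> / (2 * r)))) \<longlongrightarrow> 0) (at_right 0)"
    using assms by real_asymp
  ultimately show ?thesis
    by (rule filterlim_compose[rotated])
qed

lemma wave_holomorphic:
  assumes "0 \<notin> A" "1 \<notin> A"
  shows "wave \<kappa> holomorphic_on A"
proof -
  have "(\<lambda>s. exp (- (of_real \<kappa> * ((1 + 31 * \<i>) / s)) - of_real \<kappa> / (1 - s))) holomorphic_on A"
    using assms by (intro holomorphic_intros) auto
  then show ?thesis
    by (rule holomorphic_transform) (use assms in \<open>auto simp: wave_def\<close>)
qed

lemma wave_continuous:
  assumes \<kappa>: "0 < \<kappa>"
  shows "continuous_on triangle (wave \<kappa>)"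
  unfolding continuous_on_def
proof
  fix s assume s: "s \<in> triangle"
  have at_vertex: "(wave \<kappa> \<longlongrightarrow> wave \<kappa> z) (at z within triangle)"
    if z: "z = 0 \<or> z = 1" and b: "\<And>s. s \<in> triangle \<Longrightarrow> cmod (wave \<kappa> s) \<le> exp (- (\<kappa> / (2 * cmod (s - z))))" for z
  proof -
    have "(wave \<kappa> \<longlongrightarrow> 0) (at z within triangle)"
    proof (rule Lim_null_comparison)
      show "\<forall>\<^sub>F s in at z within triangle. norm (wave \<kappa> s) \<le> exp (- (\<kappa> / (2 * cmod (s - z))))"
        using b by (simp add: eventually_at_filter)
      show "((\<lambda>s. exp (- (\<kappa> / (2 * cmod (s - z))))) \<longlongrightarrow> 0) (at z within triangle)"
        by (rule tendsto_mono[OF at_le flat_norm_tendsto[OF \<kappa>]]) simp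
    qed
    then show ?thesis using z by (auto simp: wave_def)
  qed
  consider "s = 0" | "s = 1" | "s \<noteq> 0" "s \<noteq> 1" by blast
  then show "(wave \<kappa> \<longlongrightarrow> wave \<kappa> s) (at s within triangle)"
  proof cases
    case 1
    then show ?thesis using at_vertex[of 0] wave_bound_ends(1)[OF _ \<kappa>] by simp
  next
    case 2
    then show ?thesis using at_vertex[of 1] wave_bound_ends(2)[OF _ \<kappa>] by (simp add: norm_minus_commute)
  next
    case 3
    have "wave \<kappa> holomorphic_on (- {0, 1})" by (rule wave_holomorphic) auto
    then have "continuous_on (- {0, 1}) (wave \<kappa>)" by (rule holomorphic_on_imp_continuous_on)
    then have "isCont (wave \<kappa>) s"
      using 3 by (subst (asm) continuous_on_eq_continuous_at) (auto simp: open_Compl)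
    then show ?thesis
      using continuous_at_imp_continuous_at_within[of s "wave \<kappa>" triangle] by (simp only: continuous_within)
  qed
qed

text \<open>
  Cauchy's theorem on the triangle. On the first side, \<open>s = \<rho> (1 + \<i>)\<close> gives the exponent
  \<open>- p \<rho> - 16 / \<rho> \<le> - 8 sqrt p\<close>; on the second side \<open>Re s \<ge> 1 / 2\<close>, and \<open>p / 2 \<ge> 8 sqrt p\<close> once
  \<open>p \<ge> 256\<close>. The factor \<open>(- s) ^ i\<close>, which comes from differentiating in \<open>p\<close>, has modulus at most
  \<open>1\<close>, so that all derivatives obey the same bound.
\<close>
lemma contour_bound:
  fixes p \<kappa> :: real and i :: nat
  assumes p: "256 \<le> p" and \<kappa>: "1 \<le> \<kappa>"
  defines "Z \<equiv> \<lambda>s. (- s) ^ i * exp (- (of_real p * s)) * wave \<kappa> s"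
  shows "cmod (contour_integral (linepath 0 1) Z) \<le> 2 * exp (- 8 * sqrt p)"
proof -
  have \<kappa>0: "0 < \<kappa>" using \<kappa> by simp
  have Zc: "continuous_on triangle Z"
    unfolding Z_def by (intro continuous_intros wave_continuous[OF \<kappa>0])
  have "0 \<notin> interior triangle" "1 \<notin> interior triangle"
  proof -
    have "z \<notin> interior triangle" if z: "Im z = 0" for z
    proof
      assume "z \<in> interior triangle"
      then obtain e where e: "0 < e" "ball z e \<subseteq> triangle" using mem_interior by blast
      have "z - \<i> * of_real (e / 2) \<in> ball z e" using e(1) by (simp add: dist_norm norm_mult)
      then have "z - \<i> * of_real (e / 2) \<in> triangle" using e(2) by blast
      from triangle_bounds(1)[OF this] show False using z e(1) by simp
    qed
    then show "0 \<notin> interior triangle" "1 \<notin> interior triangle" by auto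
  qed
  then have Zh: "Z holomorphic_on interior triangle"
    unfolding Z_def by (intro holomorphic_intros wave_holomorphic)
  have "(Z has_contour_integral 0) (linepath 0 corner +++ linepath corner 1 +++ linepath 1 0)"
    by (rule Cauchy_theorem_triangle_interior[OF Zc Zh])
  then have sum0: "contour_integral (linepath 0 corner) Z + contour_integral (linepath corner 1) Z
      + contour_integral (linepath 1 0) Z = 0"
    by (rule has_chain_integral_chain_integral3)
  have seg: "closed_segment a b \<subseteq> triangle" if "a \<in> {0, corner, 1}" "b \<in> {0, corner, 1}" for a b
    by (intro closed_segment_subset convex_convex_hull hull_inc that)
  have rev: "contour_integral (linepath 1 0) Z = - contour_integral (linepath 0 1) Z"
    by (rule contour_integral_reverse_linepath, rule continuous_on_subset[OF Zc seg]) auto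
  have norm_Z: "cmod (Z s) \<le> exp (- (p * Re s)) * cmod (wave \<kappa> s)" if "s \<in> triangle" for s
  proof -
    have "cmod s \<le> 1"
    proof -
      have "cmod corner \<le> 1"
        using norm_triangle_ineq[of 1 \<i>] by (simp add: corner_def norm_divide)
      then have "triangle \<subseteq> cball 0 1"
        by (intro hull_minimal) auto
      then show ?thesis using that by auto
    qed
    then have "cmod s ^ i \<le> 1" by (simp add: power_le_one)
    then have "cmod s ^ i * (exp (- (p * Re s)) * cmod (wave \<kappa> s)) \<le> 1 * (exp (- (p * Re s)) * cmod (wave \<kappa> s))"
      by (intro mult_right_mono) auto
    then show ?thesis by (simp add: Z_def norm_mult norm_power)
  qed
  have sqrt_p: "16 \<le> sqrt p" "sqrt p * sqrt p = p"
    using p real_le_rsqrt[of 16 p] by auto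
  have b1: "cmod (Z s) \<le> exp (- 8 * sqrt p)" if s: "s \<in> closed_segment 0 corner" for s
  proof (cases "s = 0 \<or> s = 1")
    case True
    then show ?thesis by (auto simp: Z_def wave_def)
  next
    case False
    obtain u where u: "0 \<le> u" "u \<le> 1" "s = of_real u * corner"
      using s unfolding closed_segment_def by (auto simp: scaleR_conv_of_real)
    define \<rho> where "\<rho> = u / 2"
    have "Re s = u / 2" "Im s = u / 2" unfolding u(3) by (simp_all add: corner_def)
    then have \<rho>: "0 < \<rho>" "Re s = \<rho>" "Im s = \<rho>" using u False by (auto simp: \<rho>_def less_le)
    have s_tri: "s \<in> triangle" using seg[of 0 corner] s by auto
    have ph: "Re ((1 + 31 * \<i>) / s) = 16 / \<rho>"
      unfolding Re_phase cmod_power2 \<rho> using \<rho>(1) by (simp add: power2_eq_square field_simps)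
    have "0 \<le> \<kappa> * Re (1 / (1 - s))"
      using triangle_phases(2)[OF s_tri] False \<kappa>0 by (intro mult_nonneg_nonneg) (auto intro: order_trans[rotated])
    moreover have "16 / \<rho> \<le> \<kappa> * Re ((1 + 31 * \<i>) / s)"
      unfolding ph using \<kappa> \<rho>(1) by (simp add: field_simps)
    moreover have "8 * sqrt p \<le> p * \<rho> + 16 / \<rho>"
    proof -
      have "0 \<le> (sqrt p * \<rho> - 4)\<^sup>2" by simp
      then have "8 * sqrt p * \<rho> \<le> p * \<rho> * \<rho> + 16"
        using sqrt_p(2) by (simp add: power2_eq_square algebra_simps)
      then show ?thesis using \<rho>(1) by (simp add: field_simps)
    qed
    ultimately have "- (p * Re s) + (- (\<kappa> * Re ((1 + 31 * \<i>) / s)) - \<kappa> * Re (1 / (1 - s))) \<le> - 8 * sqrt p"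
      using \<rho>(2) by simp
    then have "exp (- (p * Re s)) * cmod (wave \<kappa> s) \<le> exp (- 8 * sqrt p)"
      using False by (subst wave_norm) (auto simp: mult_exp_exp)
    with norm_Z[OF s_tri] show ?thesis by linarith
  qed
  have b2: "cmod (Z s) \<le> exp (- 8 * sqrt p)" if s: "s \<in> closed_segment corner 1" for s
  proof -
    have s_tri: "s \<in> triangle" using seg[of corner 1] s by auto
    obtain u where u: "0 \<le> u" "u \<le> 1" "s = (1 - u) *\<^sub>R corner + u *\<^sub>R 1"
      using s unfolding closed_segment_def by auto
    have "Re s = 1 / 2 + u / 2" unfolding u(3) by (simp add: corner_def algebra_simps diff_divide_distrib)
    then have "1 / 2 \<le> Re s" using u(1) by (metis add.commute divide_nonneg_pos le_add_same_cancel2 zero_less_numeral)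
    then have "p * (1 / 2) \<le> p * Re s" using p by (intro mult_left_mono) auto
    moreover have "16 * sqrt p \<le> sqrt p * sqrt p" using sqrt_p by (intro mult_right_mono) auto
    ultimately have "- (p * Re s) \<le> - 8 * sqrt p" using sqrt_p(2) by linarith
    then have "exp (- (p * Re s)) * cmod (wave \<kappa> s) \<le> exp (- 8 * sqrt p) * 1"
      by (intro mult_mono wave_bound_ends(3)[OF s_tri \<kappa>0]) auto
    with norm_Z[OF s_tri] show ?thesis by linarith
  qed
  have len: "cmod (corner - 0) \<le> 1" "cmod (1 - corner) \<le> 1"
    by (auto simp: corner_def cmod_def power2_eq_square real_le_lsqrt)
  have "cmod (contour_integral (linepath 0 corner) Z) \<le> exp (- 8 * sqrt p) * cmod (corner - 0)"
    by (rule contour_integral_bound_linepath[OF _ _ b1])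
       (auto intro!: contour_integrable_continuous_linepath continuous_on_subset[OF Zc seg])
  also have "\<dots> \<le> exp (- 8 * sqrt p) * 1" using len by (intro mult_left_mono) auto
  finally have 1: "cmod (contour_integral (linepath 0 corner) Z) \<le> exp (- 8 * sqrt p)" by simp
  have "cmod (contour_integral (linepath corner 1) Z) \<le> exp (- 8 * sqrt p) * cmod (1 - corner)"
    by (rule contour_integral_bound_linepath[OF _ _ b2])
       (auto intro!: contour_integrable_continuous_linepath continuous_on_subset[OF Zc seg])
  also have "\<dots> \<le> exp (- 8 * sqrt p) * 1" using len by (intro mult_left_mono) auto
  finally have 2: "cmod (contour_integral (linepath corner 1) Z) \<le> exp (- 8 * sqrt p)" by simp
  have "contour_integral (linepath 0 1) Z = contour_integral (linepath 0 corner) Z + contour_integral (linepath corner 1) Z"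
    using sum0 unfolding rev by (simp add: algebra_simps)
  then show ?thesis
    using 1 2 norm_triangle_ineq[of "contour_integral (linepath 0 corner) Z" "contour_integral (linepath corner 1) Z"]
    by simp
qed

section \<open>The oscillating bump and its Laplace moments\<close>

text \<open>
  For \<open>p = 1 / s\<close> these are the real and imaginary parts of \<open>exp (- (1 + \<omega> \<i>) / s)\<close> and their combinations,
  a family that is stable under differentiation.
\<close>
definition damped_osc :: "real \<Rightarrow> real \<Rightarrow> real \<Rightarrow> real \<Rightarrow> real" where
  "damped_osc \<omega> a b p = exp (- p) * (a * cos (\<omega> * p) + b * sin (\<omega> * p))"

lemma damped_osc_rapid: "damped_osc \<omega> a b \<in> rapid"
  unfolding rapid_def
proof (intro CollectI conjI allI)
  show "continuous_on {0<..} (damped_osc \<omega> a b)"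
    unfolding damped_osc_def[abs_def] by (intro continuous_intros)
  fix N
  show "((\<lambda>p. p ^ N * damped_osc \<omega> a b p) \<longlongrightarrow> 0) at_top"
  proof (rule Lim_null_comparison)
    show "((\<lambda>p. (\<bar>a\<bar> + \<bar>b\<bar>) * (p ^ N / exp p)) \<longlongrightarrow> 0) at_top"
      using tendsto_mult_right_zero[OF tendsto_power_div_exp_0[of N]] .
    show "\<forall>\<^sub>F p in at_top. norm (p ^ N * damped_osc \<omega> a b p) \<le> (\<bar>a\<bar> + \<bar>b\<bar>) * (p ^ N / exp p)"
      using eventually_ge_at_top[of 0]
    proof eventually_elim
      case (elim p)
      have "\<bar>a * cos (\<omega> * p) + b * sin (\<omega> * p)\<bar> \<le> \<bar>a\<bar> * \<bar>cos (\<omega> * p)\<bar> + \<bar>b\<bar> * \<bar>sin (\<omega> * p)\<bar>"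
        by (metis abs_mult abs_triangle_ineq)
      also have "\<dots> \<le> \<bar>a\<bar> * 1 + \<bar>b\<bar> * 1" by (intro add_mono mult_left_mono) auto
      finally have "(p ^ N * exp (- p)) * \<bar>a * cos (\<omega> * p) + b * sin (\<omega> * p)\<bar> \<le> (p ^ N * exp (- p)) * (\<bar>a\<bar> + \<bar>b\<bar>)"
        using elim by (intro mult_left_mono) auto
      then show ?case using elim by (simp add: damped_osc_def abs_mult exp_minus divide_inverse mult_ac)
    qed
  qed
qed

lemma damped_osc_derivs: "derivs_in k {0<..} rapid (damped_osc \<omega> a b)"
proof (induction k arbitrary: a b)
  case (Suc k)
  show ?case
  proof (rule derivs_in_SucI[OF damped_osc_rapid _ Suc.IH])
    fix p :: real
    show "(damped_osc \<omega> a b has_real_derivative damped_osc \<omega> (\<omega> * b - a) (- \<omega> * a - b) p) (at p within {0<..})"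
      unfolding damped_osc_def[abs_def] by (auto intro!: derivative_eq_intros simp: algebra_simps)
  qed
qed (simp add: damped_osc_rapid)

definition osc_bump :: "real \<Rightarrow> real" where
  "osc_bump s = flat_ext 0 (damped_osc 31 0 1) s * flat_ext 0 (damped_osc 0 1 0) (1 + -1 * s)"

lemma osc_bump_eq: "osc_bump s = (if 0 < s \<and> s < 1 then exp (- (1 / s)) * sin (31 / s) * exp (- (1 / (1 - s))) else 0)"
  by (auto simp: osc_bump_def flat_ext_def damped_osc_def)

lemma osc_bump_Ck: "Ck_interval k UNIV osc_bump"
  unfolding osc_bump_def[abs_def]
  by (intro Ck_interval_mult Ck_interval_affine flat_ext_Ck damped_osc_derivs)

text \<open>
  The derivative of a function vanishing off \<open>[0, 1]\<close> vanishes off \<open>[0, 1]\<close>, as the complement is open.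
\<close>
lemma derivs_in_unit_supported:
  "Ck_interval k UNIV g \<Longrightarrow> (\<And>x. x \<notin> {0..1} \<Longrightarrow> g x = 0) \<Longrightarrow> derivs_in k UNIV unit_supported g"
proof (induction k arbitrary: g)
  case (Suc k)
  then obtain g' where g': "\<And>t. (g has_real_derivative g' t) (at t)" "Ck_interval k UNIV g'" by auto
  have "g' x = 0" if x: "x \<notin> {0..1}" for x
  proof -
    have "(g has_real_derivative 0) (at x)"
      by (rule has_field_derivative_transform_within_open[of "\<lambda>_. 0" _ _ "- {0..1}"])
         (use x Suc.prems(2) in \<open>auto simp: open_Compl\<close>)
    then show ?thesis using DERIV_unique g'(1) by blast
  qed
  then have "derivs_in k UNIV unit_supported g'" by (intro Suc.IH g')
  then show ?case
    using Suc.prems g'(1) by (intro derivs_in_SucI[where g'=g']) (auto simp: unit_supported_def)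
qed (auto simp: unit_supported_def)

lemma osc_bump_derivs: "derivs_in k UNIV unit_supported osc_bump"
  by (rule derivs_in_unit_supported[OF osc_bump_Ck]) (auto simp: osc_bump_eq)

lemma osc_bump_sq_derivs: "derivs_in k UNIV unit_supported (\<lambda>s. osc_bump s * osc_bump s)"
  by (rule derivs_in_unit_supported[OF Ck_interval_mult[OF osc_bump_Ck osc_bump_Ck]]) (auto simp: osc_bump_eq)

text \<open>
  The \<open>i\<close>-th derivative of the Laplace transform of \<open>g\<close> over \<open>[0, 1]\<close>.
\<close>
definition moment :: "nat \<Rightarrow> (real \<Rightarrow> real) \<Rightarrow> real \<Rightarrow> real" where
  "moment i g p = integral {0..1} (\<lambda>s. (- s) ^ i * (exp (- p * s) * g s))"

lemma moment_deriv:
  assumes g: "continuous_on UNIV g"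
  shows "(moment i g has_real_derivative moment (Suc i) g p) (at p)"
proof -
  have gc: "continuous_on A g" for A using g by (rule continuous_on_subset) simp
  have "((\<lambda>p. integral (cbox 0 1) (\<lambda>s. (- s) ^ i * (exp (- p * s) * g s))) has_field_derivative
      integral (cbox 0 1) (\<lambda>s. (- s) ^ Suc i * (exp (- p * s) * g s))) (at p within UNIV)"
  proof (rule leibniz_rule_field_derivative)
    show "((\<lambda>p. (- s) ^ i * (exp (- p * s) * g s)) has_field_derivative (- s) ^ Suc i * (exp (- p * s) * g s)) (at p within UNIV)" for p s
      by (auto intro!: derivative_eq_intros)
    show "(\<lambda>s. (- s) ^ i * (exp (- p * s) * g s)) integrable_on cbox 0 1" for p
      by (intro integrable_continuous continuous_intros gc)
    show "continuous_on (UNIV \<times> cbox 0 1) (\<lambda>(p, s). (- s) ^ Suc i * (exp (- p * s) * g s))"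
      unfolding split_beta by (intro continuous_intros continuous_on_compose2[OF gc]) auto
  qed auto
  then show ?thesis by (simp add: moment_def[abs_def])
qed

lemma wave_real:
  assumes "0 < s" "s < 1"
  shows "wave \<kappa> (of_real s) = of_real (exp (- (\<kappa> / s) - \<kappa> / (1 - s))) * cis (- (31 * \<kappa> / s))"
proof -
  have "- (of_real \<kappa> * ((1 + 31 * \<i>) / of_real s)) - of_real \<kappa> / (1 - of_real s)
      = of_real (- (\<kappa> / s) - \<kappa> / (1 - s)) + \<i> * of_real (- (31 * \<kappa> / s))"
    using assms by (simp add: field_simps)
  then show ?thesis using assms unfolding wave_def
    by (simp only: exp_add exp_of_real cis_conv_exp) (auto simp: of_real_eq_1_iff)
qed

lemma wave_moment:
  assumes \<kappa>: "1 \<le> \<kappa>" and p: "256 \<le> p"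
  shows "\<bar>integral {0..1} (\<lambda>s. (- s) ^ i * (exp (- p * s) * Re (wave \<kappa> (of_real s))))\<bar> \<le> 2 * exp (- 8 * sqrt p)"
    and "\<bar>integral {0..1} (\<lambda>s. (- s) ^ i * (exp (- p * s) * Im (wave \<kappa> (of_real s))))\<bar> \<le> 2 * exp (- 8 * sqrt p)"
proof -
  define Z where "Z s = (- s) ^ i * exp (- (of_real p * s)) * wave \<kappa> s" for s :: complex
  have seg: "closed_segment 0 1 \<subseteq> triangle"
    by (intro closed_segment_subset convex_convex_hull hull_inc) auto
  have "continuous_on triangle Z"
    unfolding Z_def by (intro continuous_intros wave_continuous) (use \<kappa> in auto)
  then have "Z contour_integrable_on linepath 0 1"
    by (intro contour_integrable_continuous_linepath continuous_on_subset[OF _ seg])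
  then have "(Z has_contour_integral contour_integral (linepath 0 1) Z) (linepath 0 1)"
    by (rule has_contour_integral_integral)
  then have hi: "((\<lambda>s. Z (of_real s)) has_integral contour_integral (linepath 0 1) Z) {0..1}"
    unfolding has_contour_integral_linepath by (simp add: linepath_def scaleR_conv_of_real)
  have Zr: "Z (of_real s) = of_real ((- s) ^ i * exp (- p * s)) * wave \<kappa> (of_real s)" for s
    using exp_of_real[of "- p * s", where 'a=complex] by (simp add: Z_def)
  have bound: "cmod (contour_integral (linepath 0 1) Z) \<le> 2 * exp (- 8 * sqrt p)"
    unfolding Z_def by (rule contour_bound[OF p \<kappa>])
  have "((\<lambda>s. (- s) ^ i * (exp (- p * s) * Re (wave \<kappa> (of_real s)))) has_integral Re (contour_integral (linepath 0 1) Z)) {0..1}"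
    using has_integral_Re[OF hi] by (simp add: Zr mult.assoc)
  then show "\<bar>integral {0..1} (\<lambda>s. (- s) ^ i * (exp (- p * s) * Re (wave \<kappa> (of_real s))))\<bar> \<le> 2 * exp (- 8 * sqrt p)"
    using bound abs_Re_le_cmod[of "contour_integral (linepath 0 1) Z"] by (simp add: integral_unique)
  have "((\<lambda>s. (- s) ^ i * (exp (- p * s) * Im (wave \<kappa> (of_real s)))) has_integral Im (contour_integral (linepath 0 1) Z)) {0..1}"
    using has_integral_Im[OF hi] by (simp add: Zr mult.assoc)
  then show "\<bar>integral {0..1} (\<lambda>s. (- s) ^ i * (exp (- p * s) * Im (wave \<kappa> (of_real s))))\<bar> \<le> 2 * exp (- 8 * sqrt p)"
    using bound abs_Im_le_cmod[of "contour_integral (linepath 0 1) Z"] by (simp add: integral_unique)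
qed

lemma osc_bump_wave:
  assumes "s \<in> {0..1}"
  shows "osc_bump s = - Im (wave 1 (of_real s))"
proof (cases "0 < s \<and> s < 1")
  case True
  then have "Im (wave 1 (of_real s)) = exp (- (1 / s) - 1 / (1 - s)) * - sin (31 / s)"
    by (subst wave_real) simp_all
  also have "exp (- (1 / s) - 1 / (1 - s)) = exp (- (1 / s)) * exp (- (1 / (1 - s)))"
    by (simp add: mult_exp_exp)
  finally show ?thesis using True by (simp add: osc_bump_eq)
next
  case False
  then have "s = 0 \<or> s = 1" using assms by auto
  then show ?thesis by (auto simp: osc_bump_eq wave_def)
qed

lemma moment_osc_bump_small:
  assumes "256 \<le> p"
  shows "\<bar>moment i osc_bump p\<bar> \<le> 2 * exp (- 8 * sqrt p)"
proof -
  have "moment i osc_bump p = integral {0..1} (\<lambda>s. - ((- s) ^ i * (exp (- p * s) * Im (wave 1 (of_real s)))))"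
    unfolding moment_def by (intro integral_cong) (simp add: osc_bump_wave)
  then show ?thesis using wave_moment(2)[of 1 p i] assms by simp
qed

definition envelope :: "real \<Rightarrow> real" where
  "envelope s = flat_ext 0 (damped_osc 0 1 0) s * flat_ext 0 (damped_osc 0 1 0) (1 + -1 * s)"

lemma envelope_continuous: "continuous_on A envelope"
proof -
  have "Ck_interval 0 UNIV envelope"
    unfolding envelope_def[abs_def]
    by (intro Ck_interval_mult Ck_interval_affine flat_ext_Ck damped_osc_derivs)
  then show ?thesis by (auto intro: continuous_on_subset)
qed

lemma envelope_eq: "envelope s = (if 0 < s \<and> s < 1 then exp (- (1 / s)) * exp (- (1 / (1 - s))) else 0)"
  by (auto simp: envelope_def flat_ext_def damped_osc_def)

text \<open>
  The identity \<open>(Im z)\<^sup>2 = (\<bar>z\<bar>\<^sup>2 - Re (z\<^sup>2)) / 2\<close>. It splits the energy into a positive integral and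
  an oscillating one that the contour estimate controls.
\<close>
lemma osc_bump_sq:
  assumes "s \<in> {0..1}"
  shows "osc_bump s * osc_bump s = (envelope s)\<^sup>2 / 2 - Re (wave 2 (of_real s)) / 2"
proof (cases "0 < s \<and> s < 1")
  case True
  have "cos (62 / s) = 1 - 2 * (sin (31 / s))\<^sup>2" using cos_double_sin[of "31 / s"] by simp
  then have "(sin (31 / s))\<^sup>2 = 1 / 2 - cos (62 / s) / 2" by linarith
  moreover have "(exp (- (1 / s)) * exp (- (1 / (1 - s))))\<^sup>2 = exp (- (2 / s) - 2 / (1 - s))"
    by (simp add: power2_eq_square mult_exp_exp)
  moreover have "Re (wave 2 (of_real s)) = exp (- (2 / s) - 2 / (1 - s)) * cos (62 / s)"
    using True by (simp add: wave_real)
  moreover have "osc_bump s * osc_bump s = (exp (- (1 / s)) * exp (- (1 / (1 - s))))\<^sup>2 * (sin (31 / s))\<^sup>2"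
    using True by (simp add: osc_bump_eq power2_eq_square mult_ac)
  ultimately show ?thesis using True by (simp add: envelope_eq right_diff_distrib)
next
  case False
  then have "s = 0 \<or> s = 1" using assms by auto
  then show ?thesis by (auto simp: osc_bump_eq envelope_eq wave_def)
qed

text \<open>
  The exponent \<open>p s + 2 / s\<close> of the positive part is at most \<open>4 sqrt p\<close> for \<open>s\<close> between \<open>1 / sqrt p\<close> and
  \<open>2 / sqrt p\<close>, and the envelope at the end \<open>1\<close> costs at most the constant \<open>exp (- 4)\<close>; this interval alone gives the
  bound.
\<close>
lemma energy_large:
  assumes p: "256 \<le> p"
  shows "exp (- 4 - 4 * sqrt p) / (2 * sqrt p) - exp (- 8 * sqrt p) \<le> moment 0 (\<lambda>s. osc_bump s * osc_bump s) p"
proof -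
  \<comment> \<open>The minimum of \<open>p s + 2 / s\<close> lies in \<open>[q, 2 q]\<close>.\<close>
  define q where "q = 1 / sqrt p"
  have sp: "16 \<le> sqrt p" using p real_le_rsqrt[of 16 p] by auto
  have q: "0 < q" "2 * q \<le> 1 / 2" "p * q = sqrt p" using sp p by (auto simp: q_def field_simps)
  have ob: "continuous_on A osc_bump" for A
    using osc_bump_Ck[of 0] by (auto intro: continuous_on_subset)
  have int: "(\<lambda>s. exp (- p * s) * (osc_bump s * osc_bump s)) integrable_on {0..1}"
    "(\<lambda>s. exp (- p * s) * (envelope s)\<^sup>2) integrable_on A" if "A = {0..1} \<or> A = {q..2*q}" for A
    using that by (auto intro!: integrable_continuous_interval continuous_intros envelope_continuous ob)
  have "integral {0..1} (\<lambda>s. exp (- p * s) * Re (wave 2 (of_real s)))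
      = integral {0..1} (\<lambda>s. exp (- p * s) * (envelope s)\<^sup>2 - 2 * (exp (- p * s) * (osc_bump s * osc_bump s)))"
    by (intro integral_cong) (simp add: osc_bump_sq algebra_simps)
  also have "\<dots> = integral {0..1} (\<lambda>s. exp (- p * s) * (envelope s)\<^sup>2)
      - 2 * moment 0 (\<lambda>s. osc_bump s * osc_bump s) p"
    by (subst integral_diff) (use int in \<open>auto simp: moment_def\<close>)
  finally have main: "2 * moment 0 (\<lambda>s. osc_bump s * osc_bump s) p \<ge>
      integral {0..1} (\<lambda>s. exp (- p * s) * (envelope s)\<^sup>2) - 2 * exp (- 8 * sqrt p)"
    using wave_moment(1)[of 2 p 0] p by simp
  have "integral {q..2*q} (\<lambda>s. exp (- 4 - 4 * sqrt p)) \<le> integral {q..2*q} (\<lambda>s. exp (- p * s) * (envelope s)\<^sup>2)"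
  proof (rule integral_le)
    fix s assume s: "s \<in> {q..2*q}"
    then have s01: "0 < s" "s \<le> 1 / 2" using q by auto
    have "p * s \<le> p * (2 * q)" using s p by (intro mult_left_mono) auto
    moreover have "1 / s \<le> 1 / q" using s q(1) by (intro divide_left_mono) auto
    moreover have "1 / q = sqrt p" by (simp add: q_def)
    moreover have "1 / (1 - s) \<le> 1 / (1 / 2)" using s01 by (intro divide_left_mono) auto
    moreover have "p * (2 * q) = 2 * sqrt p" using q(3) by simp
    ultimately have "- 4 - 4 * sqrt p \<le> - p * s + 2 * (- (1 / s)) + 2 * (- (1 / (1 - s)))"
      by simp
    then have "exp (- 4 - 4 * sqrt p) \<le> exp (- p * s + 2 * (- (1 / s)) + 2 * (- (1 / (1 - s))))" by simp
    also have "\<dots> = exp (- p * s) * (envelope s)\<^sup>2"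
    proof -
      have "envelope s = exp (- (1 / s)) * exp (- (1 / (1 - s)))" using s01 by (simp add: envelope_eq)
      then show ?thesis by (simp only: exp_add exp_double power_mult_distrib mult.assoc)
    qed
    finally show "exp (- 4 - 4 * sqrt p) \<le> exp (- p * s) * (envelope s)\<^sup>2" .
  qed (use int in auto)
  also have "\<dots> \<le> integral {0..1} (\<lambda>s. exp (- p * s) * (envelope s)\<^sup>2)"
    by (rule integral_subset_le) (use int q in auto)
  finally have "q * exp (- 4 - 4 * sqrt p) \<le> integral {0..1} (\<lambda>s. exp (- p * s) * (envelope s)\<^sup>2)"
    using q(1) by simp
  with main show ?thesis by (simp add: q_def)
qed

section \<open>The correction factor and failure of uniqueness\<close>

definition bounded_fun :: "(real \<Rightarrow> real) set" where
  "bounded_fun = {g. continuous_on {0<..} g \<and> (\<exists>C. \<forall>p>0. \<bar>g p\<bar> \<le> C)}"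

lemma bounded_fun_add: "f \<in> bounded_fun \<Longrightarrow> g \<in> bounded_fun \<Longrightarrow> (\<lambda>p. f p + g p) \<in> bounded_fun"
proof -
  assume f: "f \<in> bounded_fun" and g: "g \<in> bounded_fun"
  then obtain A B where "\<forall>p>0. \<bar>f p\<bar> \<le> A" "\<forall>p>0. \<bar>g p\<bar> \<le> B" by (auto simp: bounded_fun_def)
  then have "\<forall>p>0. \<bar>f p + g p\<bar> \<le> A + B"
    by (meson abs_triangle_ineq add_mono order_trans)
  then show ?thesis using f g by (auto simp: bounded_fun_def intro!: continuous_intros)
qed

lemma bounded_fun_mult: "f \<in> bounded_fun \<Longrightarrow> g \<in> bounded_fun \<Longrightarrow> (\<lambda>p. f p * g p) \<in> bounded_fun"
proof -
  assume f: "f \<in> bounded_fun" and g: "g \<in> bounded_fun"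
  then obtain A B where AB: "\<forall>p>0. \<bar>f p\<bar> \<le> A" "\<forall>p>0. \<bar>g p\<bar> \<le> B" by (auto simp: bounded_fun_def)
  have "\<bar>f p * g p\<bar> \<le> A * B" if "0 < p" for p
    unfolding abs_mult using AB that by (intro mult_mono) (auto intro: order_trans[OF abs_ge_zero])
  then show ?thesis using f g by (auto simp: bounded_fun_def intro!: continuous_intros)
qed

lemma rapid_add: "f \<in> rapid \<Longrightarrow> g \<in> rapid \<Longrightarrow> (\<lambda>p. f p + g p) \<in> rapid"
  unfolding rapid_def by (auto simp: distrib_left intro!: continuous_intros tendsto_add_zero)

lemma rapid_mult_bdd: 
  assumes f: "f \<in> rapid" and g: "g \<in> bounded_fun"
  shows "(\<lambda>p. f p * g p) \<in> rapid"
proof -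
  from g obtain C where C: "\<forall>p>0. \<bar>g p\<bar> \<le> C" by (auto simp: bounded_fun_def)
  have "((\<lambda>p. p ^ N * (f p * g p)) \<longlongrightarrow> 0) at_top" for N
  proof (rule Lim_null_comparison)
    have "((\<lambda>p. \<bar>p ^ N * f p\<bar>) \<longlongrightarrow> 0) at_top"
      using f by (auto simp: rapid_def intro: tendsto_rabs_zero)
    from tendsto_mult_left_zero[OF this, of C]
    show "((\<lambda>p. \<bar>p ^ N * f p\<bar> * C) \<longlongrightarrow> 0) at_top" .
    show "\<forall>\<^sub>F p in at_top. norm (p ^ N * (f p * g p)) \<le> \<bar>p ^ N * f p\<bar> * C"
      using eventually_gt_at_top[of 0]
    proof eventually_elim
      case (elim p)
      have "\<bar>p ^ N * f p\<bar> * \<bar>g p\<bar> \<le> \<bar>p ^ N * f p\<bar> * C" using C elim by (intro mult_left_mono) auto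
      then show ?case by (simp add: abs_mult mult_ac)
    qed
  qed
  then show ?thesis using f g by (auto simp: rapid_def bounded_fun_def intro!: continuous_intros)
qed

lemma bounded_fun_const: "derivs_in k {0<..} bounded_fun (\<lambda>_. c)"
proof (induction k arbitrary: c)
  case (Suc k)
  have "(\<lambda>_. c) \<in> bounded_fun" by (auto simp: bounded_fun_def)
  then show ?case by (rule derivs_in_SucI[OF _ _ Suc[of 0]]) simp
qed (auto simp: bounded_fun_def)

abbreviation bump_moment :: "nat \<Rightarrow> real \<Rightarrow> real" where
  "bump_moment i \<equiv> moment i osc_bump"

abbreviation energy :: "nat \<Rightarrow> real \<Rightarrow> real" where
  "energy i \<equiv> moment i (\<lambda>s. osc_bump s * osc_bump s)"

lemma osc_bump_continuous: "continuous_on A osc_bump"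
  using osc_bump_Ck[of 0] by (auto intro: continuous_on_subset)

lemma osc_bump_sq_continuous: "continuous_on A (\<lambda>s. osc_bump s * osc_bump s)"
  by (intro continuous_intros osc_bump_continuous)

lemma energy_eventually: "\<forall>\<^sub>F p in at_top. exp (- 5 * sqrt p) \<le> energy 0 p"
proof -
  have "\<forall>\<^sub>F p in at_top. exp (- 5 * sqrt p) \<le> exp (- 4 - 4 * sqrt p) / (2 * sqrt p) - exp (- 8 * sqrt p)"
    by real_asymp
  then show ?thesis
    using eventually_ge_at_top[of 256]
    by eventually_elim (use energy_large order_trans in blast)
qed

text \<open>
  Positive for large \<open>p\<close> and decreasing in \<open>p\<close>, hence positive everywhere.
\<close>
lemma energy_pos:
  assumes "0 < p"
  shows "0 < energy 0 p"
proof -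
  obtain q where q: "p < q" "exp (- 5 * sqrt q) \<le> energy 0 q"
    using eventually_happens[OF eventually_conj[OF eventually_gt_at_top[of p] energy_eventually]] by auto
  have "0 < energy 0 q" using q(2) by (rule less_le_trans[rotated]) simp
  also have "energy 0 q \<le> energy 0 p"
    unfolding moment_def
  proof (rule integral_le)
    fix s :: real assume s: "s \<in> {0..1}"
    have "exp (- q * s) \<le> exp (- p * s)" using s q(1) by (simp add: mult_right_mono)
    then show "(- s) ^ 0 * (exp (- q * s) * (osc_bump s * osc_bump s)) \<le> (- s) ^ 0 * (exp (- p * s) * (osc_bump s * osc_bump s))"
      by (simp add: mult_right_mono)
  qed (auto intro!: integrable_continuous_interval continuous_intros osc_bump_continuous)
  finally show ?thesis .
qed

lemma moment_continuous: "continuous_on UNIV g \<Longrightarrow> continuous_on A (moment i g)"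
  by (meson DERIV_continuous_on has_field_derivative_at_within moment_deriv)

lemma energy_ratio_bdd: "(\<lambda>p. energy i p / energy 0 p) \<in> bounded_fun"
proof -
  have "\<bar>energy i p\<bar> \<le> energy 0 p" for p
    unfolding moment_def
  proof (rule integral_norm_bound_integral[where 'n=real and 'a=real, unfolded real_norm_def])
    fix s :: real assume s: "s \<in> {0..1}"
    have "\<bar>s\<bar> ^ i \<le> 1" using s by (intro power_le_one) auto
    then have "\<bar>s\<bar> ^ i * (exp (- p * s) * (osc_bump s * osc_bump s)) \<le> 1 * (exp (- p * s) * (osc_bump s * osc_bump s))"
      by (intro mult_right_mono) auto
    then show "\<bar>(- s) ^ i * (exp (- p * s) * (osc_bump s * osc_bump s))\<bar> \<le> (- s) ^ 0 * (exp (- p * s) * (osc_bump s * osc_bump s))"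
      by (simp add: abs_mult power_abs)
  qed (auto intro!: integrable_continuous_interval continuous_intros osc_bump_continuous)
  then have "\<bar>energy i p / energy 0 p\<bar> \<le> 1" if "0 < p" for p
    using energy_pos[OF that] by (simp add: abs_divide)
  moreover have "continuous_on {0<..} (\<lambda>p. energy i p / energy 0 p)"
    using energy_pos by (intro continuous_intros moment_continuous osc_bump_continuous) (auto simp: less_le)
  ultimately show ?thesis by (auto simp: bounded_fun_def)
qed

lemma bump_ratio_rapid: "(\<lambda>p. bump_moment i p / energy 0 p) \<in> rapid"
proof -
  have "((\<lambda>p. p ^ N * (bump_moment i p / energy 0 p)) \<longlongrightarrow> 0) at_top" for N
  proof (rule Lim_null_comparison)
    show "((\<lambda>p::real. p ^ N * (2 * exp (- 8 * sqrt p) / exp (- 5 * sqrt p))) \<longlongrightarrow> 0) at_top"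
      by real_asymp
    show "\<forall>\<^sub>F p in at_top. norm (p ^ N * (bump_moment i p / energy 0 p)) \<le> p ^ N * (2 * exp (- 8 * sqrt p) / exp (- 5 * sqrt p))"
      using energy_eventually eventually_ge_at_top[of 256]
    proof eventually_elim
      case (elim p)
      then have "0 < energy 0 p" by (intro energy_pos) auto
      then have "\<bar>bump_moment i p\<bar> / energy 0 p \<le> 2 * exp (- 8 * sqrt p) / exp (- 5 * sqrt p)"
        using elim moment_osc_bump_small[of p i] by (intro frac_le) auto
      then have "\<bar>bump_moment i p / energy 0 p\<bar> \<le> 2 * exp (- 8 * sqrt p) / exp (- 5 * sqrt p)"
        using \<open>0 < energy 0 p\<close> by (simp add: abs_divide)
      then have "p ^ N * \<bar>bump_moment i p / energy 0 p\<bar> \<le> p ^ N * (2 * exp (- 8 * sqrt p) / exp (- 5 * sqrt p))"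
        using elim by (intro mult_left_mono) auto
      then show ?case using elim by (simp only: real_norm_def abs_mult power_abs)
    qed
  qed
  moreover have "continuous_on {0<..} (\<lambda>p. bump_moment i p / energy 0 p)"
    using energy_pos by (intro continuous_intros moment_continuous osc_bump_continuous) (auto simp: less_le)
  ultimately show ?thesis by (auto simp: rapid_def)
qed

lemma ratio_deriv:
  assumes "continuous_on UNIV g" "0 < p"
  shows "((\<lambda>p. moment i g p / energy 0 p) has_real_derivative
     moment (Suc i) g p / energy 0 p + (moment i g p / energy 0 p) * (-1 * (energy (Suc 0) p / energy 0 p))) (at p)"
proof -
  note d = moment_deriv[OF assms(1)] moment_deriv[OF osc_bump_sq_continuous] and pos = energy_pos[OF assms(2)]
  have "((\<lambda>p. moment i g p / energy 0 p) has_real_derivative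
     (moment (Suc i) g p * energy 0 p - moment i g p * energy (Suc 0) p) / (energy 0 p * energy 0 p)) (at p)"
    using pos by (intro DERIV_divide d) auto
  also have "(moment (Suc i) g p * energy 0 p - moment i g p * energy (Suc 0) p) / (energy 0 p * energy 0 p)
     = moment (Suc i) g p / energy 0 p + (moment i g p / energy 0 p) * (-1 * (energy (Suc 0) p / energy 0 p))"
    using pos by (simp add: field_simps)
  finally show ?thesis .
qed

text \<open>
  The quotients of the moments by the energy reproduce themselves under differentiation
  (\<open>ratio_deriv\<close>), so a bound for each of them bounds all their derivatives.
\<close>
lemma energy_ratio_derivs: "derivs_in k {0<..} bounded_fun (\<lambda>p. energy i p / energy 0 p)"
proof (induction k arbitrary: i)
  case (Suc k)
  show ?case
  proof (rule derivs_in_SucI[OF energy_ratio_bdd])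
    show "derivs_in k {0<..} bounded_fun (\<lambda>p. energy (Suc i) p / energy 0 p + (energy i p / energy 0 p) * (-1 * (energy (Suc 0) p / energy 0 p)))"
      by (rule derivs_in_add[OF bounded_fun_add Suc.IH
            derivs_in_mult[OF bounded_fun_mult bounded_fun_add Suc.IH derivs_in_mult[OF bounded_fun_mult bounded_fun_add bounded_fun_const Suc.IH]]])
    show "((\<lambda>p. energy i p / energy 0 p) has_real_derivative
        energy (Suc i) p / energy 0 p + (energy i p / energy 0 p) * (-1 * (energy (Suc 0) p / energy 0 p))) (at p within {0<..})"
      if "p \<in> {0<..}" for p
      by (rule has_field_derivative_at_within[OF ratio_deriv[OF osc_bump_sq_continuous]]) (use that in simp)
  qed
qed (simp add: energy_ratio_bdd)

lemma bump_ratio_derivs: "derivs_in k {0<..} rapid (\<lambda>p. bump_moment i p / energy 0 p)"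
proof (induction k arbitrary: i)
  case (Suc k)
  show ?case
  proof (rule derivs_in_SucI[OF bump_ratio_rapid])
    show "derivs_in k {0<..} rapid (\<lambda>p. bump_moment (Suc i) p / energy 0 p + (bump_moment i p / energy 0 p) * (-1 * (energy (Suc 0) p / energy 0 p)))"
      by (rule derivs_in_add[OF rapid_add Suc.IH
            derivs_in_mult[OF rapid_mult_bdd rapid_add Suc.IH derivs_in_mult[OF bounded_fun_mult bounded_fun_add bounded_fun_const energy_ratio_derivs]]])
    show "((\<lambda>p. bump_moment i p / energy 0 p) has_real_derivative
        bump_moment (Suc i) p / energy 0 p + (bump_moment i p / energy 0 p) * (-1 * (energy (Suc 0) p / energy 0 p))) (at p within {0<..})"
      if "p \<in> {0<..}" for p
      by (rule has_field_derivative_at_within[OF ratio_deriv[OF osc_bump_continuous]]) (use that in simp)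
  qed
qed (simp add: bump_ratio_rapid)

text \<open>
  The function \<open>R\<close> that makes \<open>\<integral> exp (- s / x) (1 - R(x) h(s)) h(s) ds\<close> vanish.
\<close>
definition correction :: "real \<Rightarrow> real" where
  "correction = flat_ext 0 (\<lambda>p. bump_moment 0 p / energy 0 p)"

lemma correction_Ck: "Ck_interval k UNIV correction"
  unfolding correction_def by (rule flat_ext_Ck[OF bump_ratio_derivs])

text \<open>
  With \<open>m = 1 - R(c x) h(t)\<close> the pair is \<open>M = (1 - c x m\<^sub>t / m) / c\<close> and \<open>f = u / m\<close>, where \<open>u\<close> is the
  scaled Laplace transform of \<open>m h\<close>. The factor \<open>1 / c\<close> in \<open>M\<close> compensates for the rescaling of
  the \<open>x\<close>-axis, which is there to make \<open>R\<close> small on \<open>[0, c]\<close>.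
\<close>
theorem nonuniqueness:
  "\<exists>M f :: real \<Rightarrow> real \<Rightarrow> real.
       Cinf_rect {0..1} {0..1} M \<and> Cinf_rect {0..1} {0..1} f \<and>
       satisfies_eq M f \<and>
       (\<forall>t\<in>{0..1}. \<forall>x\<in>{0..1}. M t x > 0) \<and>
       (\<exists>t\<in>{0..1}. f t 0 \<noteq> 0) \<and>
       (\<forall>x\<in>{0..1}. f 0 x = 0 \<and> f 1 x = 0)"
proof -
  define h where "h = osc_bump"
  have h_supp: "h \<in> unit_supported" using derivs_in_member[OF osc_bump_derivs] by (simp add: h_def)
  have hh_supp: "(\<lambda>s. h s * h s) \<in> unit_supported" using derivs_in_member[OF osc_bump_sq_derivs] by (simp add: h_def)
  have "derivs_in (Suc 0) UNIV unit_supported h" by (simp only: h_def osc_bump_derivs)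
  then obtain h' where h': "\<And>t. (h has_real_derivative h' t) (at t)" "h' \<in> unit_supported"
    by (rule derivs_in_SucE) auto
  have h'_Ck: "Ck_interval k UNIV h'" for k
  proof -
    have "Ck_interval (Suc k) UNIV h" by (simp only: h_def osc_bump_Ck)
    then obtain g where g: "\<And>t. (h has_real_derivative g t) (at t)" "Ck_interval k UNIV g" by auto
    have "g = h'" using DERIV_unique[OF g(1) h'(1)] by (rule ext)
    with g show ?thesis by simp
  qed
  obtain H where H: "0 \<le> H" "\<And>t. \<bar>h t\<bar> \<le> H" using unit_supported_bounded[OF h_supp] by blast
  obtain H' where H': "0 \<le> H'" "\<And>t. \<bar>h' t\<bar> \<le> H'" using unit_supported_bounded[OF h'(2)] by blast
  \<comment> \<open>The value \<open>1 / 4\<close> keeps \<open>m\<close> above \<open>3 / 4\<close> and \<open>c * M\<close> above \<open>2 / 3\<close>.\<close>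
  obtain c where c: "0 < c" "c \<le> 1" and correction_small: "\<And>x. \<bar>x\<bar> \<le> c \<Longrightarrow> \<bar>correction x\<bar> * (H + H' + 1) \<le> 1 / 4"
  proof -
    have "continuous_on UNIV correction" using correction_Ck[of 0] by simp
    then have "isCont correction 0" by (simp add: continuous_on_eq_continuous_at)
    moreover have "correction 0 = 0" by (simp add: correction_def flat_ext_def)
    moreover have "0 < 1 / (4 * (H + H' + 1))" using H(1) H'(1) by simp
    ultimately obtain d where d: "0 < d" "\<And>x. \<bar>x\<bar> < d \<Longrightarrow> \<bar>correction x\<bar> < 1 / (4 * (H + H' + 1))"
    proof -
      assume "isCont correction 0" "correction 0 = 0" "0 < 1 / (4 * (H + H' + 1))"
        and *: "\<And>d. 0 < d \<Longrightarrow> (\<And>x. \<bar>x\<bar> < d \<Longrightarrow> \<bar>correction x\<bar> < 1 / (4 * (H + H' + 1))) \<Longrightarrow> thesis"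
      then obtain d where "0 < d" "\<forall>x. dist x 0 < d \<longrightarrow> dist (correction x) (correction 0) < 1 / (4 * (H + H' + 1))"
        unfolding continuous_at_eps_delta by metis
      with * \<open>correction 0 = 0\<close> show thesis by (simp add: dist_real_def)
    qed
    have "\<bar>correction x\<bar> * (H + H' + 1) \<le> 1 / 4" if "\<bar>x\<bar> \<le> min 1 (d / 2)" for x
    proof -
      have "\<bar>correction x\<bar> < 1 / (4 * (H + H' + 1))" using d that by auto
      then have "\<bar>correction x\<bar> * (H + H' + 1) \<le> 1 / (4 * (H + H' + 1)) * (H + H' + 1)"
        using H(1) H'(1) by (intro mult_right_mono) auto
      also have "1 / (4 * (H + H' + 1)) * (H + H' + 1) = 1 / 4"
      proof -
        have "1 / (4 * K) * K = 1 / 4" if "0 < K" for K :: real using that by simp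
        moreover have "0 < H + H' + 1" using H(1) H'(1) by simp
        ultimately show ?thesis by blast
      qed
      finally show ?thesis .
    qed
    with that[of "min 1 (d / 2)"] d(1) show ?thesis by auto
  qed
  define m where "m t x = 1 + -1 * (correction (c * x) * h t)" for t x
  define M where "M t x = (1 / c) * (1 + (c * x) * (correction (c * x) * h' t) * inverse (m t x))" for t x
  define f where "f t x = (scaled_laplace c 0 h t x + -1 * (correction (c * x) * scaled_laplace c 0 (\<lambda>s. h s * h s) t x)) * inverse (m t x)" for t x
  have small: "\<bar>correction (c * x) * h t\<bar> \<le> 1 / 4" "\<bar>correction (c * x) * h' t\<bar> \<le> 1 / 4" if "x \<in> {0..1}" for t x
  proof -
    have cx: "\<bar>c * x\<bar> \<le> c" using c that by (auto simp: abs_mult mult_left_le)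
    have "\<bar>correction (c * x)\<bar> * \<bar>h t\<bar> \<le> \<bar>correction (c * x)\<bar> * (H + H' + 1)"
      using H(2)[of t] H'(1) by (intro mult_left_mono) auto
    with correction_small[OF cx] show "\<bar>correction (c * x) * h t\<bar> \<le> 1 / 4" by (simp add: abs_mult)
    have "\<bar>correction (c * x)\<bar> * \<bar>h' t\<bar> \<le> \<bar>correction (c * x)\<bar> * (H + H' + 1)"
      using H'(2)[of t] H(1) by (intro mult_left_mono) auto
    with correction_small[OF cx] show "\<bar>correction (c * x) * h' t\<bar> \<le> 1 / 4" by (simp add: abs_mult)
  qed
  have m_large: "3 / 4 \<le> m t x" if "x \<in> {0..1}" for t x
    using small(1)[OF that, of t] by (auto simp: m_def)
  have m_nz: "m t x \<noteq> 0" if "x \<in> {0..1}" for t x using m_large[OF that, of t] by auto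
  have correction_Ck': "Ck_interval k UNIV (\<lambda>x. correction (c * x))" for k
    using Ck_interval_affine[OF correction_Ck, of k 0 c] by simp
  have id_Ck: "Ck_interval k UNIV (\<lambda>x. x)" for k
    by (cases k) (auto intro!: exI[of _ "\<lambda>_. 1"] Ck_interval_const)
  have m_Ck: "Ck_rect k {0..1} {0..1} m" for k
    unfolding m_def[abs_def] h_def
    by (intro Ck_rect_add Ck_rect_mult Ck_rect_const Ck_rect_of_x[OF correction_Ck'] Ck_rect_of_t[OF osc_bump_Ck])
  have m_inv_Ck: "Ck_rect k {0..1} {0..1} (\<lambda>t x. inverse (m t x))" for k
    by (rule Ck_rect_inverse[OF m_nz m_Ck])
  have M_Ck: "Ck_rect k {0..1} {0..1} M" for k
    unfolding M_def[abs_def]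
    by (intro Ck_rect_add Ck_rect_mult Ck_rect_const m_inv_Ck Ck_rect_of_x[OF correction_Ck'] Ck_rect_of_t[OF h'_Ck]
        Ck_rect_of_x[OF id_Ck])
  have f_Ck: "Ck_rect k {0..1} {0..1} f" for k
    unfolding f_def[abs_def] h_def
    by (intro Ck_rect_add Ck_rect_mult Ck_rect_const m_inv_Ck[unfolded h_def] Ck_rect_of_x[OF correction_Ck']
        scaled_laplace_Ck osc_bump_derivs osc_bump_sq_derivs)
  have correction_0: "correction 0 = 0" by (simp add: correction_def flat_ext_def)
  have f_0: "f t 0 = h t" for t by (simp add: f_def m_def correction_0 scaled_laplace_0)
  have M_0: "M t 0 = 1 / c" for t by (simp add: M_def)
  have M_pos: "0 < M t x" if x: "x \<in> {0..1}" for t x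
  proof -
    have "inverse (m t x) \<le> inverse (3 / 4)" by (rule le_imp_inverse_le[OF m_large[OF x]]) simp
    moreover have "0 \<le> inverse (m t x)" using m_large[OF x, of t] by simp
    ultimately have "\<bar>c * x\<bar> * \<bar>correction (c * x) * h' t\<bar> * \<bar>inverse (m t x)\<bar> \<le> 1 * (1 / 4) * inverse (3 / 4)"
      using small(2)[OF x, of t] c x by (intro mult_mono) (auto simp: mult_le_one abs_mult)
    then have "\<bar>(c * x) * (correction (c * x) * h' t) * inverse (m t x)\<bar> \<le> 1 / 3"
      unfolding abs_mult by simp
    then have "0 < 1 + (c * x) * (correction (c * x) * h' t) * inverse (m t x)" by linarith
    then show ?thesis using c(1) by (simp add: M_def)
  qed
  have eq: "satisfies_eq M f"
    unfolding satisfies_eq_def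
  proof (intro ballI)
    fix t x :: real assume t: "t \<in> {0..1}" and x: "x \<in> {0<..1}"
    define \<rho> where "\<rho> = correction (c * x)"
    define L where "L s = scaled_laplace c 0 h s x + -1 * (\<rho> * scaled_laplace c 0 (\<lambda>s. h s * h s) s x)" for s
    have x': "0 < x" "x \<in> {0..1}" using x by auto
    have mt: "m t x \<noteq> 0" using m_nz[OF x'(2)] .
    have dL: "(L has_real_derivative (L t - m t x * h t) / (c * x)) (at t within {0..1})"
    proof -
      have "(L has_real_derivative (scaled_laplace c 0 h t x - h t) / (c * x) + -1 * (\<rho> * ((scaled_laplace c 0 (\<lambda>s. h s * h s) t x - h t * h t) / (c * x))))
          (at t within {0..1})"
        unfolding L_def
        by (intro DERIV_add DERIV_cmult scaled_laplace_ode[OF h_supp c(1) x'(1) t] scaled_laplace_ode[OF hh_supp c(1) x'(1) t])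
      also have "(scaled_laplace c 0 h t x - h t) / (c * x) + -1 * (\<rho> * ((scaled_laplace c 0 (\<lambda>s. h s * h s) t x - h t * h t) / (c * x)))
          = (L t - m t x * h t) / (c * x)"
        using c(1) x'(1) by (simp add: L_def m_def \<rho>_def field_simps)
      finally show ?thesis .
    qed
    have dm: "((\<lambda>s. m s x) has_real_derivative - (\<rho> * h' t)) (at t within {0..1})"
      unfolding m_def \<rho>_def
      by (auto intro!: derivative_eq_intros has_field_derivative_at_within[OF h'(1)])
    have "((\<lambda>s. L s / m s x) has_real_derivative
        ((L t - m t x * h t) / (c * x) * m t x - L t * - (\<rho> * h' t)) / (m t x * m t x)) (at t within {0..1})"
      by (rule DERIV_divide[OF dL dm mt])
    moreover have "L s / m s x = f s x" for s
      by (simp add: L_def f_def \<rho>_def divide_inverse)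
    moreover have "((L t - m t x * h t) / (c * x) * m t x - L t * - (\<rho> * h' t)) / (m t x * m t x)
        = (M t x * f t x - M t 0 * f t 0) / x"
    proof -
      have fx: "f t x = L t / m t x" by (simp add: L_def f_def \<rho>_def divide_inverse)
      have Mx: "M t x = (1 / c) * (1 + c * x * (\<rho> * h' t) / m t x)"
        by (simp add: M_def \<rho>_def divide_inverse)
      show ?thesis
        unfolding M_0 f_0 fx Mx using c(1) x'(1) mt by (simp add: field_simps)
    qed
    ultimately show "((\<lambda>s. f s x) has_real_derivative (M t x * f t x - M t 0 * f t 0) / x) (at t within {0..1})"
      by simp
  qed
  have f_start: "f 0 x = 0" if x: "x \<in> {0..1}" for x
  proof (cases "x = 0")
    case True
    then show ?thesis using f_0[of 0] by (simp add: h_def osc_bump_eq)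
  next
    case False
    with x have x': "0 < x" "0 < c * x" using c by auto
    define p where "p = 1 / (c * x)"
    have p: "0 < p" using x' by (simp add: p_def)
    have "scaled_laplace c 0 h 0 x = p * bump_moment 0 p"
      using scaled_laplace_eq[OF h_supp c(1) x'(1), of 0] by (simp add: p_def moment_def h_def)
    moreover have "scaled_laplace c 0 (\<lambda>s. h s * h s) 0 x = p * energy 0 p"
      using scaled_laplace_eq[OF hh_supp c(1) x'(1), of 0] by (simp add: p_def moment_def h_def)
    moreover have "correction (c * x) = bump_moment 0 p / energy 0 p"
      using x'(2) by (simp add: correction_def flat_ext_def p_def)
    ultimately show ?thesis using energy_pos[OF p] by (simp add: f_def)
  qed
  have f_end: "f 1 x = 0" if x: "x \<in> {0..1}" for x
  proof (cases "x = 0")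
    case True
    then show ?thesis using f_0[of 1] by (simp add: h_def osc_bump_eq)
  next
    case False
    with x have x': "0 < x" by auto
    show ?thesis
      using scaled_laplace_eq[OF h_supp c(1) x', of 1] scaled_laplace_eq[OF hh_supp c(1) x', of 1] by (simp add: f_def)
  qed
  have "\<exists>t\<in>{0..1}. h t \<noteq> 0"
  proof (rule ccontr)
    assume none: "\<not> ?thesis"
    have "energy 0 1 = integral {0..1} (\<lambda>s::real. 0)"
      unfolding moment_def by (rule integral_cong) (use none in \<open>auto simp: h_def\<close>)
    with energy_pos[of 1] show False by simp
  qed
  then have "\<exists>t\<in>{0..1}. f t 0 \<noteq> 0" by (simp add: f_0)
  then show ?thesis
    using M_Ck f_Ck eq M_pos f_start f_end unfolding Cinf_rect_def by blast
qed

section \<open>Integrals over triangles and products of truncated Laplace transforms\<close>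

text \<open>
  Fubini's theorem for the indicator function of the triangle times \<open>\<phi>\<close>.
\<close>
lemma integral_triangle_swap:
  fixes \<phi> :: "real \<Rightarrow> real \<Rightarrow> real"
  assumes cont: "continuous_on UNIV (\<lambda>(u, v). \<phi> u v)"
  shows "integral {0..E} (\<lambda>u. integral {u..E} (\<phi> u)) =
         integral {0..E} (\<lambda>v. integral {0..v} (\<lambda>u. \<phi> u v))"
proof -
  define S where "S = {(u::real, v). 0 \<le> u \<and> u \<le> v \<and> v \<le> E}"
  define \<psi> where "\<psi> u v = indicator S (u, v) * \<phi> u v" for u v
  have "closed S"
    unfolding S_def split_beta
    by (intro closed_Collect_conj closed_Collect_le continuous_intros)
  moreover have "S \<subseteq> {0..E} \<times> {0..E}"
    by (auto simp: S_def)
  then have "bounded S"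
    by (rule bounded_subset[rotated]) (auto intro: bounded_Times)
  ultimately have "compact S"
    by (simp add: compact_eq_bounded_closed)
  then have "integrable lborel (\<lambda>z. indicator S z *\<^sub>R (case z of (u, v) \<Rightarrow> \<phi> u v))"
    by (rule borel_integrable_compact) (rule continuous_on_subset[OF cont], simp)
  also have "(\<lambda>z. indicator S z *\<^sub>R (case z of (u, v) \<Rightarrow> \<phi> u v)) = (\<lambda>(u, v). \<psi> u v)"
    by (auto simp: \<psi>_def fun_eq_iff)
  finally have int: "integrable (lborel \<Otimes>\<^sub>M lborel) (\<lambda>(u, v). \<psi> u v)"
    by (simp add: lborel_prod)
  have c1: "continuous_on A (\<phi> u)" for A u
    by (rule continuous_on_compose2[OF cont, where f="\<lambda>v. (u, v)", simplified])
       (auto intro!: continuous_intros)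
  have c2: "continuous_on A (\<lambda>u. \<phi> u v)" for A v
    by (rule continuous_on_compose2[OF cont, where f="\<lambda>u. (u, v)", simplified])
       (auto intro!: continuous_intros)
  have row: "(LINT v|lborel. \<psi> u v) = indicator {0..E} u *\<^sub>R integral {u..E} (\<phi> u)" for u
  proof -
    have "(\<lambda>v. \<psi> u v) = (\<lambda>v. indicator {0..E} u * (indicator {u..E} v *\<^sub>R \<phi> u v))"
      by (auto simp: \<psi>_def S_def indicator_def fun_eq_iff)
    then have "(LINT v|lborel. \<psi> u v) = indicator {0..E} u * (LINT v:{u..E}|lborel. \<phi> u v)"
      by (simp add: set_lebesgue_integral_def)
    also have "(LINT v:{u..E}|lborel. \<phi> u v) = integral {u..E} (\<phi> u)"
      by (intro set_borel_integral_eq_integral borel_integrable_atLeastAtMost' c1)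
    finally show ?thesis by simp
  qed
  have col: "(LINT u|lborel. \<psi> u v) = indicator {0..E} v *\<^sub>R integral {0..v} (\<lambda>u. \<phi> u v)" for v
  proof -
    have "(\<lambda>u. \<psi> u v) = (\<lambda>u. indicator {0..E} v * (indicator {0..v} u *\<^sub>R \<phi> u v))"
      by (auto simp: \<psi>_def S_def indicator_def fun_eq_iff)
    then have "(LINT u|lborel. \<psi> u v) = indicator {0..E} v * (LINT u:{0..v}|lborel. \<phi> u v)"
      by (simp add: set_lebesgue_integral_def)
    also have "(LINT u:{0..v}|lborel. \<phi> u v) = integral {0..v} (\<lambda>u. \<phi> u v)"
      by (intro set_borel_integral_eq_integral borel_integrable_atLeastAtMost' c2)
    finally show ?thesis by simp
  qed
  have "set_integrable lborel {0..E} (\<lambda>u. integral {u..E} (\<phi> u))"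
    using lborel_pair.integrable_fst'[OF int] by (simp add: set_integrable_def row)
  from set_borel_integral_eq_integral(2)[OF this]
  have e1: "(LINT u|lborel. LINT v|lborel. \<psi> u v) = integral {0..E} (\<lambda>u. integral {u..E} (\<phi> u))"
    by (simp add: set_lebesgue_integral_def row)
  have "set_integrable lborel {0..E} (\<lambda>v. integral {0..v} (\<lambda>u. \<phi> u v))"
    using lborel_pair.integrable_snd[OF int] by (simp add: set_integrable_def col)
  from set_borel_integral_eq_integral(2)[OF this]
  have e2: "(LINT v|lborel. LINT u|lborel. \<psi> u v) = integral {0..E} (\<lambda>v. integral {0..v} (\<lambda>u. \<phi> u v))"
    by (simp add: set_lebesgue_integral_def col)
  show ?thesis
    using lborel_pair.Fubini_integral[OF int] e1 e2 by simp
qed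

lemma continuous_on_compose_pair:
  assumes "continuous_on X (\<lambda>(u, v). Q u v)" "continuous_on S f" "continuous_on S g"
    "\<And>s. s \<in> S \<Longrightarrow> (f s, g s) \<in> X"
  shows "continuous_on S (\<lambda>s. Q (f s) (g s))"
  using continuous_on_compose2[OF assms(1) continuous_on_Pair[OF assms(2,3)]] assms(4) by auto

lemma integral_rescale_01:
  fixes F :: "real \<Rightarrow> real"
  assumes "0 \<le> w"
  shows "integral {0..w} F = w * integral {0..1} (\<lambda>\<theta>. F (w * \<theta>))"
proof (cases "w = 0")
  case False
  with assms have "w > 0" by simp
  then have "(\<lambda>x. x / w) ` {0..w} = {0..1}"
    by (simp add: image_divide_atLeastAtMost)
  with integral_stretch_real[of w 0 w F] \<open>w > 0\<close> show ?thesis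
    by simp
qed simp

text \<open>
  Rescaling to \<open>[0, 1]\<close> turns a moving upper limit into a parameter of the integrand.
\<close>
lemma continuous_on_integral_upto:
  fixes \<Phi> :: "'a::topological_space \<Rightarrow> real \<Rightarrow> real"
  assumes h: "continuous_on S h" "\<And>z. z \<in> S \<Longrightarrow> 0 \<le> h z"
    and \<Phi>: "continuous_on (S \<times> {0..1}) (\<lambda>(z, \<theta>). \<Phi> z (h z * \<theta>))"
  shows "continuous_on S (\<lambda>z. integral {0..h z} (\<Phi> z))"
proof -
  have "continuous_on S (\<lambda>z. integral (cbox 0 1) (\<lambda>\<theta>. \<Phi> z (h z * \<theta>)))"
    by (rule integral_continuous_on_param) (use \<Phi> in simp)
  then have "continuous_on S (\<lambda>z. h z * integral (cbox 0 1) (\<lambda>\<theta>. \<Phi> z (h z * \<theta>)))"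
    by (intro continuous_on_mult h)
  then show ?thesis
    by (rule continuous_on_eq) (subst integral_rescale_01, auto simp: h)
qed

lemma abs_integral_le:
  fixes f :: "real \<Rightarrow> real"
  assumes "a \<le> b" "f integrable_on {a..b}" "\<And>t. t \<in> {a..b} \<Longrightarrow> \<bar>f t\<bar> \<le> B"
  shows "\<bar>integral {a..b} f\<bar> \<le> B * (b - a)"
proof -
  have "0 \<le> B" using assms(1) assms(3)[of a] by (auto intro: order_trans[OF abs_ge_zero])
  from integrable_bound[OF this, of f a b] assms show ?thesis by simp
qed

text \<open>
  In the square \<open>[0, E]\<^sup>2\<close> substitute \<open>\<sigma> = u + v\<close>. The triangle \<open>\<sigma> \<le> E\<close> gives the transform of
  the convolution, and on the rest \<open>exp (- p \<sigma>) \<le> exp (- p E)\<close>. Thus truncated transforms multiply like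
  transforms on the half-line, up to an error of the size that the uniqueness theorem tolerates.
\<close>
lemma truncated_laplace_product:
  fixes Q :: "real \<Rightarrow> real \<Rightarrow> real"
  assumes E: "0 \<le> E" and cont: "continuous_on ({0..E} \<times> {0..E}) (\<lambda>(u, v). Q u v)"
    and bound: "\<And>u v. u \<in> {0..E} \<Longrightarrow> v \<in> {0..E} \<Longrightarrow> \<bar>Q u v\<bar> \<le> K"
    and "0 \<le> p"
  shows "\<bar>integral {0..E} (\<lambda>u. integral {0..E} (\<lambda>v. exp (- p * (u + v)) * Q u v))
         - integral {0..E} (\<lambda>\<sigma>. exp (- p * \<sigma>) * integral {0..\<sigma>} (\<lambda>u. Q u (\<sigma> - u)))\<bar>
         \<le> E^2 * K * exp (- p * E)"
proof -
  \<comment> \<open>Clamping extends the integrand continuously to the plane, as the swap over the triangle requires.\<close>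
  define c where "c u = max 0 (min E u)" for u :: real
  have c_cont: "continuous_on A c" for A unfolding c_def by (intro continuous_intros)
  have c_in: "c u \<in> {0..E}" for u using E by (auto simp: c_def)
  have c_id: "c u = u" if "u \<in> {0..E}" for u using that by (auto simp: c_def)
  define q where "q u v = exp (- p * (u + v)) * Q (c u) (c v)" for u v
  have q_cont: "continuous_on A (\<lambda>s. q (f s) (g s))" if "continuous_on A f" "continuous_on A g"
    for A and f g :: "'z::topological_space \<Rightarrow> real"
    unfolding q_def
    by (intro continuous_intros that continuous_on_compose_pair[OF cont] continuous_on_compose2[OF c_cont])
       (use c_in in auto)
  have q_int: "q u integrable_on {a..b}" for u a b
    by (intro integrable_continuous_interval q_cont continuous_intros)
  have i1: "(\<lambda>u. integral {0..E} (q u)) integrable_on {0..E}"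
  proof -
    have "continuous_on ({0..E} \<times> cbox 0 E) (\<lambda>(u, v). q u v)"
      unfolding split_beta by (intro q_cont continuous_on_fst continuous_on_snd continuous_on_id)
    then have "continuous_on {0..E} (\<lambda>u. integral (cbox 0 E) (q u))"
      by (rule integral_continuous_on_param)
    then show ?thesis
      unfolding interval_cbox by (rule integrable_continuous)
  qed
  have eq0: "integral {u..E} (\<lambda>\<sigma>. q u (\<sigma> - u)) = integral {0..E-u} (q u)" for u
    using integral_shift_Icc_real[of u E "q u" "-u"] by (simp add: o_def)
  have c3: "continuous_on {0..E} (\<lambda>u. integral {0..E-u} (q u))"
  proof -
    have "continuous_on ({0..E} \<times> {0..1}) (\<lambda>(u, \<theta>). q u ((E - u) * \<theta>))"
      unfolding split_beta
      by (rule q_cont) (intro continuous_on_fst continuous_on_snd continuous_on_id continuous_intros)+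
    then show ?thesis
      by (intro continuous_on_integral_upto continuous_intros) auto
  qed
  have i2: "(\<lambda>u. integral {0..E-u} (q u)) integrable_on {0..E}"
    using c3 by (rule integrable_continuous_interval)
  have "integral {0..E} (\<lambda>u. integral {0..E-u} (q u)) = integral {0..E} (\<lambda>u. integral {u..E} (\<lambda>\<sigma>. q u (\<sigma> - u)))"
    by (simp add: eq0)
  also have "\<dots> = integral {0..E} (\<lambda>\<sigma>. integral {0..\<sigma>} (\<lambda>u. q u (\<sigma> - u)))"
    by (rule integral_triangle_swap) (auto simp: split_beta intro!: q_cont continuous_intros)
  also have "\<dots> = integral {0..E} (\<lambda>\<sigma>. exp (- p * \<sigma>) * integral {0..\<sigma>} (\<lambda>u. Q u (\<sigma> - u)))"
  proof (rule integral_cong)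
    fix \<sigma> assume s: "\<sigma> \<in> {0..E}"
    have "integral {0..\<sigma>} (\<lambda>u. q u (\<sigma> - u)) = integral {0..\<sigma>} (\<lambda>u. exp (- p * \<sigma>) * Q u (\<sigma> - u))"
      by (rule integral_cong) (use s in \<open>auto simp: q_def c_id\<close>)
    then show "integral {0..\<sigma>} (\<lambda>u. q u (\<sigma> - u)) = exp (- p * \<sigma>) * integral {0..\<sigma>} (\<lambda>u. Q u (\<sigma> - u))"
      by simp
  qed
  finally have A: "integral {0..E} (\<lambda>u. integral {0..E-u} (q u)) = \<dots>" .
  have B: "integral {0..E} (\<lambda>u. integral {0..E} (\<lambda>v. exp (- p * (u + v)) * Q u v)) = integral {0..E} (\<lambda>u. integral {0..E} (q u))"
    by (intro integral_cong) (auto simp: q_def c_id)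
  have comb: "integral {0..E} (q u) - integral {0..E-u} (q u) = integral {E-u..E} (q u)"
    if "u \<in> {0..E}" for u
    using Henstock_Kurzweil_Integration.integral_combine[OF _ _ q_int, of 0 "E - u" E u] that by simp
  have "\<bar>integral {0..E} (\<lambda>u. integral {0..E} (q u)) - integral {0..E} (\<lambda>u. integral {0..E-u} (q u))\<bar>
      = \<bar>integral {0..E} (\<lambda>u. integral {E-u..E} (q u))\<bar>"
  proof -
    have "integral {0..E} (\<lambda>u. integral {0..E} (q u)) - integral {0..E} (\<lambda>u. integral {0..E-u} (q u))
       = integral {0..E} (\<lambda>u. integral {0..E} (q u) - integral {0..E-u} (q u))"
      by (rule integral_diff[symmetric, OF i1 i2])
    also have "\<dots> = integral {0..E} (\<lambda>u. integral {E-u..E} (q u))"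
      by (rule integral_cong) (rule comb)
    finally show ?thesis by simp
  qed
  also have "\<dots> \<le> (E * K * exp (- p * E)) * (E - 0)"
  proof -
    have bnd: "\<bar>integral {E-u..E} (q u)\<bar> \<le> E * K * exp (- p * E)" if u: "u \<in> {0..E}" for u
    proof -
      have K: "0 \<le> K" using bound[of 0 0] E by force
      have "\<bar>integral {E-u..E} (q u)\<bar> \<le> (K * exp (- p * E)) * (E - (E - u))"
      proof (rule abs_integral_le)
        fix v assume v: "v \<in> {E-u..E}"
        have "p * E \<le> p * (u + v)" using v \<open>0 \<le> p\<close> by (intro mult_left_mono) auto
        then have "exp (- p * (u + v)) \<le> exp (- p * E)" by simp
        moreover have "\<bar>Q (c u) (c v)\<bar> \<le> K" using bound c_in by blast
        ultimately have "exp (- p * (u + v)) * \<bar>Q (c u) (c v)\<bar> \<le> exp (- p * E) * K"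
          by (intro mult_mono) auto
        then show "\<bar>q u v\<bar> \<le> K * exp (- p * E)"
          by (simp add: q_def abs_mult mult.commute)
      qed (use u q_int in auto)
      also have "\<dots> \<le> (K * exp (- p * E)) * E" using u K by (intro mult_left_mono) auto
      finally show ?thesis by (simp add: mult_ac)
    qed
    have "(\<lambda>u. integral {E-u..E} (q u)) integrable_on {0..E}"
    proof -
      have "(\<lambda>u. integral {0..E} (q u) - integral {0..E-u} (q u)) integrable_on {0..E}"
        by (rule integrable_diff[OF i1 i2])
      then show ?thesis
        by (rule integrable_eq) (rule comb)
    qed
    from abs_integral_le[OF E this bnd] show ?thesis .
  qed
  finally show ?thesis
    unfolding A B by (simp add: power2_eq_square mult_ac)
qed

section \<open>Uniqueness for the Laplace transform on a finite interval\<close>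

text \<open>
  As a function of \<open>z\<close> this is a smoothed step, which becomes the indicator function of
  \<open>\<sigma> < t\<close> when \<open>z = p (t - \<sigma>)\<close> and \<open>p \<rightarrow> \<infinity>\<close>, and it is a series in the exponentials \<open>exp (- k p \<sigma>)\<close>.
\<close>
lemma exp_minus_exp_series:
  fixes z :: real
  shows "(\<lambda>k. (-1) ^ k / fact (Suc k) * exp (real (Suc k) * z)) sums (1 - exp (- exp z))"
proof -
  have "(\<lambda>n. (- exp z) ^ n /\<^sub>R fact n) sums exp (- exp z)"
    by (rule exp_converges)
  then have "(\<lambda>n. (- exp z) ^ Suc n /\<^sub>R fact (Suc n)) sums (exp (- exp z) - 1)"
    using sums_Suc_iff[of "\<lambda>n. (- exp z) ^ n /\<^sub>R fact n" "exp (- exp z) - 1"] by simp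
  then have "(\<lambda>n. - ((- exp z) ^ Suc n /\<^sub>R fact (Suc n))) sums - (exp (- exp z) - 1)"
    by (rule sums_minus)
  moreover have "- ((- exp z) ^ Suc n /\<^sub>R fact (Suc n)) = (-1) ^ n / fact (Suc n) * exp (real (Suc n) * z)" for n
  proof -
    have "(- exp z) ^ Suc n = (-1) ^ Suc n * exp (real (Suc n) * z)"
      unfolding exp_of_nat_mult by (rule power_minus)
    then show ?thesis by (simp add: divide_inverse mult_ac del: of_nat_Suc fact_Suc)
  qed
  ultimately show ?thesis by simp
qed

text \<open>
  Integrate the smoothed step of the preceding lemma against \<open>g\<close>. As \<open>p\<close> grows this tends to \<open>\<integral>\<^sub>0\<^sup>t g\<close>. On the
  other hand it is a series in the values of the transform at the multiples \<open>k p\<close>, with coefficients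
  \<open>\<plusminus> exp (k p t) / k!\<close>, and by the hypothesis its sum is at most a constant times \<open>p y exp y\<close> for
  \<open>y = exp (- p (E - t))\<close>, which tends to \<open>0\<close>.
\<close>
lemma finite_laplace_unique:
  fixes g :: "real \<Rightarrow> real"
  assumes cont: "continuous_on {0..E} g"
    and bound: "\<And>p. p \<ge> 1 \<Longrightarrow> \<bar>integral {0..E} (\<lambda>\<sigma>. exp (- p * \<sigma>) * g \<sigma>)\<bar> \<le> C * p * exp (- p * E)"
    and t: "0 \<le> t" "t < E"
  shows "integral {0..t} g = 0"
proof -
  define T where "T p k = (-1) ^ k / fact (Suc k) * exp (real (Suc k) * p * t)
      * integral {0..E} (\<lambda>\<sigma>. exp (- (real (Suc k) * p) * \<sigma>) * g \<sigma>)" for p k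
  define S where "S p = integral {0..E} (\<lambda>\<sigma>. (1 - exp (- exp (p * (t - \<sigma>)))) * g \<sigma>)" for p
  have C: "0 \<le> C"
  proof -
    have "0 \<le> C * 1 * exp (- 1 * E)" using bound[of 1] abs_ge_zero order_trans by (metis order.refl)
    then show ?thesis by (simp add: zero_le_mult_iff)
  qed
  obtain B where B: "\<And>\<sigma>. \<sigma> \<in> {0..E} \<Longrightarrow> \<bar>g \<sigma>\<bar> \<le> B"
    using compact_imp_bounded[OF compact_continuous_image[OF cont compact_Icc]]
    unfolding bounded_iff by (metis image_eqI real_norm_def)
  have Tsum: "T p sums S p" for p
  proof -
    define f where "f k \<sigma> = (-1) ^ k / fact (Suc k) * exp (real (Suc k) * (p * (t - \<sigma>))) * g \<sigma>" for k \<sigma>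
    have f_cont: "continuous_on {0..E} (f k)" for k
      unfolding f_def by (intro continuous_intros cont)
    have "uniform_limit {0..E} (\<lambda>n \<sigma>. \<Sum>k<n. f k \<sigma>) (\<lambda>\<sigma>. suminf (\<lambda>k. f k \<sigma>)) sequentially"
    proof (rule Weierstrass_m_test)
      fix n \<sigma> assume s: "\<sigma> \<in> {0..E}"
      have "p * (t - \<sigma>) \<le> \<bar>p\<bar> * E"
      proof -
        have "p * (t - \<sigma>) \<le> \<bar>p\<bar> * \<bar>t - \<sigma>\<bar>" by (simp add: abs_mult[symmetric])
        also have "\<dots> \<le> \<bar>p\<bar> * E" using s t by (intro mult_left_mono) auto
        finally show ?thesis .
      qed
      then have "exp (real (Suc n) * (p * (t - \<sigma>))) \<le> exp (real (Suc n) * (\<bar>p\<bar> * E))"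
        by (simp add: mult_left_mono)
      then have "\<bar>f n \<sigma>\<bar> \<le> 1 / fact (Suc n) * exp (real (Suc n) * (\<bar>p\<bar> * E)) * B"
        unfolding f_def abs_mult using B[OF s]
        by (intro mult_mono) (auto simp: power_abs)
      also have "\<dots> = exp (\<bar>p\<bar> * E) ^ Suc n / fact (Suc n) * B"
        unfolding exp_of_nat_mult by simp
      finally show "norm (f n \<sigma>) \<le> exp (\<bar>p\<bar> * E) ^ Suc n / fact (Suc n) * B" by simp
    next
      have "summable (\<lambda>n. exp (\<bar>p\<bar> * E) ^ n /\<^sub>R fact n)" by (rule summable_exp_generic)
      then have "summable (\<lambda>n. exp (\<bar>p\<bar> * E) ^ Suc n / fact (Suc n))"
        using summable_Suc_iff[of "\<lambda>n. exp (\<bar>p\<bar> * E) ^ n /\<^sub>R fact n"]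
        by (simp add: divide_inverse mult.commute)
      then show "summable (\<lambda>n. exp (\<bar>p\<bar> * E) ^ Suc n / fact (Suc n) * B)" by (rule summable_mult2)
    qed
    moreover have "suminf (\<lambda>k. f k \<sigma>) = (1 - exp (- exp (p * (t - \<sigma>)))) * g \<sigma>" for \<sigma>
      using sums_mult2[OF exp_minus_exp_series, of "p * (t - \<sigma>)" "g \<sigma>"] unfolding f_def
      by (simp add: sums_iff)
    ultimately have "uniform_limit {0..E} (\<lambda>n \<sigma>. \<Sum>k<n. f k \<sigma>)
        (\<lambda>\<sigma>. (1 - exp (- exp (p * (t - \<sigma>)))) * g \<sigma>) sequentially" by simp
    from uniform_limit_integral[OF this]
    obtain I J where IJ: "\<And>n. ((\<lambda>\<sigma>. \<Sum>k<n. f k \<sigma>) has_integral I n) {0..E}"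
      "((\<lambda>\<sigma>. (1 - exp (- exp (p * (t - \<sigma>)))) * g \<sigma>) has_integral J) {0..E}" "I \<longlonglongrightarrow> J"
      using f_cont by (auto intro!: continuous_on_sum simp: sequentially_bot)
    have fk: "integral {0..E} (f k) = T p k" for k
    proof -
      have "exp (real (Suc k) * (p * (t - \<sigma>))) = exp (real (Suc k) * p * t) * exp (- (real (Suc k) * p) * \<sigma>)" for \<sigma>
        by (subst mult_exp_exp) (simp add: algebra_simps del: of_nat_Suc)
      then have "f k = (\<lambda>\<sigma>. (-1) ^ k / fact (Suc k) * exp (real (Suc k) * p * t) * (exp (- (real (Suc k) * p) * \<sigma>) * g \<sigma>))"
        by (simp add: f_def fun_eq_iff mult_ac del: fact_Suc of_nat_Suc)
      then show ?thesis unfolding T_def by (simp only: integral_mult_right)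
    qed
    have "I n = (\<Sum>k<n. T p k)" for n
    proof -
      have "I n = integral {0..E} (\<lambda>\<sigma>. \<Sum>k<n. f k \<sigma>)" using IJ(1)[of n] by (rule integral_unique[symmetric])
      also have "\<dots> = (\<Sum>k<n. integral {0..E} (f k))"
        by (rule integral_sum) (auto intro: integrable_continuous_interval f_cont)
      also have "\<dots> = (\<Sum>k<n. T p k)" by (simp only: fk)
      finally show ?thesis .
    qed
    then have "I = (\<lambda>n. \<Sum>k<n. T p k)" by (rule ext)
    with IJ(2,3) show ?thesis by (simp add: sums_def S_def integral_unique)
  qed
  have S_small: "\<bar>S p\<bar> \<le> C * p * exp (- (E - t) * p) * exp 1" if p: "p \<ge> 1" for p
  proof -
    define y where "y = exp (- (E - t) * p)"
    have y: "0 < y" "y \<le> 1" using t p by (auto simp: y_def mult_nonpos_nonneg)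
    have Tb: "\<bar>T p k\<bar> \<le> C * p * y * (1 / fact k)" for k
    proof -
      have "\<bar>T p k\<bar> \<le> 1 / fact (Suc k) * exp (real (Suc k) * p * t) *
              (C * (real (Suc k) * p) * exp (- (real (Suc k) * p) * E))"
        unfolding T_def abs_mult
      proof (intro mult_mono)
        have "1 * 1 \<le> real (Suc k) * p" using p by (intro mult_mono) auto
        then show "\<bar>integral {0..E} (\<lambda>\<sigma>. exp (- (real (Suc k) * p) * \<sigma>) * g \<sigma>)\<bar>
            \<le> C * (real (Suc k) * p) * exp (- (real (Suc k) * p) * E)"
          by (intro bound) simp
      qed (auto simp: power_abs)
      also have "\<dots> = C * p * (real (Suc k) / fact (Suc k))
          * (exp (real (Suc k) * p * t) * exp (- (real (Suc k) * p) * E))"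
        by (simp add: mult_ac divide_inverse del: fact_Suc of_nat_Suc)
      also have "exp (real (Suc k) * p * t) * exp (- (real (Suc k) * p) * E) = exp (real (Suc k) * (- (E - t) * p))"
        by (subst mult_exp_exp) (simp add: algebra_simps del: of_nat_Suc)
      also have "exp (real (Suc k) * (- (E - t) * p)) = y ^ Suc k"
        unfolding y_def by (rule exp_of_nat_mult)
      also have "real (Suc k) / fact (Suc k) = 1 / fact k"
        by (simp add: fact_Suc del: of_nat_Suc)
      also have "C * p * (1 / fact k) * y ^ Suc k \<le> C * p * (1 / fact k) * y"
        using C p y by (intro mult_left_mono) (auto simp: mult_le_cancel_left1 power_le_one)
      finally show ?thesis by (simp add: mult_ac)
    qed
    have e1: "(\<lambda>k. 1 / fact k :: real) sums exp 1"
      using exp_converges[of "1::real"] by (simp add: divide_inverse)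
    then have e2: "(\<lambda>k. C * p * y * (1 / fact k)) sums (C * p * y * exp 1)"
      by (rule sums_mult)
    have "\<bar>\<Sum>k. T p k\<bar> \<le> (\<Sum>k. C * p * y * (1 / fact k))"
      using Tb e2 norm_suminf_le[of "T p" "\<lambda>k. C * p * y * (1 / fact k)"] by (simp add: sums_iff)
    then show ?thesis using Tsum[of p] e2 by (simp add: sums_iff y_def)
  qed
  have "(\<lambda>n. C * real (Suc n) * exp (- (E - t) * real (Suc n)) * exp 1) \<longlonglongrightarrow> 0"
    using t by real_asymp
  then have lim0: "(\<lambda>n. S (real (Suc n))) \<longlonglongrightarrow> 0"
    by (rule Lim_null_comparison[rotated]) (use S_small in auto)
  \<comment> \<open>The pointwise limit of the smoothed step times \<open>g\<close>; the value at \<open>\<sigma> = t\<close> does not affect the integral.\<close>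
  define L where "L \<sigma> = (if \<sigma> < t then g \<sigma> else if \<sigma> = t then (1 - exp (-1)) * g t else 0)" for \<sigma>
  have "(\<lambda>n. S (real (Suc n))) \<longlonglongrightarrow> integral {0..E} L"
    unfolding S_def
  proof (rule dominated_convergence(2)[where h="\<lambda>_. B"])
    fix \<sigma> assume s: "\<sigma> \<in> {0..E}"
    have "(\<lambda>n. 1 - exp (- exp (real (Suc n) * (t - \<sigma>)))) \<longlonglongrightarrow> (if \<sigma> < t then 1 else if \<sigma> = t then 1 - exp (-1) else 0)"
    proof -
      consider "\<sigma> < t" | "\<sigma> = t" | "t < \<sigma>" by linarith
      then show ?thesis
      proof cases
        case 1
        then have "0 < t - \<sigma>" by simp
        then have "(\<lambda>n. 1 - exp (- exp (real (Suc n) * (t - \<sigma>)))) \<longlonglongrightarrow> 1" by real_asymp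
        with 1 show ?thesis by simp
      next
        case 3
        then have "t - \<sigma> < 0" by simp
        then have "(\<lambda>n. 1 - exp (- exp (real (Suc n) * (t - \<sigma>)))) \<longlonglongrightarrow> 0" by real_asymp
        with 3 show ?thesis by simp
      qed simp
    qed
    from tendsto_mult_right[OF this, of "g \<sigma>"]
    show "(\<lambda>n. (1 - exp (- exp (real (Suc n) * (t - \<sigma>)))) * g \<sigma>) \<longlonglongrightarrow> L \<sigma>"
      by (auto simp: L_def)
  next
    fix n \<sigma> assume "\<sigma> \<in> {0..E}"
    then have "\<bar>1 - exp (- exp (real (Suc n) * (t - \<sigma>)))\<bar> * \<bar>g \<sigma>\<bar> \<le> 1 * B"
      using B by (intro mult_mono) auto
    then show "norm ((1 - exp (- exp (real (Suc n) * (t - \<sigma>)))) * g \<sigma>) \<le> B"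
      by (simp add: abs_mult)
  qed (auto intro!: integrable_continuous_interval continuous_intros cont)
  then have "integral {0..E} L = 0" using lim0 LIMSEQ_unique by blast
  moreover have "integral {0..E} L = integral {0..E} (\<lambda>\<sigma>. if \<sigma> \<in> {0..t} then g \<sigma> else 0)"
    by (rule integral_spike[of "{t}"]) (auto simp: L_def)
  moreover have "\<dots> = integral {0..t} g"
    by (subst integral_restrict_Int) (use t in \<open>simp add: min_def\<close>)
  ultimately show ?thesis by metis
qed

lemma zero_if_integrals_zero:
  fixes g :: "real \<Rightarrow> real"
  assumes cont: "continuous_on {0..E} g" and z: "\<And>t. 0 \<le> t \<Longrightarrow> t < E \<Longrightarrow> integral {0..t} g = 0"
    and E: "0 < E" and t: "t \<in> {0..E}"
  shows "g t = 0"
proof -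
  have "g t = 0" if t: "t \<in> {0<..<E}" for t
  proof -
    have "((\<lambda>u. integral {0..u} g) has_real_derivative g t) (at t within {0..E})"
      using t by (intro integral_has_real_derivative cont) auto
    then have "((\<lambda>u. integral {0..u} g) has_real_derivative g t) (at t)"
      using t by (simp add: at_within_Icc_at)
    moreover have "((\<lambda>u. integral {0..u} g) has_real_derivative 0) (at t)"
      by (rule has_field_derivative_transform_within_open[of "\<lambda>_. 0" _ _ "{0<..<E}"]) (use t z in auto)
    ultimately show ?thesis by (rule DERIV_unique)
  qed
  then show ?thesis
    using continuous_constant_on_closure[of "{0<..<E}" g 0 t] E cont t
    by (simp add: closure_greaterThanLessThan)
qed

text \<open>
  The function \<open>exp (- K t) \<integral>\<^sub>0\<^sup>t \<bar>y\<bar>\<close> is decreasing, nonnegative, and \<open>0\<close> at the origin.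
\<close>
lemma volterra_zero:
  fixes y :: "real \<Rightarrow> real"
  assumes cont: "continuous_on {0..E} y"
    and le: "\<And>t. t \<in> {0..E} \<Longrightarrow> \<bar>y t\<bar> \<le> K * integral {0..t} (\<lambda>s. \<bar>y s\<bar>)"
    and t: "t \<in> {0..E}"
  shows "y t = 0"
proof -
  define Y where "Y t = integral {0..t} (\<lambda>s. \<bar>y s\<bar>)" for t
  have dY: "(Y has_real_derivative \<bar>y u\<bar>) (at u within {0..E})" if "u \<in> {0..E}" for u
    unfolding Y_def by (intro integral_has_real_derivative continuous_intros cont that)
  have "exp (- K * t) * Y t \<le> exp (- K * 0) * Y 0"
  proof (rule DERIV_nonpos_imp_decreasing_open[where f="\<lambda>u. exp (- K * u) * Y u"])
    show "0 \<le> t" using t by simp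
  next
    fix u assume u: "0 < u" "u < t"
    have "(Y has_real_derivative \<bar>y u\<bar>) (at u)"
      using dY[of u] u t by (simp add: at_within_Icc_at)
    then have "((\<lambda>u. exp (- K * u) * Y u) has_real_derivative exp (- K * u) * (\<bar>y u\<bar> - K * Y u)) (at u)"
      by (auto intro!: derivative_eq_intros simp: algebra_simps)
    moreover have "exp (- K * u) * (\<bar>y u\<bar> - K * Y u) \<le> 0"
      using le[of u] u t by (auto simp: mult_le_0_iff Y_def)
    ultimately show "\<exists>d. ((\<lambda>u. exp (- K * u) * Y u) has_real_derivative d) (at u) \<and> d \<le> 0" by blast
  next
    have "continuous_on {0..t} Y"
      by (rule DERIV_continuous_on, rule DERIV_subset[OF dY]) (use t in auto)
    then show "continuous_on {0..t} (\<lambda>u. exp (- K * u) * Y u)" by (intro continuous_intros)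
  qed
  then have "Y t \<le> 0" by (simp add: Y_def mult_le_0_iff)
  moreover have "0 \<le> Y t"
    unfolding Y_def using t
    by (intro integral_nonneg integrable_continuous_interval continuous_intros continuous_on_subset[OF cont]) auto
  ultimately show ?thesis using le[OF t] by (simp add: Y_def)
qed

section \<open>The exponential of a truncated Laplace transform\<close>

text \<open>
  Convolution powers in the second variable, with index shifted by one: \<open>conv_power L 0\<close> is \<open>L\<close> itself.
\<close>
primrec conv_power :: "(real \<Rightarrow> real \<Rightarrow> real) \<Rightarrow> nat \<Rightarrow> real \<Rightarrow> real \<Rightarrow> real" where
  "conv_power L 0 s w = L s w"
| "conv_power L (Suc n) s w = integral {0..w} (\<lambda>u. L s u * conv_power L n s (w - u))"

lemma continuous_on_convolution:
  fixes P Q :: "real \<Rightarrow> real \<Rightarrow> real"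
  assumes P: "continuous_on ({0..E} \<times> {0..E}) (\<lambda>(s, w). P s w)"
    and Q: "continuous_on ({0..E} \<times> {0..E}) (\<lambda>(s, w). Q s w)"
  shows "continuous_on ({0..E} \<times> {0..E}) (\<lambda>(s, w). integral {0..w} (\<lambda>u. P s u * Q s (w - u)))"
proof -
  have "continuous_on (({0..E} \<times> {0..E}) \<times> {0..1})
      (\<lambda>(z, \<theta>). P (fst z) (snd z * \<theta>) * Q (fst z) (snd z - snd z * \<theta>))"
    unfolding split_beta
    by (intro continuous_on_mult continuous_on_compose_pair[OF P] continuous_on_compose_pair[OF Q] continuous_intros)
       (auto simp: mult_left_le intro: order_trans[OF mult_left_le] order_trans[of "b - b * t" b for b t :: real])
  then show ?thesis
    unfolding split_beta by (intro continuous_on_integral_upto continuous_intros) (auto simp only: case_prod_unfold mem_Times_iff atLeastAtMost_iff)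
qed

lemma conv_power_continuous:
  assumes L: "continuous_on ({0..E} \<times> {0..E}) (\<lambda>(s, w). L s w)"
  shows "continuous_on ({0..E} \<times> {0..E}) (\<lambda>(s, w). conv_power L n s w)"
  by (induction n) (simp_all add: L continuous_on_convolution)

lemma continuous_on_slice:
  assumes "continuous_on (A \<times> B) (\<lambda>(s, w). P s w)" "s \<in> A"
  shows "continuous_on B (P s)"
  using continuous_on_compose_pair[OF assms(1), of B "\<lambda>_. s" "\<lambda>w. w"] assms(2) by auto

lemma convolution_integrable:
  fixes P Q :: "real \<Rightarrow> real"
  assumes "continuous_on {0..E} P" "continuous_on {0..E} Q" "w \<in> {0..E}"
  shows "(\<lambda>u. P u * Q (w - u)) integrable_on {0..w}"
  using assms(3)
  by (intro integrable_continuous_interval continuous_intros continuous_on_subset[OF assms(1)]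
      continuous_on_compose2[OF assms(2)]) auto

lemma abs_truncated_laplace_le:
  fixes g :: "real \<Rightarrow> real"
  assumes E: "0 \<le> E" and p: "0 \<le> p" and g: "continuous_on {0..E} g"
    and B: "\<And>w. w \<in> {0..E} \<Longrightarrow> \<bar>g w\<bar> \<le> B"
  shows "\<bar>integral {0..E} (\<lambda>w. exp (- p * w) * g w)\<bar> \<le> B * E"
proof -
  have "\<bar>integral {0..E} (\<lambda>w. exp (- p * w) * g w)\<bar> \<le> B * (E - 0)"
  proof (rule abs_integral_le[OF E])
    fix w assume w: "w \<in> {0..E}"
    have "exp (- p * w) * \<bar>g w\<bar> \<le> 1 * B"
      using p w B[OF w] by (intro mult_mono) auto
    then show "\<bar>exp (- p * w) * g w\<bar> \<le> B" by (simp add: abs_mult)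
  qed (intro integrable_continuous_interval continuous_intros g)
  then show ?thesis by simp
qed

lemma conv_power_bound:
  assumes L: "continuous_on ({0..E} \<times> {0..E}) (\<lambda>(s, w). L s w)"
    and bound: "\<And>s w. s \<in> {0..E} \<Longrightarrow> w \<in> {0..E} \<Longrightarrow> \<bar>L s w\<bar> \<le> \<Lambda>"
    and s: "s \<in> {0..E}" and w: "w \<in> {0..E}"
  shows "\<bar>conv_power L n s w\<bar> \<le> \<Lambda> * (\<Lambda> * E) ^ n"
  using w
proof (induction n arbitrary: w)
  case 0
  then show ?case using bound s by simp
next
  case (Suc n)
  have \<Lambda>: "0 \<le> \<Lambda>" using bound[OF s Suc.prems] by linarith
  have E: "0 \<le> E" using Suc.prems by simp
  have "\<bar>integral {0..w} (\<lambda>u. L s u * conv_power L n s (w - u))\<bar> \<le> (\<Lambda> * (\<Lambda> * (\<Lambda> * E) ^ n)) * (w - 0)"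
  proof (rule abs_integral_le)
    show "(\<lambda>u. L s u * conv_power L n s (w - u)) integrable_on {0..w}"
      by (intro convolution_integrable[where E=E] continuous_on_slice[OF L s]
          continuous_on_slice[OF conv_power_continuous[OF L] s] Suc.prems)
    fix u assume u: "u \<in> {0..w}"
    then show "\<bar>L s u * conv_power L n s (w - u)\<bar> \<le> \<Lambda> * (\<Lambda> * (\<Lambda> * E) ^ n)"
      unfolding abs_mult using Suc.prems s \<Lambda> by (intro mult_mono bound Suc.IH) auto
  qed (use Suc.prems in auto)
  also have "\<dots> \<le> (\<Lambda> * (\<Lambda> * (\<Lambda> * E) ^ n)) * E"
    using Suc.prems \<Lambda> E by (intro mult_left_mono) auto
  finally show ?case by (simp add: mult_ac)
qed

text \<open>
  Each further factor costs one application of \<open>truncated_laplace_product\<close>. As multiplication by \<open>z\<close>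
  costs a factor \<open>\<Lambda> * E\<close> as well, all \<open>n\<close> errors enter with the same power of it.
\<close>
lemma laplace_conv_power:
  fixes p :: real
  assumes L: "continuous_on ({0..E} \<times> {0..E}) (\<lambda>(s, w). L s w)"
    and bound: "\<And>s w. s \<in> {0..E} \<Longrightarrow> w \<in> {0..E} \<Longrightarrow> \<bar>L s w\<bar> \<le> \<Lambda>"
    and s: "s \<in> {0..E}" and p: "0 \<le> p"
  defines "z \<equiv> integral {0..E} (\<lambda>w. exp (- p * w) * L s w)"
  shows "\<bar>z ^ Suc n - integral {0..E} (\<lambda>w. exp (- p * w) * conv_power L n s w)\<bar>
         \<le> real n * (\<Lambda> * E) ^ Suc n * exp (- p * E)"
proof (induction n)
  case 0
  then show ?case by (simp add: z_def)
next
  case (Suc n)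
  have E: "0 \<le> E" using s by simp
  have \<Lambda>: "0 \<le> \<Lambda>" using bound[OF s s] by linarith
  define I where "I n = integral {0..E} (\<lambda>w. exp (- p * w) * conv_power L n s w)" for n
  have Lc: "continuous_on {0..E} (L s)" by (rule continuous_on_slice[OF L s])
  have Pc: "continuous_on {0..E} (conv_power L n s)"
    by (rule continuous_on_slice[OF conv_power_continuous[OF L] s])
  have z: "\<bar>z\<bar> \<le> \<Lambda> * E"
    unfolding z_def by (rule abs_truncated_laplace_le[OF E p Lc bound[OF s]])
  have "\<bar>integral {0..E} (\<lambda>u. integral {0..E} (\<lambda>v. exp (- p * (u + v)) * (L s u * conv_power L n s v)))
         - integral {0..E} (\<lambda>w. exp (- p * w) * integral {0..w} (\<lambda>u. L s u * conv_power L n s (w - u)))\<bar>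
         \<le> E^2 * (\<Lambda> * (\<Lambda> * (\<Lambda> * E) ^ n)) * exp (- p * E)"
  proof (rule truncated_laplace_product[OF E _ _ p])
    show "continuous_on ({0..E} \<times> {0..E}) (\<lambda>(u, v). L s u * conv_power L n s v)"
      unfolding split_beta
      by (intro continuous_on_mult continuous_on_compose2[OF Lc] continuous_on_compose2[OF Pc] continuous_intros) auto
    fix u v assume "u \<in> {0..E}" "v \<in> {0..E}"
    then show "\<bar>L s u * conv_power L n s v\<bar> \<le> \<Lambda> * (\<Lambda> * (\<Lambda> * E) ^ n)"
      unfolding abs_mult using \<Lambda> s
      by (intro mult_mono bound conv_power_bound[OF L bound]) auto
  qed
  also have "integral {0..E} (\<lambda>u. integral {0..E} (\<lambda>v. exp (- p * (u + v)) * (L s u * conv_power L n s v))) = z * I n"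
  proof -
    have "exp (- p * (u + v)) * (L s u * conv_power L n s v)
        = (exp (- p * u) * L s u) * (exp (- p * v) * conv_power L n s v)" for u v
      using exp_add[of "- p * u" "- p * v"] by (simp add: distrib_left)
    then show ?thesis by (simp only: I_def z_def integral_mult_right integral_mult_left)
  qed
  also have "integral {0..E} (\<lambda>w. exp (- p * w) * integral {0..w} (\<lambda>u. L s u * conv_power L n s (w - u))) = I (Suc n)"
    by (simp add: I_def)
  finally have step: "\<bar>z * I n - I (Suc n)\<bar> \<le> (\<Lambda> * E) ^ Suc (Suc n) * exp (- p * E)"
    by (simp add: power2_eq_square mult_ac)
  have "\<bar>z * (z ^ Suc n - I n)\<bar> \<le> (\<Lambda> * E) * (real n * (\<Lambda> * E) ^ Suc n * exp (- p * E))"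
    unfolding abs_mult using Suc z \<Lambda> E by (intro mult_mono) (auto simp: I_def)
  then have "\<bar>z * (z ^ Suc n - I n)\<bar> \<le> real n * (\<Lambda> * E) ^ Suc (Suc n) * exp (- p * E)"
    by (simp add: mult_ac)
  moreover have "z ^ Suc (Suc n) - I (Suc n) = z * (z ^ Suc n - I n) + (z * I n - I (Suc n))"
    by (simp add: algebra_simps)
  ultimately have "\<bar>z ^ Suc (Suc n) - I (Suc n)\<bar>
      \<le> real n * (\<Lambda> * E) ^ Suc (Suc n) * exp (- p * E) + (\<Lambda> * E) ^ Suc (Suc n) * exp (- p * E)"
    using step by linarith
  also have "\<dots> = real (Suc n) * (\<Lambda> * E) ^ Suc (Suc n) * exp (- p * E)"
    by (simp only: of_nat_Suc distrib_right mult_1 add.commute)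
  finally show ?case unfolding I_def .
qed

text \<open>
  The exponential series of \<open>- L\<close> in the convolution algebra, without its unit.
\<close>
definition exp_kernel :: "(real \<Rightarrow> real \<Rightarrow> real) \<Rightarrow> real \<Rightarrow> real \<Rightarrow> real" where
  "exp_kernel L s w = (\<Sum>n. (-1) ^ Suc n / fact (Suc n) * conv_power L n s w)"

context
  fixes L :: "real \<Rightarrow> real \<Rightarrow> real" and E \<Lambda> :: real
  assumes L: "continuous_on ({0..E} \<times> {0..E}) (\<lambda>(s, w). L s w)"
    and bound: "\<And>s w. s \<in> {0..E} \<Longrightarrow> w \<in> {0..E} \<Longrightarrow> \<bar>L s w\<bar> \<le> \<Lambda>"
    and E: "0 \<le> E"
begin

lemma exp_kernel_term_bound:
  assumes "s \<in> {0..E}" "w \<in> {0..E}"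
  shows "\<bar>(-1) ^ Suc n / fact (Suc n) * conv_power L n s w\<bar> \<le> \<Lambda> * (inverse (fact n) * (\<Lambda> * E) ^ n)"
proof -
  have "\<bar>(-1) ^ Suc n / fact (Suc n) * conv_power L n s w\<bar> = 1 / fact (Suc n) * \<bar>conv_power L n s w\<bar>"
    by (simp add: abs_mult power_abs)
  also have "\<dots> \<le> 1 / fact n * (\<Lambda> * (\<Lambda> * E) ^ n)"
    using conv_power_bound[OF L bound assms, of n]
    by (intro mult_mono) (auto intro!: divide_left_mono fact_mono simp del: fact_Suc)
  finally show ?thesis by (simp add: divide_inverse mult_ac)
qed

lemma exp_kernel_summable: "summable (\<lambda>n. \<Lambda> * (inverse (fact n) * (\<Lambda> * E) ^ n))"
  by (intro summable_mult summable_exp)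

lemma exp_kernel_uniform:
  "uniform_limit ({0..E} \<times> {0..E}) (\<lambda>N (s, w). \<Sum>n<N. (-1) ^ Suc n / fact (Suc n) * conv_power L n s w)
     (\<lambda>(s, w). exp_kernel L s w) sequentially"
  unfolding exp_kernel_def split_beta
  by (rule Weierstrass_m_test[OF _ exp_kernel_summable]) (use exp_kernel_term_bound in auto)

lemma exp_kernel_continuous:
  "continuous_on ({0..E} \<times> {0..E}) (\<lambda>(s, w). exp_kernel L s w)"
proof (rule uniform_limit_theorem[OF _ exp_kernel_uniform])
  show "\<forall>\<^sub>F N in sequentially. continuous_on ({0..E} \<times> {0..E})
     (\<lambda>(s, w). \<Sum>n<N. (-1) ^ Suc n / fact (Suc n) * conv_power L n s w)"
    using conv_power_continuous[OF L] unfolding split_beta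
    by (intro always_eventually allI continuous_intros)
qed simp

text \<open>
  Compare the exponential series of \<open>- z\<close> with the series defining the kernel term by term. The factor
  \<open>n\<close> in \<open>laplace_conv_power\<close> is absorbed by the factorial.
\<close>
lemma laplace_exp_kernel:
  fixes p :: real
  assumes s: "s \<in> {0..E}" and p: "0 \<le> p"
  defines "z \<equiv> integral {0..E} (\<lambda>w. exp (- p * w) * L s w)"
  shows "\<bar>exp (- z) - (1 + integral {0..E} (\<lambda>w. exp (- p * w) * exp_kernel L s w))\<bar>
         \<le> \<Lambda> * E * exp (\<Lambda> * E) * exp (- p * E)"
proof -
  define I where "I n = integral {0..E} (\<lambda>w. exp (- p * w) * conv_power L n s w)" for n
  define c where "c n = ((-1) ^ Suc n / fact (Suc n) :: real)" for n
  have Pc: "continuous_on {0..E} (conv_power L n s)" for n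
    by (rule continuous_on_slice[OF conv_power_continuous[OF L] s])
  have "uniform_limit {0..E} (\<lambda>N w. \<Sum>n<N. exp (- p * w) * (c n * conv_power L n s w))
      (\<lambda>w. \<Sum>n. exp (- p * w) * (c n * conv_power L n s w)) sequentially"
  proof (rule Weierstrass_m_test[OF _ exp_kernel_summable])
    fix n w assume w: "w \<in> {0..E}"
    have "exp (- p * w) * \<bar>c n * conv_power L n s w\<bar> \<le> 1 * (\<Lambda> * (inverse (fact n) * (\<Lambda> * E) ^ n))"
      unfolding c_def using p w exp_kernel_term_bound[OF s w, of n] by (intro mult_mono) auto
    then show "norm (exp (- p * w) * (c n * conv_power L n s w)) \<le> \<Lambda> * (inverse (fact n) * (\<Lambda> * E) ^ n)"
      by (simp add: abs_mult)
  qed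
  then obtain A J where AJ: "\<And>N. ((\<lambda>w. \<Sum>n<N. exp (- p * w) * (c n * conv_power L n s w)) has_integral A N) {0..E}"
      "((\<lambda>w. \<Sum>n. exp (- p * w) * (c n * conv_power L n s w)) has_integral J) {0..E}" "A \<longlonglongrightarrow> J"
    by (rule uniform_limit_integral) (auto intro!: continuous_intros Pc)
  have "A N = (\<Sum>n<N. c n * I n)" for N
  proof -
    have "A N = integral {0..E} (\<lambda>w. \<Sum>n<N. exp (- p * w) * (c n * conv_power L n s w))"
      using AJ(1)[of N] by (rule integral_unique[symmetric])
    also have "\<dots> = (\<Sum>n<N. integral {0..E} (\<lambda>w. exp (- p * w) * (c n * conv_power L n s w)))"
      by (rule integral_sum) (auto intro!: integrable_continuous_interval continuous_intros Pc)
    also have "\<dots> = (\<Sum>n<N. c n * I n)"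
      unfolding I_def by (intro sum.cong refl) (simp only: mult.left_commute[of _ "c _"] integral_mult_right)
    finally show ?thesis .
  qed
  then have "A = (\<lambda>N. \<Sum>n<N. c n * I n)" by (rule ext)
  then have "(\<lambda>n. c n * I n) sums J" using AJ(3) by (simp add: sums_def)
  moreover have "(\<lambda>w. \<Sum>n. exp (- p * w) * (c n * conv_power L n s w)) w = exp (- p * w) * exp_kernel L s w"
    if w: "w \<in> {0..E}" for w
    unfolding exp_kernel_def c_def
    by (rule suminf_mult, rule summable_comparison_test'[OF exp_kernel_summable])
       (use exp_kernel_term_bound[OF s w] in auto)
  then have "J = integral {0..E} (\<lambda>w. exp (- p * w) * exp_kernel L s w)"
    using integral_unique[OF AJ(2)] integral_cong by (metis (no_types, lifting))
  moreover have "(\<lambda>n. c n * z ^ Suc n) sums (exp (- z) - 1)"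
  proof -
    have "(\<lambda>n. (- z) ^ n /\<^sub>R fact n) sums exp (- z)" by (rule exp_converges)
    then have "(\<lambda>n. (- z) ^ Suc n /\<^sub>R fact (Suc n)) sums (exp (- z) - 1)"
      using sums_Suc_iff[of "\<lambda>n. (- z) ^ n /\<^sub>R fact n" "exp (- z) - 1"] by simp
    moreover have "(- z) ^ Suc n /\<^sub>R fact (Suc n) = c n * z ^ Suc n" for n
      unfolding c_def power_minus[of z "Suc n"] by (simp add: divide_inverse mult_ac del: fact_Suc)
    ultimately show ?thesis by simp
  qed
  ultimately have d: "(\<lambda>n. c n * (z ^ Suc n - I n)) sums
      (exp (- z) - (1 + integral {0..E} (\<lambda>w. exp (- p * w) * exp_kernel L s w)))"
    using sums_diff by (fastforce simp: right_diff_distrib diff_diff_eq)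
  have \<Lambda>: "0 \<le> \<Lambda>" using bound[OF s s] by linarith
  have tb: "norm (c n * (z ^ Suc n - I n)) \<le> \<Lambda> * E * exp (- p * E) * (inverse (fact n) * (\<Lambda> * E) ^ n)" for n
  proof -
    have "norm (c n * (z ^ Suc n - I n)) = 1 / fact (Suc n) * \<bar>z ^ Suc n - I n\<bar>"
      by (simp add: c_def abs_mult power_abs)
    also have "\<dots> \<le> 1 / fact (Suc n) * (real (Suc n) * (\<Lambda> * E) ^ Suc n * exp (- p * E))"
    proof (rule mult_left_mono)
      have "\<bar>z ^ Suc n - I n\<bar> \<le> real n * (\<Lambda> * E) ^ Suc n * exp (- p * E)"
        using laplace_conv_power[OF L bound s p, of n] by (simp add: z_def I_def)
      also have "\<dots> \<le> real (Suc n) * (\<Lambda> * E) ^ Suc n * exp (- p * E)"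
        using \<Lambda> E by (intro mult_right_mono) auto
      finally show "\<bar>z ^ Suc n - I n\<bar> \<le> real (Suc n) * (\<Lambda> * E) ^ Suc n * exp (- p * E)" .
    qed simp
    also have "\<dots> = (real (Suc n) / fact (Suc n)) * (\<Lambda> * E) ^ Suc n * exp (- p * E)" by simp
    also have "real (Suc n) / fact (Suc n) = inverse (fact n)"
      by (simp add: fact_Suc inverse_eq_divide del: of_nat_Suc)
    finally show ?thesis by (simp add: mult_ac)
  qed
  have e: "(\<lambda>n. \<Lambda> * E * exp (- p * E) * (inverse (fact n) * (\<Lambda> * E) ^ n)) sums (\<Lambda> * E * exp (- p * E) * exp (\<Lambda> * E))"
    using exp_converges[of "\<Lambda> * E"] by (intro sums_mult) (simp add: mult.commute)
  from norm_suminf_le[of "\<lambda>n. c n * (z ^ Suc n - I n)", OF tb sums_summable[OF e]] d e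
  show ?thesis by (simp add: sums_iff mult_ac)
qed

end

section \<open>Vanishing of the trace on a short time interval\<close>

lemma bounded_on_compact:
  fixes f :: "'a::topological_space \<Rightarrow> real"
  assumes "compact S" "continuous_on S f"
  obtains B where "0 \<le> B" "\<And>x. x \<in> S \<Longrightarrow> \<bar>f x\<bar> \<le> B"
proof -
  obtain B where "0 < B" "\<forall>y\<in>f ` S. norm y \<le> B"
    using compact_imp_bounded[OF compact_continuous_image[OF assms(2,1)]] unfolding bounded_pos by blast
  with that[of B] show ?thesis by auto
qed

lemma abs_exp_diff_le:
  fixes u v B :: real
  assumes "u \<le> B" "v \<le> B"
  shows "\<bar>exp u - exp v\<bar> \<le> exp B * \<bar>u - v\<bar>"
proof -
  have *: "exp u - exp v \<le> exp B * \<bar>u - v\<bar>" if "u \<le> B" for u v :: real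
  proof -
    have "exp u * (1 + (v - u)) \<le> exp u * exp (v - u)"
      by (intro mult_left_mono exp_ge_add_one_self) auto
    then have "exp u - exp v \<le> exp u * (u - v)" by (simp add: exp_diff algebra_simps)
    also have "\<dots> \<le> exp u * \<bar>u - v\<bar>" by (intro mult_left_mono) auto
    also have "\<dots> \<le> exp B * \<bar>u - v\<bar>" using that by (intro mult_right_mono) auto
    finally show ?thesis .
  qed
  from *[OF assms(1), of v] *[OF assms(2), of u] show ?thesis
    by (intro abs_leI) (simp_all add: abs_minus_commute)
qed

text \<open>
  Variation of constants gives \<open>J = \<integral>\<^sub>0\<^sup>E exp (- p s) exp (- \<Theta>(s)) a(s) ds = O(exp (- p E))\<close> with
  \<open>\<Theta> = \<integral> N\<close>. Replacing \<open>exp (- \<Theta>)\<close> by one plus the transform of the kernel \<open>k\<close>, and a double integral by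
  the transform of a convolution, turns \<open>J\<close> into the transform of \<open>g\<close> with errors
  \<open>O(p exp (- p E))\<close>. Hence \<open>g = 0\<close>, a Volterra equation for \<open>a\<close>.
\<close>
lemma trace_vanishes:
  fixes f N \<beta> :: "real \<Rightarrow> real \<Rightarrow> real" and a :: "real \<Rightarrow> real"
  assumes E: "0 < E"
    and \<beta>: "continuous_on ({0..E} \<times> {0..E}) (\<lambda>(t, w). \<beta> t w)"
    and N_cont: "\<And>p. 1 \<le> p \<Longrightarrow> continuous_on {0..E} (\<lambda>t. N t p)"
    and N: "\<And>t p. t \<in> {0..E} \<Longrightarrow> 1 \<le> p \<Longrightarrow>
       \<bar>N t p - integral {0..E} (\<lambda>w. exp (- p * w) * \<beta> t w)\<bar> \<le> K * p * exp (- p * E)"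
    and a: "continuous_on {0..E} a"
    and f_deriv: "\<And>t p. t \<in> {0..E} \<Longrightarrow> 1 \<le> p \<Longrightarrow>
       ((\<lambda>s. f s p) has_real_derivative p * (f t p - a t) + N t p * f t p) (at t within {0..E})"
    and f_bound: "\<And>p. 1 \<le> p \<Longrightarrow> \<bar>f E p\<bar> \<le> F"
    and f0: "\<And>p. 1 \<le> p \<Longrightarrow> f 0 p = 0"
    and t: "t \<in> {0..E}"
  shows "a t = 0"
proof -
  obtain \<Lambda> where \<Lambda>: "0 \<le> \<Lambda>" "\<And>t w. t \<in> {0..E} \<Longrightarrow> w \<in> {0..E} \<Longrightarrow> \<bar>\<beta> t w\<bar> \<le> \<Lambda>"
    using bounded_on_compact[OF compact_Times[OF compact_Icc compact_Icc] \<beta>] by (metis (no_types, lifting) SigmaI case_prod_conv)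
  obtain A where A: "0 \<le> A" "\<And>t. t \<in> {0..E} \<Longrightarrow> \<bar>a t\<bar> \<le> A"
    using bounded_on_compact[OF compact_Icc a] by blast
  have K: "0 \<le> K" using N[of 0 1] E order_trans[OF abs_ge_zero, of _ "K * 1 * exp (- 1 * E)"]
    by (simp add: zero_le_mult_iff)
  define L where "L s w = integral {0..s} (\<lambda>r. \<beta> r w)" for s w
  have L_cont: "continuous_on ({0..E} \<times> {0..E}) (\<lambda>(s, w). L s w)"
  proof -
    have "continuous_on (({0..E} \<times> {0..E}) \<times> {0..1}) (\<lambda>(z, \<theta>). \<beta> (fst z * \<theta>) (snd z))"
      unfolding split_beta
      by (intro continuous_on_compose_pair[OF \<beta>] continuous_intros)
         (auto simp: mult_left_le intro: order_trans[OF mult_left_le])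
    then show ?thesis
      unfolding L_def split_beta by (intro continuous_on_integral_upto continuous_intros) (auto simp only: case_prod_unfold mem_Times_iff atLeastAtMost_iff)
  qed
  have \<beta>_slice: "continuous_on {0..E} (\<lambda>r. \<beta> r w)" if "w \<in> {0..E}" for w
    using that by (intro continuous_on_compose_pair[OF \<beta>] continuous_intros) auto
  have L_bound: "\<bar>L s w\<bar> \<le> \<Lambda> * E" if s: "s \<in> {0..E}" and w: "w \<in> {0..E}" for s w
  proof -
    have "\<bar>L s w\<bar> \<le> \<Lambda> * (s - 0)"
      unfolding L_def using s w
      by (intro abs_integral_le integrable_continuous_interval continuous_on_subset[OF \<beta>_slice] \<Lambda>(2)) auto
    also have "\<dots> \<le> \<Lambda> * E" using s \<Lambda>(1) by (intro mult_left_mono) auto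
    finally show ?thesis .
  qed
  define k where "k = exp_kernel L"
  note k_facts = L_cont L_bound less_imp_le[OF E]
  have k_cont: "continuous_on ({0..E} \<times> {0..E}) (\<lambda>(s, w). k s w)"
    unfolding k_def by (rule exp_kernel_continuous[OF k_facts])
  obtain \<kappa> where \<kappa>: "0 \<le> \<kappa>" "\<And>t w. t \<in> {0..E} \<Longrightarrow> w \<in> {0..E} \<Longrightarrow> \<bar>k t w\<bar> \<le> \<kappa>"
    using bounded_on_compact[OF compact_Times[OF compact_Icc compact_Icc] k_cont] by (metis (no_types, lifting) SigmaI case_prod_conv)
  define N0 where "N0 = \<Lambda> * E + K / E"
  have N0: "0 \<le> N0" using \<Lambda>(1) K E by (simp add: N0_def)
  define g where "g \<sigma> = a \<sigma> + integral {0..\<sigma>} (\<lambda>u. a u * k u (\<sigma> - u))" for \<sigma>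
  have ak_cont: "continuous_on ({0..E} \<times> {0..E}) (\<lambda>(s, w). a s * k s w)"
    unfolding split_beta
    by (intro continuous_on_mult continuous_on_compose_pair[OF k_cont] continuous_on_compose2[OF a] continuous_intros) auto
  have ak_bound: "\<bar>a s * k s w\<bar> \<le> A * \<kappa>" if "s \<in> {0..E}" "w \<in> {0..E}" for s w
    unfolding abs_mult using that A \<kappa> by (intro mult_mono) auto
  have conv_cont: "continuous_on {0..E} (\<lambda>\<sigma>. integral {0..\<sigma>} (\<lambda>u. a u * k u (\<sigma> - u)))"
  proof -
    have "continuous_on ({0..E} \<times> {0..1}) (\<lambda>(\<sigma>, \<theta>). a (\<sigma> * \<theta>) * k (\<sigma> * \<theta>) (\<sigma> - \<sigma> * \<theta>))"
      unfolding split_beta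
      by (intro continuous_on_compose_pair[OF ak_cont] continuous_intros)
         (auto simp: mult_left_le intro: order_trans[OF mult_left_le] order_trans[of "b - b * t" b for b t :: real])
    then show ?thesis
      by (intro continuous_on_integral_upto continuous_intros) auto
  qed
  have g_cont: "continuous_on {0..E} g"
    unfolding g_def by (intro continuous_on_add a conv_cont)
  define C1 where "C1 = exp (N0 * E) * (K * E) + \<Lambda> * E * E * exp (\<Lambda> * E * E)"
  define C where "C = exp (N0 * E) * F + A * C1 * E + E\<^sup>2 * (A * \<kappa>)"
  have "\<bar>integral {0..E} (\<lambda>\<sigma>. exp (- p * \<sigma>) * g \<sigma>)\<bar> \<le> C * p * exp (- p * E)" if p: "1 \<le> p" for p
  proof -
    have p0: "0 \<le> p" using p by simp
    define I\<beta> where "I\<beta> t = integral {0..E} (\<lambda>w. exp (- p * w) * \<beta> t w)" for t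
    define \<Theta> where "\<Theta> t = integral {0..t} (\<lambda>r. N r p)" for t
    define z where "z s = integral {0..E} (\<lambda>w. exp (- p * w) * L s w)" for s
    define Ik where "Ik s = integral {0..E} (\<lambda>w. exp (- p * w) * k s w)" for s
    \<comment> \<open>This makes the error term in \<open>N\<close>, and with it \<open>\<Theta>\<close>, bounded uniformly in \<open>p\<close>.\<close>
    have small: "p * exp (- p * E) \<le> 1 / E"
    proof -
      have "p * E \<le> exp (p * E)" using exp_ge_add_one_self[of "p * E"] by linarith
      then show ?thesis using E by (simp add: exp_minus field_simps)
    qed
    have I\<beta>_cont: "continuous_on {0..E} I\<beta>"
    proof -
      have "continuous_on ({0..E} \<times> cbox 0 E) (\<lambda>(t, w). exp (- p * w) * \<beta> t w)"
        unfolding split_beta by (intro continuous_intros continuous_on_compose_pair[OF \<beta>]) auto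
      from integral_continuous_on_param[OF this] show ?thesis by (simp add: I\<beta>_def[abs_def])
    qed
    have I\<beta>_bound: "\<bar>I\<beta> t\<bar> \<le> \<Lambda> * E" if s: "t \<in> {0..E}" for t
      unfolding I\<beta>_def
      by (rule abs_truncated_laplace_le[OF less_imp_le[OF E] p0 continuous_on_slice[OF \<beta> s] \<Lambda>(2)[OF s]])
    have N_bound: "\<bar>N t p\<bar> \<le> N0" if "t \<in> {0..E}" for t
    proof -
      have "K * (p * exp (- p * E)) \<le> K * (1 / E)" by (intro mult_left_mono small K)
      with N[OF that p] I\<beta>_bound[OF that] show ?thesis
        unfolding N0_def I\<beta>_def[symmetric] by (simp add: mult.assoc)
    qed
    have \<Theta>_bound: "\<bar>\<Theta> s\<bar> \<le> N0 * E" if s: "s \<in> {0..E}" for s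
    proof -
      have "\<bar>\<Theta> s\<bar> \<le> N0 * (s - 0)"
        unfolding \<Theta>_def using s
        by (intro abs_integral_le integrable_continuous_interval continuous_on_subset[OF N_cont[OF p]] N_bound) auto
      also have "\<dots> \<le> N0 * E" using s N0 by (intro mult_left_mono) auto
      finally show ?thesis .
    qed
    have z_eq: "z s = integral {0..s} I\<beta>" if s: "s \<in> {0..E}" for s
    proof -
      have "continuous_on (cbox (0, 0) (s, E)) (\<lambda>(r, w). exp (- p * w) * \<beta> r w)"
        unfolding split_beta using s
        by (intro continuous_intros continuous_on_compose_pair[OF \<beta>]) (auto simp: cbox_Pair_eq)
      from integral_swap_continuous[OF this] show ?thesis
        unfolding z_def L_def I\<beta>_def by simp
    qed
    have z_bound: "\<bar>z s\<bar> \<le> N0 * E" if s: "s \<in> {0..E}" for s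
    proof -
      have "\<bar>z s\<bar> \<le> N0 * (s - 0)"
        unfolding z_eq[OF s] using s K E
        by (intro abs_integral_le integrable_continuous_interval continuous_on_subset[OF I\<beta>_cont]
            order_trans[OF I\<beta>_bound]) (auto simp: N0_def)
      also have "\<dots> \<le> N0 * E" using s N0 by (intro mult_left_mono) auto
      finally show ?thesis .
    qed
    have \<Theta>_z: "\<bar>\<Theta> s - z s\<bar> \<le> K * E * (p * exp (- p * E))" if s: "s \<in> {0..E}" for s
    proof -
      have "\<Theta> s - z s = integral {0..s} (\<lambda>r. N r p - I\<beta> r)"
        unfolding z_eq[OF s] \<Theta>_def using s
        by (intro integral_diff[symmetric] integrable_continuous_interval
            continuous_on_subset[OF I\<beta>_cont] continuous_on_subset[OF N_cont[OF p]]) auto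
      also have "\<bar>\<dots>\<bar> \<le> (K * p * exp (- p * E)) * (s - 0)"
      proof (rule abs_integral_le)
        show "(\<lambda>r. N r p - I\<beta> r) integrable_on {0..s}" using s
          by (intro integrable_continuous_interval continuous_on_diff
              continuous_on_subset[OF I\<beta>_cont] continuous_on_subset[OF N_cont[OF p]]) auto
      qed (use s N[OF _ p] in \<open>auto simp: I\<beta>_def\<close>)
      also have "\<dots> \<le> (K * p * exp (- p * E)) * E" using s K p by (intro mult_left_mono) auto
      finally show ?thesis by (simp add: mult_ac)
    qed
    have err: "\<bar>exp (- \<Theta> s) - (1 + Ik s)\<bar> \<le> C1 * (p * exp (- p * E))" if s: "s \<in> {0..E}" for s
    proof -
      have "\<bar>exp (- \<Theta> s) - exp (- z s)\<bar> \<le> exp (N0 * E) * \<bar>- \<Theta> s - - z s\<bar>"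
        using \<Theta>_bound[OF s] z_bound[OF s] by (intro abs_exp_diff_le) auto
      also have "\<dots> \<le> exp (N0 * E) * (K * E * (p * exp (- p * E)))"
        using \<Theta>_z[OF s] by (intro mult_left_mono) auto
      finally have 1: "\<bar>exp (- \<Theta> s) - exp (- z s)\<bar> \<le> exp (N0 * E) * (K * E) * (p * exp (- p * E))"
        by (simp add: mult.assoc)
      have "\<bar>exp (- z s) - (1 + Ik s)\<bar> \<le> \<Lambda> * E * E * exp (\<Lambda> * E * E) * exp (- p * E)"
        using laplace_exp_kernel[OF k_facts s p0] by (simp add: z_def Ik_def k_def)
      also have "\<dots> \<le> \<Lambda> * E * E * exp (\<Lambda> * E * E) * (p * exp (- p * E))"
        using p \<Lambda>(1) E by (intro mult_left_mono) auto
      finally show ?thesis using 1 unfolding C1_def distrib_right by linarith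
    qed
    have \<Theta>_deriv: "(\<Theta> has_real_derivative N t p) (at t within {0..E})" if "t \<in> {0..E}" for t
      unfolding \<Theta>_def by (intro integral_has_real_derivative N_cont p that)
    have \<Theta>_cont: "continuous_on {0..E} \<Theta>"
      by (rule DERIV_continuous_on[OF \<Theta>_deriv])
    have ftc: "((\<lambda>t. - p * (exp (- p * t) * exp (- \<Theta> t) * a t)) has_integral
        exp (- p * E - \<Theta> E) * f E p - exp (- p * 0 - \<Theta> 0) * f 0 p) {0..E}"
    proof (rule fundamental_theorem_of_calculus)
      fix t assume t: "t \<in> {0..E}"
      have "((\<lambda>t. exp (- p * t - \<Theta> t) * f t p) has_real_derivative
          exp (- p * t - \<Theta> t) * (- p - N t p) * f t p
          + exp (- p * t - \<Theta> t) * (p * (f t p - a t) + N t p * f t p)) (at t within {0..E})"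
        by (auto intro!: derivative_eq_intros \<Theta>_deriv[OF t] f_deriv[OF t p])
      also have "exp (- p * t - \<Theta> t) * (- p - N t p) * f t p
          + exp (- p * t - \<Theta> t) * (p * (f t p - a t) + N t p * f t p)
          = - p * (exp (- p * t) * exp (- \<Theta> t) * a t)"
      proof -
        have "exp (- p * t - \<Theta> t) = exp (- p * t) * exp (- \<Theta> t)"
          using exp_add[of "- p * t" "- \<Theta> t"] by simp
        moreover have "x * (- p - n) * y + x * (p * (y - \<alpha>) + n * y) = - p * (x * \<alpha>)" for x n y \<alpha> :: real
          by (simp add: algebra_simps)
        ultimately show ?thesis by (simp only:)
      qed
      finally show "((\<lambda>t. exp (- p * t - \<Theta> t) * f t p) has_vector_derivative
          - p * (exp (- p * t) * exp (- \<Theta> t) * a t)) (at t within {0..E})"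
        by (simp add: has_real_derivative_iff_has_vector_derivative)
    qed (use E in simp)
    define J where "J = integral {0..E} (\<lambda>t. exp (- p * t) * exp (- \<Theta> t) * a t)"
    have "- p * J = exp (- p * E - \<Theta> E) * f E p"
      using integral_unique[OF ftc] f0[OF p] unfolding J_def by (simp only: integral_mult_right)
    then have "\<bar>- p * J\<bar> = \<bar>exp (- p * E - \<Theta> E) * f E p\<bar>" by (simp only:)
    then have "p * \<bar>J\<bar> = exp (- p * E - \<Theta> E) * \<bar>f E p\<bar>" using p by (simp add: abs_mult)
    also have "\<dots> = exp (- p * E) * (exp (- \<Theta> E) * \<bar>f E p\<bar>)"
      using exp_add[of "- p * E" "- \<Theta> E"] by simp
    also have "\<dots> \<le> exp (- p * E) * (exp (N0 * E) * F)"
      using \<Theta>_bound[of E] E f_bound[OF p] by (intro mult_left_mono mult_mono) auto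
    finally have pJ: "p * \<bar>J\<bar> \<le> exp (N0 * E) * F * exp (- p * E)" by (simp add: mult_ac)
    have "\<bar>J\<bar> \<le> p * \<bar>J\<bar>" using p by (simp add: mult_le_cancel_right1)
    also note pJ
    also have "exp (N0 * E) * F * exp (- p * E) \<le> exp (N0 * E) * F * (p * exp (- p * E))"
      using p order_trans[OF abs_ge_zero f_bound[OF p]] by (intro mult_left_mono) auto
    finally have J: "\<bar>J\<bar> \<le> exp (N0 * E) * F * (p * exp (- p * E))" .
    have Ik_cont: "continuous_on {0..E} Ik"
    proof -
      have "continuous_on ({0..E} \<times> cbox 0 E) (\<lambda>(t, w). exp (- p * w) * k t w)"
        unfolding split_beta by (intro continuous_intros continuous_on_compose_pair[OF k_cont]) auto
      from integral_continuous_on_param[OF this] show ?thesis by (simp add: Ik_def[abs_def])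
    qed
    define J' where "J' = integral {0..E} (\<lambda>s. exp (- p * s) * a s * (1 + Ik s))"
    have "J - J' = integral {0..E} (\<lambda>s. exp (- p * s) * exp (- \<Theta> s) * a s - exp (- p * s) * a s * (1 + Ik s))"
      unfolding J_def J'_def
      by (intro integral_diff[symmetric] integrable_continuous_interval continuous_intros a \<Theta>_cont Ik_cont)
    also have "\<bar>\<dots>\<bar> \<le> (A * (C1 * (p * exp (- p * E)))) * (E - 0)"
    proof (rule abs_integral_le)
      fix s assume s: "s \<in> {0..E}"
      have "\<bar>exp (- p * s) * exp (- \<Theta> s) * a s - exp (- p * s) * a s * (1 + Ik s)\<bar>
          = exp (- p * s) * (\<bar>a s\<bar> * \<bar>exp (- \<Theta> s) - (1 + Ik s)\<bar>)"
      proof -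
        have "exp (- p * s) * exp (- \<Theta> s) * a s - exp (- p * s) * a s * (1 + Ik s)
            = exp (- p * s) * (a s * (exp (- \<Theta> s) - (1 + Ik s)))"
          by (simp add: algebra_simps)
        then show ?thesis by (simp only: abs_mult abs_exp_cancel)
      qed
      also have "\<dots> \<le> 1 * (A * (C1 * (p * exp (- p * E))))"
        using p s A err[OF s] by (intro mult_mono) auto
      finally show "\<bar>exp (- p * s) * exp (- \<Theta> s) * a s - exp (- p * s) * a s * (1 + Ik s)\<bar>
          \<le> A * (C1 * (p * exp (- p * E)))" by simp
    qed (use E in \<open>auto intro!: integrable_continuous_interval continuous_intros a \<Theta>_cont Ik_cont\<close>)
    finally have JJ': "\<bar>J - J'\<bar> \<le> A * C1 * E * (p * exp (- p * E))" by (simp add: mult_ac)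
    define D where "D = integral {0..E} (\<lambda>u. integral {0..E} (\<lambda>v. exp (- p * (u + v)) * (a u * k u v)))"
    define D' where "D' = integral {0..E} (\<lambda>\<sigma>. exp (- p * \<sigma>) * integral {0..\<sigma>} (\<lambda>u. a u * k u (\<sigma> - u)))"
    have "\<bar>D - D'\<bar> \<le> E\<^sup>2 * (A * \<kappa>) * exp (- p * E)"
      unfolding D_def D'_def
      by (rule truncated_laplace_product[OF _ ak_cont ak_bound p0]) (use E in auto)
    also have "\<dots> \<le> E\<^sup>2 * (A * \<kappa>) * (p * exp (- p * E))"
      using p A(1) \<kappa>(1) by (intro mult_left_mono) auto
    finally have DD': "\<bar>D - D'\<bar> \<le> E\<^sup>2 * (A * \<kappa>) * (p * exp (- p * E))" .
    have D_eq: "D = integral {0..E} (\<lambda>s. exp (- p * s) * a s * Ik s)"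
    proof -
      have "exp (- p * (u + v)) * (a u * k u v) = exp (- p * u) * a u * (exp (- p * v) * k u v)" for u v
        using exp_add[of "- p * u" "- p * v"] by (simp add: distrib_left)
      then show ?thesis by (simp only: D_def Ik_def integral_mult_right)
    qed
    define H where "H = integral {0..E} (\<lambda>s. exp (- p * s) * a s)"
    have "J' = integral {0..E} (\<lambda>s. exp (- p * s) * a s + exp (- p * s) * a s * Ik s)"
      by (simp add: J'_def algebra_simps)
    also have "\<dots> = H + D"
      unfolding H_def D_eq
      by (intro integral_add integrable_continuous_interval continuous_intros a Ik_cont)
    finally have J'_eq: "J' = H + D" .
    have "integral {0..E} (\<lambda>\<sigma>. exp (- p * \<sigma>) * g \<sigma>)
      = integral {0..E} (\<lambda>\<sigma>. exp (- p * \<sigma>) * a \<sigma> + exp (- p * \<sigma>) * integral {0..\<sigma>} (\<lambda>u. a u * k u (\<sigma> - u)))"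
      by (simp add: g_def algebra_simps)
    also have "\<dots> = H + D'"
      unfolding H_def D'_def
      by (intro integral_add integrable_continuous_interval continuous_intros a conv_cont)
    finally have "integral {0..E} (\<lambda>\<sigma>. exp (- p * \<sigma>) * g \<sigma>) = J - (J - J') - (D - D')"
      using J'_eq by simp
    then have "\<bar>integral {0..E} (\<lambda>\<sigma>. exp (- p * \<sigma>) * g \<sigma>)\<bar> \<le> C * (p * exp (- p * E))"
      using J JJ' DD' unfolding C_def distrib_right by linarith
    then show ?thesis by (simp only: mult.assoc)
  qed
  then have "integral {0..t} g = 0" if "0 \<le> t" "t < E" for t
    using finite_laplace_unique[OF g_cont _ that] by blast
  then have g0: "g t = 0" if "t \<in> {0..E}" for t
    using zero_if_integrals_zero[OF g_cont _ E that] by blast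
  show "a t = 0"
  proof (rule volterra_zero[OF a _ t, where K=\<kappa>])
    fix t assume t: "t \<in> {0..E}"
    have int1: "(\<lambda>u. a u * k u (t - u)) integrable_on {0..t}" using t
      by (intro integrable_continuous_interval continuous_on_compose_pair[OF ak_cont] continuous_intros) auto
    have int2: "(\<lambda>s. \<kappa> * \<bar>a s\<bar>) integrable_on {0..t}" using t
      by (intro integrable_continuous_interval continuous_intros continuous_on_subset[OF a]) auto
    have "\<bar>a t\<bar> = \<bar>integral {0..t} (\<lambda>u. a u * k u (t - u))\<bar>"
      using g0[OF t] unfolding g_def by linarith
    also have "\<dots> \<le> integral {0..t} (\<lambda>s. \<kappa> * \<bar>a s\<bar>)"
    proof -
      have "norm (a u * k u (t - u)) \<le> \<kappa> * \<bar>a u\<bar>" if u: "u \<in> {0..t}" for u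
      proof -
        have "\<bar>k u (t - u)\<bar> * \<bar>a u\<bar> \<le> \<kappa> * \<bar>a u\<bar>"
          using u t by (intro mult_right_mono \<kappa>(2)) auto
        then show ?thesis by (simp add: abs_mult mult.commute)
      qed
      from integral_norm_bound_integral[OF int1 int2 this] show ?thesis by simp
    qed
    finally show "\<bar>a t\<bar> \<le> \<kappa> * integral {0..t} (\<lambda>s. \<bar>a s\<bar>)" by simp
  qed
qed

section \<open>Reduction to the normal form and uniqueness\<close>

lemma linear_ode_zero:
  fixes y q :: "real \<Rightarrow> real"
  assumes q: "continuous_on {0..E} q"
    and y: "\<And>t. t \<in> {0..E} \<Longrightarrow> (y has_real_derivative q t * y t) (at t within {0..E})"
    and y0: "y 0 = 0" and t: "t \<in> {0..E}"
  shows "y t = 0"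
proof -
  define Q where "Q t = integral {0..t} q" for t
  have Q: "(Q has_real_derivative q t) (at t within {0..E})" if "t \<in> {0..E}" for t
    unfolding Q_def by (intro integral_has_real_derivative q that)
  have "\<exists>c. \<forall>t\<in>{0..E}. exp (- Q t) * y t = c"
  proof (rule has_field_derivative_zero_constant)
    fix t assume "t \<in> {0..E}"
    then show "((\<lambda>t. exp (- Q t) * y t) has_field_derivative 0) (at t within {0..E})"
      by (auto intro!: derivative_eq_intros Q y)
  qed simp
  then obtain c where c: "\<And>t. t \<in> {0..E} \<Longrightarrow> exp (- Q t) * y t = c" by blast
  have "c = 0" using c[of 0] y0 t by simp
  with c[OF t] show ?thesis by simp
qed

text \<open>
  Induction over time steps of length \<open>\<epsilon>\<close>, the range of the Laplace representation of \<open>N\<close>. In each step the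
  trace vanishes first; the equation is then homogeneous.
\<close>
lemma normalized_uniqueness:
  fixes f N \<beta> :: "real \<Rightarrow> real \<Rightarrow> real" and a :: "real \<Rightarrow> real"
  assumes \<epsilon>: "0 < \<epsilon>"
    and \<beta>: "continuous_on ({0..T} \<times> {0..\<epsilon>}) (\<lambda>(t, w). \<beta> t w)"
    and N_cont: "\<And>p. 1 \<le> p \<Longrightarrow> continuous_on {0..T} (\<lambda>t. N t p)"
    and N: "\<And>t p. t \<in> {0..T} \<Longrightarrow> 1 \<le> p \<Longrightarrow>
       \<bar>N t p - integral {0..\<epsilon>} (\<lambda>w. exp (- p * w) * \<beta> t w)\<bar> \<le> K * p * exp (- p * \<epsilon>)"
    and a: "continuous_on {0..T} a"
    and f_deriv: "\<And>t p. t \<in> {0..T} \<Longrightarrow> 1 \<le> p \<Longrightarrow>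
       ((\<lambda>s. f s p) has_real_derivative p * (f t p - a t) + N t p * f t p) (at t within {0..T})"
    and f_bound: "\<And>t p. t \<in> {0..T} \<Longrightarrow> 1 \<le> p \<Longrightarrow> \<bar>f t p\<bar> \<le> F"
    and f0: "\<And>p. 1 \<le> p \<Longrightarrow> f 0 p = 0"
    and t: "t \<in> {0..T}" and p: "1 \<le> p"
  shows "f t p = 0"
proof -
  obtain \<Lambda> where \<Lambda>: "0 \<le> \<Lambda>" "\<And>t w. t \<in> {0..T} \<Longrightarrow> w \<in> {0..\<epsilon>} \<Longrightarrow> \<bar>\<beta> t w\<bar> \<le> \<Lambda>"
    using bounded_on_compact[OF compact_Times[OF compact_Icc compact_Icc] \<beta>] by (metis (no_types, lifting) SigmaI case_prod_conv)
  have K: "0 \<le> K" using N[of t 1] t order_trans[OF abs_ge_zero, of _ "K * 1 * exp (- 1 * \<epsilon>)"]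
    by (simp add: zero_le_mult_iff)
  have claim: "\<forall>t\<in>{0..T}. t \<le> real n * \<epsilon> \<longrightarrow> (\<forall>p\<ge>1. f t p = 0)" for n
  proof (induction n)
    case 0
    then show ?case using f0 by auto
  next
    case (Suc n)
    define \<tau> where "\<tau> = real n * \<epsilon>"
    \<comment> \<open>The last step is cut off at the final time \<open>T\<close>.\<close>
    define E where "E = min \<epsilon> (T - \<tau>)"
    have \<tau>: "0 \<le> \<tau>" using \<epsilon> by (simp add: \<tau>_def)
    show ?case
    proof (cases "\<tau> < T")
      case False
      then show ?thesis
        by (intro ballI impI allI, intro Suc.IH[rule_format]) (auto simp: \<tau>_def)
    next
      case True
      then have E: "0 < E" "E \<le> \<epsilon>" "\<tau> + E \<le> T" using \<epsilon> by (auto simp: E_def)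
      have sub: "\<tau> + s \<in> {0..T}" if "s \<in> {0..E}" for s using that \<tau> E by auto
      have f\<tau>: "f \<tau> p = 0" if "1 \<le> p" for p
        by (rule Suc.IH[rule_format]) (use that \<tau> True in \<open>simp_all add: \<tau>_def\<close>)
      have deriv: "((\<lambda>s. f (\<tau> + s) p) has_real_derivative p * (f (\<tau> + s) p - a (\<tau> + s)) + N (\<tau> + s) p * f (\<tau> + s) p) (at s within {0..E})"
        if s: "s \<in> {0..E}" and p: "1 \<le> p" for s p
      proof -
        have "((\<lambda>s. f s p) has_real_derivative p * (f (\<tau> + s) p - a (\<tau> + s)) + N (\<tau> + s) p * f (\<tau> + s) p)
            (at (\<tau> + s) within (+) \<tau> ` {0..E})"
          by (rule DERIV_subset[OF f_deriv[OF sub[OF s] p] image_subsetI[OF sub]])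
        moreover have "((+) \<tau> has_real_derivative 1) (at s within {0..E})"
          by (auto intro!: derivative_eq_intros)
        ultimately show ?thesis
          using DERIV_image_chain[of "\<lambda>s. f s p" _ "(+) \<tau>" s "{0..E}" 1] by (simp add: o_def)
      qed
      have N_cont': "continuous_on {0..E} (\<lambda>s. N (\<tau> + s) p)" if "1 \<le> p" for p
        by (rule continuous_on_compose2[OF N_cont[OF that] _ image_subsetI[OF sub]])
           (intro continuous_intros)
      have a0: "a (\<tau> + s) = 0" if s: "s \<in> {0..E}" for s
      proof (rule trace_vanishes[OF E(1) _ _ _ _ _ _ _ s,
          where \<beta>="\<lambda>s w. \<beta> (\<tau> + s) w" and f="\<lambda>s p. f (\<tau> + s) p" and N="\<lambda>s p. N (\<tau> + s) p" and F=F
            and K="K + \<Lambda> * \<epsilon>"])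
        show "continuous_on ({0..E} \<times> {0..E}) (\<lambda>(s, w). \<beta> (\<tau> + s) w)"
          unfolding split_beta
        proof (intro continuous_on_compose_pair[OF \<beta>] continuous_intros)
          fix z assume "z \<in> {0..E} \<times> {0..E}"
          then show "(\<tau> + fst z, snd z) \<in> {0..T} \<times> {0..\<epsilon>}"
            using sub[of "fst z"] E by (simp add: mem_Times_iff)
        qed
        show "continuous_on {0..E} (\<lambda>s. a (\<tau> + s))"
          by (rule continuous_on_compose2[OF a _ image_subsetI[OF sub]]) (intro continuous_intros)
        show "\<bar>f (\<tau> + E) p\<bar> \<le> F" if "1 \<le> p" for p
          using f_bound[OF sub that, of E] E by simp
        show "f (\<tau> + 0) p = 0" if "1 \<le> p" for p using f\<tau>[OF that] by simp
        fix s p :: real assume s: "s \<in> {0..E}" and p: "1 \<le> p"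
        have sl: "continuous_on {0..\<epsilon>} (\<lambda>w. exp (- p * w) * \<beta> (\<tau> + s) w)"
          by (intro continuous_intros continuous_on_slice[OF \<beta> sub[OF s]])
        have "integral {0..\<epsilon>} (\<lambda>w. exp (- p * w) * \<beta> (\<tau> + s) w)
            = integral {0..E} (\<lambda>w. exp (- p * w) * \<beta> (\<tau> + s) w) + integral {E..\<epsilon>} (\<lambda>w. exp (- p * w) * \<beta> (\<tau> + s) w)"
          using Henstock_Kurzweil_Integration.integral_combine[OF _ E(2) integrable_continuous_interval[OF sl]] E(1) by simp
        moreover have "\<bar>integral {E..\<epsilon>} (\<lambda>w. exp (- p * w) * \<beta> (\<tau> + s) w)\<bar> \<le> (exp (- p * E) * \<Lambda>) * (\<epsilon> - E)"
        proof (rule abs_integral_le[OF E(2)])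
          show "(\<lambda>w. exp (- p * w) * \<beta> (\<tau> + s) w) integrable_on {E..\<epsilon>}"
            by (intro integrable_continuous_interval continuous_on_subset[OF sl]) (use E in auto)
          fix w assume w: "w \<in> {E..\<epsilon>}"
          then have "exp (- p * w) * \<bar>\<beta> (\<tau> + s) w\<bar> \<le> exp (- p * E) * \<Lambda>"
            using p E \<Lambda>(2)[OF sub[OF s], of w] by (intro mult_mono) auto
          then show "\<bar>exp (- p * w) * \<beta> (\<tau> + s) w\<bar> \<le> exp (- p * E) * \<Lambda>" by (simp add: abs_mult)
        qed
        moreover have "(exp (- p * E) * \<Lambda>) * (\<epsilon> - E) \<le> \<Lambda> * \<epsilon> * p * exp (- p * E)"
        proof -
          have "\<Lambda> * (\<epsilon> - E) \<le> \<Lambda> * (\<epsilon> * p)"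
            using \<Lambda>(1) \<epsilon> E(1) p by (intro mult_left_mono) (auto intro: order_trans[of _ "\<epsilon> * 1"])
          from mult_right_mono[OF this, of "exp (- p * E)"] show ?thesis by (simp add: mult_ac)
        qed
        moreover have "K * p * exp (- p * \<epsilon>) \<le> K * p * exp (- p * E)"
          using K p E by (intro mult_left_mono) auto
        ultimately show "\<bar>N (\<tau> + s) p - integral {0..E} (\<lambda>w. exp (- p * w) * \<beta> (\<tau> + s) w)\<bar>
            \<le> (K + \<Lambda> * \<epsilon>) * p * exp (- p * E)"
          using N[OF sub[OF s] p] unfolding distrib_right by linarith
      qed (auto intro!: N_cont' deriv)
      have f_zero: "f (\<tau> + s) p = 0" if s: "s \<in> {0..E}" and p: "1 \<le> p" for s p
      proof (rule linear_ode_zero[OF _ _ _ s, where q="\<lambda>s. p + N (\<tau> + s) p"])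
        show "continuous_on {0..E} (\<lambda>s. p + N (\<tau> + s) p)"
          by (intro continuous_intros N_cont' p)
        show "((\<lambda>s. f (\<tau> + s) p) has_real_derivative (p + N (\<tau> + s) p) * f (\<tau> + s) p) (at s within {0..E})"
          if "s \<in> {0..E}" for s
          using deriv[OF that p] a0[OF that] by (simp add: distrib_right)
        show "f (\<tau> + 0) p = 0" using f\<tau>[OF p] by simp
      qed
      show ?thesis
      proof (intro ballI impI allI)
        fix t p :: real assume t: "t \<in> {0..T}" "t \<le> real (Suc n) * \<epsilon>" and p: "1 \<le> p"
        show "f t p = 0"
        proof (cases "t \<le> \<tau>")
          case True
          then show ?thesis
            by (intro Suc.IH[rule_format]) (use t p in \<open>auto simp: \<tau>_def\<close>)
        next
          case False
          then have "t - \<tau> \<in> {0..E}" using t by (auto simp: E_def \<tau>_def algebra_simps)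
          from f_zero[OF this p] show ?thesis by simp
        qed
      qed
    qed
  qed
  obtain n where "T / \<epsilon> \<le> real n" using real_arch_simple by blast
  then have "T \<le> real n * \<epsilon>" using \<epsilon> by (simp add: field_simps)
  then show ?thesis
    by (intro claim[of n, rule_format]) (use t p in auto)
qed

text \<open>
  The inverse of \<open>B(t) = \<integral>\<^sub>0\<^sup>t b\<close>. Extending \<open>b\<close> by constants to \<open>[-1, 2]\<close> makes all relevant points
  interior, where the inverse function rule applies.
\<close>
lemma time_change:
  fixes b :: "real \<Rightarrow> real"
  assumes cont: "continuous_on {0..1} b" and pos: "\<And>t. t \<in> {0..1} \<Longrightarrow> 0 < b t"
  obtains T S where "0 < T" "S 0 = 0" "\<And>\<tau>. \<tau> \<in> {0..T} \<Longrightarrow> S \<tau> \<in> {0..1}"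
    "\<And>\<tau>. \<tau> \<in> {0..T} \<Longrightarrow> (S has_real_derivative 1 / b (S \<tau>)) (at \<tau> within {0..T})"
    "\<And>t. t \<in> {0..1} \<Longrightarrow> \<exists>\<tau>\<in>{0..T}. S \<tau> = t"
proof -
  define \<beta> where "\<beta> r = b (max 0 (min 1 r))" for r
  have \<beta>_cont: "continuous_on A \<beta>" for A
    unfolding \<beta>_def by (rule continuous_on_compose2[OF cont]) (auto intro!: continuous_intros)
  have \<beta>_pos: "0 < \<beta> r" for r unfolding \<beta>_def by (rule pos) auto
  define B where "B t = integral {-1..t} \<beta> - integral {-1..0} \<beta>" for t
  have B_deriv: "(B has_real_derivative \<beta> t) (at t within {-1..2})" if "t \<in> {-1..2}" for t
    unfolding B_def using integral_has_real_derivative[OF \<beta>_cont that]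
    by (auto intro!: derivative_eq_intros)
  have B_cont: "continuous_on {-1..2} B" by (rule DERIV_continuous_on[OF B_deriv])
  have B_less: "B s < B t" if "s \<in> {-1..2}" "t \<in> {-1..2}" "s < t" for s t
  proof (rule DERIV_pos_imp_increasing_open[OF \<open>s < t\<close>])
    show "continuous_on {s..t} B" by (rule continuous_on_subset[OF B_cont]) (use that in auto)
    fix u assume "s < u" "u < t"
    then have "(B has_real_derivative \<beta> u) (at u)"
      using B_deriv[of u] that by (simp add: at_within_Icc_at)
    then show "\<exists>y. (B has_real_derivative y) (at u) \<and> 0 < y" using \<beta>_pos by blast
  qed
  have inj: "inj_on B {-1..2}"
    by (rule linorder_inj_onI) (use B_less in \<open>auto simp: less_imp_neq\<close>)
  define S where "S = inv_into {-1..2} B"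
  have SB: "S (B t) = t" if "t \<in> {-1..2}" for t
    unfolding S_def by (rule inv_into_f_f[OF inj that])
  have img: "\<tau> \<in> B ` {-1..2}" if "B (-1) \<le> \<tau>" "\<tau> \<le> B 2" for \<tau>
    using IVT'[of B "-1" \<tau> 2] that B_cont by force
  have BS: "B (S \<tau>) = \<tau>" "S \<tau> \<in> {-1..2}" if "B (-1) \<le> \<tau>" "\<tau> \<le> B 2" for \<tau>
    unfolding S_def by (rule f_inv_into_f[OF img[OF that]], rule inv_into_into[OF img[OF that]])
  have S_cont: "continuous_on {B (-1)..B 2} S"
  proof (rule continuous_on_subset)
    show "continuous_on (B ` {-1..2}) S"
      by (rule continuous_on_inv[OF B_cont compact_Icc]) (use SB in auto)
  qed (use img in auto)
  have B0: "B 0 = 0" by (simp add: B_def)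
  have ends: "B (-1) < 0" "0 < B 1" "B 1 < B 2"
    using B_less[of "-1" 0] B_less[of 0 1] B_less[of 1 2] B0 by auto
  have S01: "S \<tau> \<in> {0..1}" if t: "\<tau> \<in> {0..B 1}" for \<tau>
  proof -
    have 1: "B (S \<tau>) = \<tau>" "S \<tau> \<in> {-1..2}" using BS[of \<tau>] t ends by auto
    have "\<not> S \<tau> < 0" using B_less[of "S \<tau>" 0] 1 t B0 by auto
    moreover have "\<not> 1 < S \<tau>" using B_less[of 1 "S \<tau>"] 1 t by auto
    ultimately show ?thesis by auto
  qed
  show ?thesis
  proof (rule that[of "B 1" S])
    show "0 < B 1" by (rule ends)
    show "S 0 = 0" using SB[of 0] B0 by simp
    show "\<And>\<tau>. \<tau> \<in> {0..B 1} \<Longrightarrow> S \<tau> \<in> {0..1}" by (rule S01)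
    show "\<exists>\<tau>\<in>{0..B 1}. S \<tau> = t" if t: "t \<in> {0..1}" for t
    proof (rule bexI[of _ "B t"])
      show "S (B t) = t" using SB[of t] t by auto
      show "B t \<in> {0..B 1}"
        using B_less[of 0 t] B_less[of t 1] B0 t ends by (cases "t = 0"; cases "t = 1") auto
    qed
    fix \<tau> assume t: "\<tau> \<in> {0..B 1}"
    note s = S01[OF t]
    have "(S has_real_derivative inverse (\<beta> (S \<tau>))) (at \<tau>)"
    proof (rule DERIV_inverse_function[where f=B and a="B (-1)" and b="B 2"])
      show "(B has_real_derivative \<beta> (S \<tau>)) (at (S \<tau>))"
        using B_deriv[of "S \<tau>"] s by (simp add: at_within_Icc_at)
      show "isCont S \<tau>"
        using continuous_on_interior[OF S_cont, of \<tau>] t ends by (simp add: interior_atLeastAtMost_real)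
    qed (use t ends BS \<beta>_pos[of "S \<tau>"] in auto)
    moreover have "\<beta> (S \<tau>) = b (S \<tau>)" using s by (simp add: \<beta>_def)
    ultimately show "(S has_real_derivative 1 / b (S \<tau>)) (at \<tau> within {0..B 1})"
      by (simp add: inverse_eq_divide has_field_derivative_at_within)
  qed
qed

lemma laplace_by_parts:
  fixes h h' :: "real \<Rightarrow> real"
  assumes h: "\<And>w. w \<in> {0..\<epsilon>} \<Longrightarrow> (h has_real_derivative h' w) (at w within {0..\<epsilon>})"
    and h': "continuous_on {0..\<epsilon>} h'" and "0 \<le> \<epsilon>"
  shows "p * integral {0..\<epsilon>} (\<lambda>w. exp (- p * w) * h w)
       = h 0 - exp (- p * \<epsilon>) * h \<epsilon> + integral {0..\<epsilon>} (\<lambda>w. exp (- p * w) * h' w)"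
proof -
  have hc: "continuous_on {0..\<epsilon>} h" by (rule DERIV_continuous_on[OF h])
  have "((\<lambda>w. exp (- p * w) * h' w - p * (exp (- p * w) * h w)) has_integral
      exp (- p * \<epsilon>) * h \<epsilon> - exp (- p * 0) * h 0) {0..\<epsilon>}"
    using \<open>0 \<le> \<epsilon>\<close>
  proof (rule fundamental_theorem_of_calculus)
    fix w assume "w \<in> {0..\<epsilon>}"
    then show "((\<lambda>w. exp (- p * w) * h w) has_vector_derivative
        exp (- p * w) * h' w - p * (exp (- p * w) * h w)) (at w within {0..\<epsilon>})"
      unfolding has_real_derivative_iff_has_vector_derivative[symmetric]
      by (auto intro!: derivative_eq_intros h)
  qed
  then have "integral {0..\<epsilon>} (\<lambda>w. exp (- p * w) * h' w - p * (exp (- p * w) * h w)) = exp (- p * \<epsilon>) * h \<epsilon> - h 0"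
    by (simp add: integral_unique)
  also have "integral {0..\<epsilon>} (\<lambda>w. exp (- p * w) * h' w - p * (exp (- p * w) * h w))
      = integral {0..\<epsilon>} (\<lambda>w. exp (- p * w) * h' w) - integral {0..\<epsilon>} (\<lambda>w. p * (exp (- p * w) * h w))"
    by (intro integral_diff integrable_continuous_interval continuous_intros hc h')
  finally show ?thesis by simp
qed

text \<open>
  Two integrations by parts give \<open>p M(t, 1 / p) = p b(t, 0) + b\<^sub>w(t, 0) + \<integral>\<^sub>0\<^sup>\<epsilon> exp (- p w) b\<^sub>w\<^sub>w(t, w) dw\<close> up to an error
  \<open>O(p exp (- p \<epsilon>))\<close>. The first term is normalised by the time change \<open>S\<close>, the second is removed by the
  factor \<open>exp (- C)\<close>, and the rest is the function \<open>N\<close> of the normal form.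
\<close>
theorem laplace_coefficient_uniqueness:
  fixes \<epsilon> :: real and M b G f :: "real \<Rightarrow> real \<Rightarrow> real"
  assumes \<epsilon>: "\<epsilon> > 0"
    and M: "\<And>t x. t \<in> {0..1} \<Longrightarrow> x \<in> {0<..1} \<Longrightarrow>
          M t x = 1 / x * integral {0..\<epsilon>} (\<lambda>w. exp (- w / x) * b t w) + exp (- \<epsilon> / x) * G t x"
    and M0: "\<And>t. t \<in> {0..1} \<Longrightarrow> (M t \<longlongrightarrow> M t 0) (at_right 0)"
    and b: "Ck_rect 3 {0..1} {0..\<epsilon>} b"
    and b_pos: "\<And>t. t \<in> {0..1} \<Longrightarrow> b t 0 > 0"
    and G: "continuous_on ({0..1} \<times> {0..1}) (\<lambda>(t, x). G t x)"
    and f: "continuous_on ({0..1} \<times> {0..1}) (\<lambda>(t, x). f t x)"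
    and eq: "satisfies_eq M f"
    and f0: "\<And>x. x \<in> {0..1} \<Longrightarrow> f 0 x = 0"
  shows "\<forall>t\<in>{0..1}. M t 0 = b t 0" "\<forall>t\<in>{0..1}. \<forall>x\<in>{0..1}. f t x = 0"
proof -
  obtain b1 where
    b1: "\<And>t w. t \<in> {0..1} \<Longrightarrow> w \<in> {0..\<epsilon>} \<Longrightarrow> (b t has_real_derivative b1 t w) (at w within {0..\<epsilon>})"
    and C2: "Ck_rect (Suc (Suc 0)) {0..1} {0..\<epsilon>} b1"
    by (rule Ck_rect_SucE[OF b[unfolded numeral_3_eq_3]]) blast
  obtain b2 where
    b2: "\<And>t w. t \<in> {0..1} \<Longrightarrow> w \<in> {0..\<epsilon>} \<Longrightarrow> (b1 t has_real_derivative b2 t w) (at w within {0..\<epsilon>})"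
    and C1: "Ck_rect (Suc 0) {0..1} {0..\<epsilon>} b2"
    by (rule Ck_rect_SucE[OF C2]) blast
  note b_cont = Ck_rect_continuous[OF b]
  note b1_cont = Ck_rect_continuous[OF C2]
  note b2_cont = Ck_rect_continuous[OF C1]
  have box: "compact ({0..1::real} \<times> {0..\<epsilon>})" "compact ({0..1::real} \<times> {0..1::real})"
    by (auto intro: compact_Times)
  obtain \<Lambda> where \<Lambda>: "0 \<le> \<Lambda>" "\<And>z. z \<in> {0..1} \<times> {0..\<epsilon>} \<Longrightarrow> \<bar>case z of (t, w) \<Rightarrow> b2 t w\<bar> \<le> \<Lambda>"
    using bounded_on_compact[OF box(1) b2_cont] by blast
  obtain Bb where Bb: "0 \<le> Bb" "\<And>z. z \<in> {0..1} \<times> {0..\<epsilon>} \<Longrightarrow> \<bar>case z of (t, w) \<Rightarrow> b t w\<bar> \<le> Bb"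
    using bounded_on_compact[OF box(1) b_cont] by blast
  obtain B1 where B1: "0 \<le> B1" "\<And>z. z \<in> {0..1} \<times> {0..\<epsilon>} \<Longrightarrow> \<bar>case z of (t, w) \<Rightarrow> b1 t w\<bar> \<le> B1"
    using bounded_on_compact[OF box(1) b1_cont] by blast
  obtain BG where BG: "0 \<le> BG" "\<And>z. z \<in> {0..1} \<times> {0..1} \<Longrightarrow> \<bar>case z of (t, x) \<Rightarrow> G t x\<bar> \<le> BG"
    using bounded_on_compact[OF box(2) G] by blast
  obtain F where F: "0 \<le> F" "\<And>z. z \<in> {0..1} \<times> {0..1} \<Longrightarrow> \<bar>case z of (t, x) \<Rightarrow> f t x\<bar> \<le> F"
    using bounded_on_compact[OF box(2) f] by blast
  define r where "r t p = exp (- p * \<epsilon>) * (p * G t (1 / p) - p * b t \<epsilon> - b1 t \<epsilon>)" for t p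
  define I where "I t p = integral {0..\<epsilon>} (\<lambda>w. exp (- p * w) * b2 t w)" for t p
  have M_expand: "p * M t (1 / p) = p * b t 0 + b1 t 0 + I t p + r t p"
    if t: "t \<in> {0..1}" and p: "1 \<le> p" for t p
  proof -
    have "M t (1 / p) = p * integral {0..\<epsilon>} (\<lambda>w. exp (- p * w) * b t w) + exp (- p * \<epsilon>) * G t (1 / p)"
      using M[OF t, of "1 / p"] p by (simp add: mult.commute)
    also have "p * integral {0..\<epsilon>} (\<lambda>w. exp (- p * w) * b t w)
        = b t 0 - exp (- p * \<epsilon>) * b t \<epsilon> + integral {0..\<epsilon>} (\<lambda>w. exp (- p * w) * b1 t w)"
      by (rule laplace_by_parts[OF b1[OF t] continuous_on_slice[OF b1_cont t]]) (use \<epsilon> in auto)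
    finally have Mt: "M t (1 / p) = b t 0 - exp (- p * \<epsilon>) * b t \<epsilon> + integral {0..\<epsilon>} (\<lambda>w. exp (- p * w) * b1 t w)
        + exp (- p * \<epsilon>) * G t (1 / p)" .
    have "p * M t (1 / p) = p * (b t 0 - exp (- p * \<epsilon>) * b t \<epsilon>)
        + p * integral {0..\<epsilon>} (\<lambda>w. exp (- p * w) * b1 t w) + p * (exp (- p * \<epsilon>) * G t (1 / p))"
      unfolding Mt by (simp only: distrib_left)
    also have "p * integral {0..\<epsilon>} (\<lambda>w. exp (- p * w) * b1 t w)
        = b1 t 0 - exp (- p * \<epsilon>) * b1 t \<epsilon> + I t p"
      unfolding I_def
      by (rule laplace_by_parts[OF b2[OF t] continuous_on_slice[OF b2_cont t]]) (use \<epsilon> in auto)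
    finally show ?thesis by (simp add: r_def algebra_simps)
  qed
  have I_bound: "\<bar>I t p\<bar> \<le> \<Lambda> * \<epsilon>" if t: "t \<in> {0..1}" and p: "1 \<le> p" for t p
    unfolding I_def
    by (rule abs_truncated_laplace_le[OF _ _ continuous_on_slice[OF b2_cont t]])
       (use \<epsilon> p t \<Lambda>(2)[of "(t, _)"] in auto)
  have r_bound: "\<bar>r t p\<bar> \<le> (BG + Bb + B1) * p * exp (- p * \<epsilon>)" if t: "t \<in> {0..1}" and p: "1 \<le> p" for t p
  proof -
    have "\<bar>p * G t (1 / p) - p * b t \<epsilon> - b1 t \<epsilon>\<bar> \<le> p * \<bar>G t (1 / p)\<bar> + p * \<bar>b t \<epsilon>\<bar> + 1 * \<bar>b1 t \<epsilon>\<bar>"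
    proof -
      have "\<bar>p * G t (1 / p)\<bar> = p * \<bar>G t (1 / p)\<bar>" "\<bar>p * b t \<epsilon>\<bar> = p * \<bar>b t \<epsilon>\<bar>"
        using p by (simp_all add: abs_mult)
      then show ?thesis by linarith
    qed
    also have "\<dots> \<le> p * BG + p * Bb + p * B1"
      using p t \<epsilon> BG(2)[of "(t, 1 / p)"] Bb(2)[of "(t, \<epsilon>)"] B1(2)[of "(t, \<epsilon>)"] BG(1) Bb(1) B1(1)
      by (intro add_mono mult_mono) auto
    finally have "exp (- p * \<epsilon>) * \<bar>p * G t (1 / p) - p * b t \<epsilon> - b1 t \<epsilon>\<bar> \<le> exp (- p * \<epsilon>) * (p * BG + p * Bb + p * B1)"
      by (rule mult_left_mono) simp
    also have "\<dots> = (BG + Bb + B1) * p * exp (- p * \<epsilon>)" by (simp add: algebra_simps)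
    finally show ?thesis by (simp only: r_def abs_mult abs_exp_cancel)
  qed
  show Mb: "\<forall>t\<in>{0..1}. M t 0 = b t 0"
  proof
    fix t :: real assume t: "t \<in> {0..1}"
    have "(\<lambda>n. M t (1 / real (Suc n))) \<longlonglongrightarrow> M t 0"
    proof (rule filterlim_compose[OF M0[OF t]])
      show "filterlim (\<lambda>n. 1 / real (Suc n)) (at_right 0) sequentially"
        by real_asymp
    qed
    moreover have "(\<lambda>n. M t (1 / real (Suc n))) \<longlonglongrightarrow> b t 0"
    proof -
      define C where "C = \<bar>b1 t 0\<bar> + \<Lambda> * \<epsilon>"
      have close: "\<bar>M t (1 / p) - b t 0\<bar> \<le> C / p + (BG + Bb + B1) * exp (- p * \<epsilon>)" if p: "1 \<le> p" for p
      proof -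
        have "p * \<bar>M t (1 / p) - b t 0\<bar> = \<bar>b1 t 0 + I t p + r t p\<bar>"
        proof -
          have "p * (M t (1 / p) - b t 0) = b1 t 0 + I t p + r t p"
            using M_expand[OF t p] by (simp add: right_diff_distrib)
          then have "\<bar>p * (M t (1 / p) - b t 0)\<bar> = \<bar>b1 t 0 + I t p + r t p\<bar>" by (simp only:)
          then show ?thesis using p by (simp add: abs_mult)
        qed
        also have "\<dots> \<le> C + (BG + Bb + B1) * p * exp (- p * \<epsilon>)"
          using I_bound[OF t p] r_bound[OF t p] unfolding C_def by linarith
        finally show ?thesis using p by (simp add: field_simps)
      qed
      have "norm (M t (1 / real (Suc n)) - b t 0) \<le> C / real (Suc n) + (BG + Bb + B1) * exp (- real (Suc n) * \<epsilon>)" for n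
        using close[of "real (Suc n)"] by (simp del: of_nat_Suc)
      moreover have "(\<lambda>n. C / real (Suc n) + (BG + Bb + B1) * exp (- real (Suc n) * \<epsilon>)) \<longlonglongrightarrow> 0"
        using \<epsilon> by real_asymp
      ultimately have "(\<lambda>n. M t (1 / real (Suc n)) - b t 0) \<longlonglongrightarrow> 0"
        by (rule Lim_null_comparison[OF always_eventually[OF allI]])
      then show ?thesis by (simp add: LIM_zero_iff)
    qed
    ultimately show "M t 0 = b t 0" by (rule LIMSEQ_unique)
  qed
  have b0_cont: "continuous_on {0..1} (\<lambda>t. b t 0)"
    using \<epsilon> by (intro continuous_on_compose_pair[OF b_cont] continuous_intros) auto
  obtain T S where TS: "0 < T" "S 0 = 0" "\<And>\<tau>. \<tau> \<in> {0..T} \<Longrightarrow> S \<tau> \<in> {0..1}"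
    and S_deriv: "\<And>\<tau>. \<tau> \<in> {0..T} \<Longrightarrow> (S has_real_derivative 1 / b (S \<tau>) 0) (at \<tau> within {0..T})"
    and S_onto: "\<And>t. t \<in> {0..1} \<Longrightarrow> \<exists>\<tau>\<in>{0..T}. S \<tau> = t"
    using time_change[OF b0_cont b_pos] by metis
  have S_cont: "continuous_on {0..T} S" by (rule DERIV_continuous_on[OF S_deriv])
  define c where "c \<tau> = b1 (S \<tau>) 0 / b (S \<tau>) 0" for \<tau>
  define C where "C \<tau> = integral {0..\<tau>} c" for \<tau>
  have bS_cont: "continuous_on {0..T} (\<lambda>\<tau>. b (S \<tau>) 0)"
    using TS(3) \<epsilon> by (intro continuous_on_compose_pair[OF b_cont] S_cont continuous_intros) auto
  have bS: "b (S \<tau>) 0 \<noteq> 0" "0 < b (S \<tau>) 0" if "\<tau> \<in> {0..T}" for \<tau>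
    using b_pos[OF TS(3)[OF that]] by auto
  have c_cont: "continuous_on {0..T} c"
    unfolding c_def using TS(3) \<epsilon> bS(1)
    by (intro continuous_on_divide bS_cont continuous_on_compose_pair[OF b1_cont] S_cont continuous_intros) auto
  have C_deriv: "(C has_real_derivative c \<tau>) (at \<tau> within {0..T})" if "\<tau> \<in> {0..T}" for \<tau>
    unfolding C_def by (intro integral_has_real_derivative c_cont that)
  have C_cont: "continuous_on {0..T} C" by (rule DERIV_continuous_on[OF C_deriv])
  obtain m where m: "0 < m" "\<And>\<tau>. \<tau> \<in> {0..T} \<Longrightarrow> m \<le> b (S \<tau>) 0"
  proof -
    obtain \<tau>0 where "\<tau>0 \<in> {0..T}" "\<forall>\<tau>\<in>{0..T}. b (S \<tau>0) 0 \<le> b (S \<tau>) 0"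
      using continuous_attains_inf[OF compact_Icc _ bS_cont] TS(1) by auto
    with that[of "b (S \<tau>0) 0"] bS show ?thesis by auto
  qed
  obtain X where X: "0 \<le> X" "\<And>\<tau>. \<tau> \<in> {0..T} \<Longrightarrow> \<bar>exp (- C \<tau>)\<bar> \<le> X"
    using bounded_on_compact[OF compact_Icc, of 0 T "\<lambda>\<tau>. exp (- C \<tau>)"] C_cont
    by (metis continuous_on_exp continuous_on_minus)
  have zero: "exp (- C \<tau>) * f (S \<tau>) (1 / p) = 0" if \<tau>: "\<tau> \<in> {0..T}" and p: "1 \<le> p" for \<tau> p
  proof (rule normalized_uniqueness[OF \<epsilon> _ _ _ _ _ _ _ \<tau> p,
        where \<beta>="\<lambda>\<tau> w. b2 (S \<tau>) w / b (S \<tau>) 0"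
          and N="\<lambda>\<tau> p. p * M (S \<tau>) (1 / p) / b (S \<tau>) 0 - p - c \<tau>"
          and f="\<lambda>\<tau> p. exp (- C \<tau>) * f (S \<tau>) (1 / p)"
          and a="\<lambda>\<tau>. exp (- C \<tau>) * f (S \<tau>) 0" and F="X * F" and K="(BG + Bb + B1) / m"])
    show "continuous_on ({0..T} \<times> {0..\<epsilon>}) (\<lambda>(\<tau>, w). b2 (S \<tau>) w / b (S \<tau>) 0)"
      unfolding split_beta
      by (intro continuous_on_divide continuous_on_compose_pair[OF b2_cont] continuous_on_compose2[OF bS_cont]
          continuous_on_compose2[OF S_cont] continuous_intros) (use TS(3) bS(1) in \<open>auto simp: mem_Times_iff\<close>)
    show "continuous_on {0..T} (\<lambda>\<tau>. exp (- C \<tau>) * f (S \<tau>) 0)"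
      by (intro continuous_intros C_cont continuous_on_compose_pair[OF f] S_cont) (use TS(3) in auto)
    show "exp (- C 0) * f (S 0) (1 / p) = 0" if "1 \<le> p" for p
      using TS(2) f0[of "1 / p"] that by simp
    fix \<tau> p :: real assume \<tau>: "\<tau> \<in> {0..T}" and p: "1 \<le> p"
    note s = TS(3)[OF \<tau>]
    have px: "1 / p \<in> {0<..1}" "1 / p \<in> {0..1}" using p by auto
    have "p * M (S \<tau>) (1 / p) / b (S \<tau>) 0 = p + c \<tau> + I (S \<tau>) p / b (S \<tau>) 0 + r (S \<tau>) p / b (S \<tau>) 0"
      unfolding M_expand[OF s p] c_def using bS[OF \<tau>] by (simp add: add_divide_distrib)
    then have "p * M (S \<tau>) (1 / p) / b (S \<tau>) 0 - p - c \<tau> - integral {0..\<epsilon>} (\<lambda>w. exp (- p * w) * (b2 (S \<tau>) w / b (S \<tau>) 0))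
        = r (S \<tau>) p / b (S \<tau>) 0"
      by (simp add: I_def)
    also have "\<bar>\<dots>\<bar> \<le> (BG + Bb + B1) * p * exp (- p * \<epsilon>) / m"
      unfolding abs_divide using r_bound[OF s p] m(1) m(2)[OF \<tau>] BG(1) Bb(1) B1(1) p
      by (intro frac_le) auto
    finally show "\<bar>p * M (S \<tau>) (1 / p) / b (S \<tau>) 0 - p - c \<tau> - integral {0..\<epsilon>} (\<lambda>w. exp (- p * w) * (b2 (S \<tau>) w / b (S \<tau>) 0))\<bar>
        \<le> (BG + Bb + B1) / m * p * exp (- p * \<epsilon>)" by (simp add: mult_ac)
    have "\<bar>exp (- C \<tau>)\<bar> * \<bar>f (S \<tau>) (1 / p)\<bar> \<le> X * F"
      using X(2)[OF \<tau>] X(1) F(2)[of "(S \<tau>, 1 / p)"] s px by (intro mult_mono) auto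
    then show "\<bar>exp (- C \<tau>) * f (S \<tau>) (1 / p)\<bar> \<le> X * F" by (simp add: abs_mult)
    have "((\<lambda>s. f s (1 / p)) has_real_derivative
        (M (S \<tau>) (1 / p) * f (S \<tau>) (1 / p) - M (S \<tau>) 0 * f (S \<tau>) 0) / (1 / p)) (at (S \<tau>) within {0..1})"
      using eq s px(1) unfolding satisfies_eq_def by blast
    then have "((\<lambda>s. f s (1 / p)) has_real_derivative
        (M (S \<tau>) (1 / p) * f (S \<tau>) (1 / p) - b (S \<tau>) 0 * f (S \<tau>) 0) * p) (at (S \<tau>) within {0..1})"
      using Mb s by simp
    then have "((\<lambda>s. f s (1 / p)) has_real_derivative
        (M (S \<tau>) (1 / p) * f (S \<tau>) (1 / p) - b (S \<tau>) 0 * f (S \<tau>) 0) * p) (at (S \<tau>) within S ` {0..T})"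
      by (rule DERIV_subset[OF _ image_subsetI[OF TS(3)]])
    from DERIV_image_chain[OF this S_deriv[OF \<tau>]]
    have "((\<lambda>\<tau>. f (S \<tau>) (1 / p)) has_real_derivative
        (M (S \<tau>) (1 / p) * f (S \<tau>) (1 / p) - b (S \<tau>) 0 * f (S \<tau>) 0) * p * (1 / b (S \<tau>) 0)) (at \<tau> within {0..T})"
      by (simp add: o_def)
    then have "((\<lambda>\<tau>. exp (- C \<tau>) * f (S \<tau>) (1 / p)) has_real_derivative
        exp (- C \<tau>) * (- c \<tau>) * f (S \<tau>) (1 / p) + exp (- C \<tau>) *
        ((M (S \<tau>) (1 / p) * f (S \<tau>) (1 / p) - b (S \<tau>) 0 * f (S \<tau>) 0) * p * (1 / b (S \<tau>) 0))) (at \<tau> within {0..T})"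
      by (auto intro!: derivative_eq_intros C_deriv[OF \<tau>])
    also have "exp (- C \<tau>) * (- c \<tau>) * f (S \<tau>) (1 / p) + exp (- C \<tau>) *
        ((M (S \<tau>) (1 / p) * f (S \<tau>) (1 / p) - b (S \<tau>) 0 * f (S \<tau>) 0) * p * (1 / b (S \<tau>) 0))
      = p * (exp (- C \<tau>) * f (S \<tau>) (1 / p) - exp (- C \<tau>) * f (S \<tau>) 0)
        + (p * M (S \<tau>) (1 / p) / b (S \<tau>) 0 - p - c \<tau>) * (exp (- C \<tau>) * f (S \<tau>) (1 / p))"
      using bS[OF \<tau>] by (simp add: field_simps)
    finally show "((\<lambda>\<tau>. exp (- C \<tau>) * f (S \<tau>) (1 / p)) has_real_derivative
        p * (exp (- C \<tau>) * f (S \<tau>) (1 / p) - exp (- C \<tau>) * f (S \<tau>) 0)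
        + (p * M (S \<tau>) (1 / p) / b (S \<tau>) 0 - p - c \<tau>) * (exp (- C \<tau>) * f (S \<tau>) (1 / p))) (at \<tau> within {0..T})" .
  next
    fix p :: real assume p: "1 \<le> p"
    have "continuous_on {0..T} (\<lambda>\<tau>. (p * b (S \<tau>) 0 + b1 (S \<tau>) 0 + I (S \<tau>) p + r (S \<tau>) p) / b (S \<tau>) 0 - p - c \<tau>)"
    proof -
      have "continuous_on ({0..T} \<times> cbox 0 \<epsilon>) (\<lambda>(\<tau>, w). exp (- p * w) * b2 (S \<tau>) w)"
        unfolding split_beta
        by (intro continuous_on_mult continuous_on_compose_pair[OF b2_cont] continuous_on_compose2[OF S_cont] continuous_intros)
           (use TS(3) in \<open>auto simp: mem_Times_iff\<close>)
      from integral_continuous_on_param[OF this]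
      have "continuous_on {0..T} (\<lambda>\<tau>. I (S \<tau>) p)" by (simp add: I_def)
      moreover have "continuous_on {0..T} (\<lambda>\<tau>. r (S \<tau>) p)"
        unfolding r_def
        by (intro continuous_intros continuous_on_compose_pair[OF b_cont] continuous_on_compose_pair[OF b1_cont]
            continuous_on_compose_pair[OF G] S_cont) (use TS(3) \<epsilon> p in auto)
      moreover have "continuous_on {0..T} (\<lambda>\<tau>. b1 (S \<tau>) 0)"
        by (intro continuous_on_compose_pair[OF b1_cont] S_cont continuous_intros) (use TS(3) \<epsilon> in auto)
      ultimately show ?thesis
        using bS(1) by (intro continuous_intros bS_cont c_cont) auto
    qed
    then show "continuous_on {0..T} (\<lambda>\<tau>. p * M (S \<tau>) (1 / p) / b (S \<tau>) 0 - p - c \<tau>)"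
      by (rule continuous_on_eq) (simp add: M_expand[OF TS(3) p])
  qed
  show "\<forall>t\<in>{0..1}. \<forall>x\<in>{0..1}. f t x = 0"
  proof (intro ballI)
    fix t x :: real assume t: "t \<in> {0..1}" and x: "x \<in> {0..1}"
    obtain \<tau> where \<tau>: "\<tau> \<in> {0..T}" "S \<tau> = t" using S_onto[OF t] by blast
    have pos: "f t y = 0" if "y \<in> {0<..<1}" for y
      using zero[OF \<tau>(1), of "1 / y"] that \<tau>(2) by simp
    show "f t x = 0"
      using continuous_constant_on_closure[of "{0<..<1}" "f t" 0 x] continuous_on_slice[OF f t] pos x
      by (simp add: closure_greaterThanLessThan)
  qed
qed

theorem theorem1p1:
  shows
   "(\<exists>M f :: real \<Rightarrow> real \<Rightarrow> real.
       Cinf_rect {0..1} {0..1} M \<and> Cinf_rect {0..1} {0..1} f \<and>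
       satisfies_eq M f \<and>
       (\<forall>t\<in>{0..1}. \<forall>x\<in>{0..1}. M t x > 0) \<and>
       (\<exists>t\<in>{0..1}. f t 0 \<noteq> 0) \<and>
       (\<forall>x\<in>{0..1}. f 0 x = 0 \<and> f 1 x = 0))
    \<and>
    (\<forall>(\<epsilon> :: real) (M :: real \<Rightarrow> real \<Rightarrow> real) (b :: real \<Rightarrow> real \<Rightarrow> real)
        (G :: real \<Rightarrow> real \<Rightarrow> real) (f :: real \<Rightarrow> real \<Rightarrow> real).
       \<epsilon> > 0 \<longrightarrow>
       (\<forall>t\<in>{0..1}. \<forall>x\<in>{0<..1}.
          M t x = 1 / x * integral {0..\<epsilon>} (\<lambda>w. exp (- w / x) * b t w)
                  + exp (- \<epsilon> / x) * G t x) \<longrightarrow>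
       (\<forall>t\<in>{0..1}. (M t \<longlongrightarrow> M t 0) (at_right 0)) \<longrightarrow>
       Ck_rect 3 {0..1} {0..\<epsilon>} b \<longrightarrow>
       (\<forall>t\<in>{0..1}. b t 0 > 0) \<longrightarrow>
       continuous_on ({0..1} \<times> {0..1}) (\<lambda>(t, x). G t x) \<longrightarrow>
       continuous_on ({0..1} \<times> {0..1}) (\<lambda>(t, x). f t x) \<longrightarrow>
       satisfies_eq M f \<longrightarrow>
       (\<forall>x\<in>{0..1}. f 0 x = 0) \<longrightarrow>
       Ck_interval 2 {0..1} (\<lambda>t. f t 0) \<longrightarrow>
       (\<forall>t\<in>{0..1}. M t 0 = b t 0) \<and>
       (\<forall>t\<in>{0..1}. \<forall>x\<in>{0..1}. f t x = 0))"
proof (intro conjI, rule nonuniqueness, intro allI impI)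
  fix \<epsilon> :: real and M b G f :: "real \<Rightarrow> real \<Rightarrow> real"
  assume "\<epsilon> > 0"
    "\<forall>t\<in>{0..1}. \<forall>x\<in>{0<..1}. M t x = 1 / x * integral {0..\<epsilon>} (\<lambda>w. exp (- w / x) * b t w) + exp (- \<epsilon> / x) * G t x"
    "\<forall>t\<in>{0..1}. (M t \<longlongrightarrow> M t 0) (at_right 0)"
    "Ck_rect 3 {0..1} {0..\<epsilon>} b" "\<forall>t\<in>{0..1}. b t 0 > 0"
    "continuous_on ({0..1} \<times> {0..1}) (\<lambda>(t, x). G t x)"
    "continuous_on ({0..1} \<times> {0..1}) (\<lambda>(t, x). f t x)"
    "satisfies_eq M f" "\<forall>x\<in>{0..1}. f 0 x = 0"
  note hyps = this
  show "(\<forall>t\<in>{0..1}. M t 0 = b t 0) \<and> (\<forall>t\<in>{0..1}. \<forall>x\<in>{0..1}. f t x = 0)"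
    using laplace_coefficient_uniqueness[OF hyps(1) hyps(2)[rule_format] hyps(3)[rule_format] hyps(4)
        hyps(5)[rule_format] hyps(6-8) hyps(9)[rule_format]]
    by blast
qed

end
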